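(* Let $(\nu_n)_{n\ge 1}$ be a sequence of strictly aperiodic probability measures on $\mathbb{Z}$ such that (1) $E(\nu_n)=0$ for all $n$; (2) $\sum_{i=1}^{n} m_2(\nu_i)^2 = O(n)$; (3) there exist a constant $c>0$ and an integer $N_0>0$ such that $|\hat\nu_n(t)|\le e^{-ct^2}$ for all $n>N_0$ and all $t\in[-1/2,1/2)$. Let $\mu_n=\nu_1*\cdots*\nu_n$. Let $(X,\Sigma,m)$ be a probability space, $T:X\to X$ an invertible measure preserving transformation, and $\mu_n f(x)=\sum_{j\in\mathbb{Z}}\mu_n(j)f(T^jx)$. Let $2<s<\infty$ and let $(n_k)_{k\ge1}$ be an increasing sequence of positive integers, with $\|\cdot\|_{o(2)}$ the associated oscillation norm. Then there is a constant $C$ such that for all $f\in L^2(X)$ $$\big\|\,\|\mu_n f\|_{v(s)}\,\big\|_{2}\le C\|f\|_2\qquad\text{and}\qquad \big\|\,\|\mu_n f\|_{o(2)}\,\big\|_{2}\le C\|f\|_2 .$$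
   Context: A probability measure $\nu$ on $\mathbb{Z}$ is strictly aperiodic if its support is not contained in a coset of a proper subgroup of $\mathbb{Z}$. $m_p(\nu)=\sum_{k\in\mathbb{Z}}|k|^p\nu(k)$, $E(\nu)=\sum_{k\in\mathbb{Z}}k\,\nu(k)$, and $\hat\nu(t)=\sum_{k\in\mathbb{Z}}\nu(k)e^{-2\pi i k t}$. Convolution: $\nu_1*\nu_2(k)=\sum_{j\in\mathbb{Z}}\nu_1(j)\nu_2(k-j)$. For a sequence of numbers $(x_n)_{n\ge1}$ and $1\le\rho<\infty$, $\|x_n\|_{v(\rho)}=\sup\big(\sum_{j=1}^\infty|x_{n(j)}-x_{n(j+1)}|^\rho\big)^{1/\rho}$, the supremum over all sequences of positive integers $n(1)\le n(2)\le\cdots$. For an increasing sequence of positive integers $(n_k)_{k\ge1}$, $\|x_n\|_{o(s)}=\big(\sum_{k=1}^\infty\max_{n_k\le n\le n_{k+1}}|x_n-x_{n_k}|^s\big)^{1/s}$. The quantities $\|\mu_nf\|_{v(s)}$ and $\|\mu_nf\|_{o(2)}$ are the functions $x\mapsto\|\mu_nf(x)\|_{v(s)}$ and $x\mapsto\|\mu_nf(x)\|_{o(2)}$ on $X$ (norms taken in the variable $n$), and the outer $\|\cdot\|_2$ is the $L^2(X)$ norm. *)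

theory Defs
  imports "HOL-Probability.Probability" "HOL-Algebra.Elementary_Groups"
begin

text \<open>Probability measures on the integers are elements of \<^typ>\<open>int pmf\<close>.\<close>

definition strictly_aperiodic :: "int pmf \<Rightarrow> bool" where
  "strictly_aperiodic \<nu> \<longleftrightarrow>
     \<not> (\<exists>H C. subgroup H integer_group \<and> H \<noteq> UNIV \<and>
            C \<in> rcosets\<^bsub>integer_group\<^esub> H \<and> set_pmf \<nu> \<subseteq> C)"

text \<open>The absolute moments are \<^typ>\<open>ennreal\<close>-valued, so an infinite moment has value \<^term>\<open>\<infinity> :: ennreal\<close>.\<close>

definition abs_moment :: "nat \<Rightarrow> int pmf \<Rightarrow> ennreal" where
  "abs_moment p \<nu> = (\<Sum>\<^sub>\<infinity>k. ennreal (real_of_int (\<bar>k\<bar> ^ p) * pmf \<nu> k))"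

text \<open>The series below has value 0 by convention when it does not converge absolutely;
  it does converge absolutely whenever the second moment is finite.\<close>

definition mean :: "int pmf \<Rightarrow> real" where
  "mean \<nu> = (\<Sum>\<^sub>\<infinity>k. real_of_int k * pmf \<nu> k)"

definition fourier :: "int pmf \<Rightarrow> real \<Rightarrow> complex" where
  "fourier \<nu> t = (\<Sum>\<^sub>\<infinity>k. of_real (pmf \<nu> k) * exp (- 2 * of_real pi * \<i> * of_int k * of_real t))"

definition conv :: "(int \<Rightarrow> real) \<Rightarrow> (int \<Rightarrow> real) \<Rightarrow> int \<Rightarrow> real" where
  "conv a b k = (\<Sum>\<^sub>\<infinity>j. a j * b (k - j))"

text \<open>\<open>conv_prod \<nu> n\<close> is \<open>\<nu> 1 * \<dots> * \<nu> n\<close>; the empty convolution is the unit mass at 0, and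
  \<open>\<nu> 0\<close> is never used.\<close>

primrec conv_prod :: "(nat \<Rightarrow> int pmf) \<Rightarrow> nat \<Rightarrow> int \<Rightarrow> real" where
  "conv_prod \<nu> 0 = (\<lambda>k. if k = 0 then 1 else 0)"
| "conv_prod \<nu> (Suc n) = conv (conv_prod \<nu> n) (pmf (\<nu> (Suc n)))"

definition invertible_measure_preserving :: "'a measure \<Rightarrow> ('a \<Rightarrow> 'a) \<Rightarrow> bool" where
  "invertible_measure_preserving M T \<longleftrightarrow>
     T \<in> measurable M M \<and> bij_betw T (space M) (space M) \<and>
     inv_into (space M) T \<in> measurable M M \<and> distr M M T = M"

definition int_iterate :: "'a measure \<Rightarrow> ('a \<Rightarrow> 'a) \<Rightarrow> int \<Rightarrow> 'a \<Rightarrow> 'a" where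
  "int_iterate M T j = (if 0 \<le> j then T ^^ nat j else inv_into (space M) T ^^ nat (- j))"

text \<open>For \<open>f\<close> in \<open>L\<^sup>2\<close> and a probability measure \<open>\<mu>\<close> the series converges absolutely for
  almost every \<open>x\<close>; elsewhere the value is 0 by convention.\<close>

definition weighted_average ::
  "'a measure \<Rightarrow> ('a \<Rightarrow> 'a) \<Rightarrow> (int \<Rightarrow> real) \<Rightarrow> ('a \<Rightarrow> complex) \<Rightarrow> 'a \<Rightarrow> complex" where
  "weighted_average M T \<mu> f x = (\<Sum>\<^sub>\<infinity>j. of_real (\<mu> j) * f (int_iterate M T j x))"

text \<open>Powers on \<open>[0, \<infinity>]\<close>, for exponents \<open>a > 0\<close> only.\<close>

definition enn_powr :: "ennreal \<Rightarrow> real \<Rightarrow> ennreal" where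
  "enn_powr x a = (if x = \<infinity> then \<infinity> else ennreal (enn2real x powr a))"

text \<open>A sequence \<open>(x\<^sub>n)\<close> with \<open>n \<ge> 1\<close> is a function on \<^typ>\<open>nat\<close> whose value at 0 is ignored.
  The sequences of indices (\<open>r\<close> and \<open>N\<close> below) are numbered from 0 instead of 1, while
  their values are positive.\<close>

definition variation_norm :: "real \<Rightarrow> (nat \<Rightarrow> complex) \<Rightarrow> ennreal" where
  "variation_norm \<rho> x =
     (SUP r \<in> {r :: nat \<Rightarrow> nat. mono r \<and> (\<forall>j. 0 < r j)}.
        enn_powr (\<Sum>j. ennreal (norm (x (r j) - x (r (Suc j))) powr \<rho>)) (1 / \<rho>))"

definition oscillation_norm :: "(nat \<Rightarrow> nat) \<Rightarrow> real \<Rightarrow> (nat \<Rightarrow> complex) \<Rightarrow> ennreal" where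
  "oscillation_norm N s x =
     enn_powr (\<Sum>k. ennreal (Max ((\<lambda>n. norm (x n - x (N k)) powr s) ` {N k..N (Suc k)}))) (1 / s)"

text \<open>Only applied to measurable functions: the variation norm of a sequence of measurable
  functions is measurable, since the supremum over the uncountable set of index sequences
  equals the supremum over the countable set of eventually constant ones.\<close>

definition L2_norm :: "'a measure \<Rightarrow> ('a \<Rightarrow> ennreal) \<Rightarrow> ennreal" where
  "L2_norm M g = enn_powr (\<integral>\<^sup>+ x. (g x)\<^sup>2 \<partial>M) (1 / 2)"

definition in_L2 :: "'a measure \<Rightarrow> ('a \<Rightarrow> complex) \<Rightarrow> bool" where
  "in_L2 M f \<longleftrightarrow> f \<in> borel_measurable M \<and> L2_norm M (\<lambda>x. ennreal (norm (f x))) < \<infinity>"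

end

theory Submission
  imports Defs "HOL-Library.Real_Mod"
begin

text \<open>Let \<open>f\<close> be in \<open>L\<^sup>2\<close> and let \<open>y\<^sub>n\<close> be the averages of \<open>f\<close> over the \<open>n\<close>-step lazy random walk, i.e. the
  averages with symbol \<open>cos(\<pi> t)\<^bsup>2n\<^esup>\<close>. The difference \<open>g\<^sub>n = \<mu>\<^sub>n f - y\<^sub>n\<close> satisfies
  \<open>|g\<^sub>b - g\<^sub>a|\<^sup>2 \<le> 16 \<Sum>\<^bsub>a\<le>n<b\<^esub> (n |g\<^sub>n\<^sub>+\<^sub>1 - g\<^sub>n|\<^sup>2 + |g\<^sub>n|\<^sup>2 / n)\<close>, and the right-hand side is additive over intervals, so
  it bounds the 2-variation. Its integral is controlled on the Fourier side: with \<open>\<theta> = t\<^sup>2\<close> the symbols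
  are at most \<open>A exp(-c n \<theta>)\<close> and differ from 1 by \<open>O(n \<theta>)\<close>, and the growth of the sums of
  \<open>m\<^sub>2(\<nu>\<^sub>i)\<^sup>2\<close> handles the weighted increments by Abel summation.

  The averages \<open>y\<^sub>n\<close> are, by Rota's dilation, conditional expectations of a reverse martingale on
  \<open>X \<times> {0,1}\<^sup>L\<close>, which after a measure preserving change of variables becomes, for each point of \<open>X\<close>,
  a martingale of coin tosses. Its oscillation is bounded by Doob's inequality. Its \<open>s\<close>-variation is
  bounded pathwise by the running maximum and the energies of the martingale stopped
  at jumps of size \<open>2\<^sup>-\<^sup>m\<close> times the running maximum.\<close>

section \<open>Additive control of the 2-variation\<close>

text \<open>The additive bound fails for \<open>\<mu>\<^sub>n f\<close> itself: its symbol stays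
  near 1 while n t^2 is small, so the sum of the squared symbols divided by n grows like log(1/t^2)
  as t tends to 0. Subtracting a reference process with the same parabolic scaling repairs this,
  since the two symbols then differ by O(n t^2) for small n and by an exponentially small amount for
  large n. The lazy walk is chosen because its symbol is the squared modulus of (1 + e^(2 pi i
  t))/2, the shape that Rota's dilation asks for, and because laziness keeps the symbol away from
  -1. The 2-variation of a martingale is in general not controlled by its L2 norm, hence s > 2;
  oscillation survives at exponent 2 because squared norms telescope over the blocks. The dilation
  needs the number L of tosses in advance and the pathwise bounds have no evident monotonicity in L,
  hence a liminf and Fatou's lemma. No spectral measure is constructed: nonnegative weights on
  finite grids, with total mass the squared norm of f, take its place.\<close>

lemma powr_convex_combination:
  fixes a b :: real
  assumes s: "1 \<le> s" and ab: "0 \<le> a" "0 \<le> b" and l: "0 \<le> l" "l \<le> 1"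
  shows "(l * a + (1 - l) * b) powr s \<le> l * a powr s + (1 - l) * b powr s"
proof -
  have shrink: "(u * c) powr s \<le> u * c powr s" if "0 \<le> u" "u \<le> 1" "0 \<le> c" for u c :: real
  proof -
    have "u powr s \<le> u powr 1" using that s by (intro powr_mono') auto
    then show ?thesis using that by (simp add: powr_mult mult_right_mono)
  qed
  consider "a = 0" | "b = 0" | "a > 0" "b > 0" using ab by linarith
  then show ?thesis
  proof cases
    case 1
    then show ?thesis using shrink[of "1 - l" b] ab l s by simp
  next
    case 2
    then show ?thesis using shrink[of l a] ab l s by simp
  next
    case 3
    then show ?thesis using convex_onD[OF powr_convex[OF s], of "1 - l" a b] l by simp
  qed
qed

text \<open>Minkowski's inequality in l^s. Upper bounds \<open>h\<close> and \<open>k\<close> stand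
  in place of the norms so that it iterates over a finite family. After scaling, the sum is
  \<open>h + k\<close> times a convex combination with weight \<open>h / (h + k)\<close>, and
  convexity applies term by term.\<close>

lemma sum_norm_add_powr_le:
  fixes a b :: "'i \<Rightarrow> 'v::real_normed_vector"
  assumes s: "1 \<le> s" and h: "0 \<le> h" and k: "0 \<le> k" and I: "finite I"
    and a: "(\<Sum>i\<in>I. norm (a i) powr s) \<le> h powr s"
    and b: "(\<Sum>i\<in>I. norm (b i) powr s) \<le> k powr s"
  shows "(\<Sum>i\<in>I. norm (a i + b i) powr s) \<le> (h + k) powr s"
proof -
  have zero: "c i = 0" if "(\<Sum>i\<in>I. norm (c i) powr s) \<le> 0" "i \<in> I" for i and c :: "'i \<Rightarrow> 'v"
  proof -
    have "norm (c i) powr s \<le> (\<Sum>i\<in>I. norm (c i) powr s)"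
      by (rule member_le_sum) (use that I in auto)
    with that have "norm (c i) powr s \<le> 0" by linarith
    then show ?thesis by (simp add: powr_def split: if_splits)
  qed
  consider "h = 0" | "k = 0" | "h > 0" "k > 0" using h k by linarith
  then show ?thesis
  proof cases
    case 1
    with a have "\<And>i. i \<in> I \<Longrightarrow> a i = 0" using zero[of a] by simp
    then have "(\<Sum>i\<in>I. norm (a i + b i) powr s) = (\<Sum>i\<in>I. norm (b i) powr s)" by simp
    with b 1 show ?thesis by simp
  next
    case 2
    with b have "\<And>i. i \<in> I \<Longrightarrow> b i = 0" using zero[of b] by simp
    then have "(\<Sum>i\<in>I. norm (a i + b i) powr s) = (\<Sum>i\<in>I. norm (a i) powr s)" by simp
    with a 2 show ?thesis by simp
  next
    case 3
    define l where "l = h / (h + k)"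
    have l: "0 \<le> l" "l \<le> 1" "1 - l = k / (h + k)" using 3 by (auto simp: l_def field_simps)
    have hk: "(h + k) * l = h" "(h + k) * (1 - l) = k" using 3 by (auto simp: l(3)) (simp add: l_def)
    have pt: "norm (a i + b i) powr s \<le>
        (h + k) powr s * (l * (norm (a i) powr s / h powr s) + (1 - l) * (norm (b i) powr s / k powr s))" for i
    proof -
      have eq: "norm (a i) + norm (b i) = (h + k) * (l * (norm (a i) / h) + (1 - l) * (norm (b i) / k))"
        using 3 by (simp add: distrib_left mult.assoc[symmetric] hk)
      have "norm (a i + b i) powr s \<le> (norm (a i) + norm (b i)) powr s"
        using s by (intro powr_mono2) (auto simp: norm_triangle_ineq)
      also have "\<dots> = (h + k) powr s * (l * (norm (a i) / h) + (1 - l) * (norm (b i) / k)) powr s"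
        unfolding eq using 3 l by (subst powr_mult) auto
      also have "\<dots> \<le> (h + k) powr s * (l * (norm (a i) / h) powr s + (1 - l) * (norm (b i) / k) powr s)"
        using s l 3 by (intro mult_left_mono powr_convex_combination) auto
      finally show ?thesis using 3 by (simp add: powr_divide)
    qed
    have "(\<Sum>i\<in>I. norm (a i + b i) powr s) \<le> (\<Sum>i\<in>I. (h + k) powr s *
        (l * (norm (a i) powr s / h powr s) + (1 - l) * (norm (b i) powr s / k powr s)))"
      by (intro sum_mono pt)
    also have "\<dots> = (h + k) powr s * (l * ((\<Sum>i\<in>I. norm (a i) powr s) / h powr s)
        + (1 - l) * ((\<Sum>i\<in>I. norm (b i) powr s) / k powr s))"
      by (simp only: sum_distrib_left[symmetric] sum.distrib sum_divide_distrib[symmetric])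
    also have "\<dots> \<le> (h + k) powr s * (l * 1 + (1 - l) * 1)"
      using a b l 3 by (intro mult_left_mono add_mono) (auto simp: divide_le_eq)
    finally show ?thesis by simp
  qed
qed

lemma sum_norm_sum_powr_le:
  fixes a :: "'w \<Rightarrow> 'i \<Rightarrow> 'v::real_normed_vector"
  assumes s: "1 \<le> s" and I: "finite I" and W: "finite W"
    and h: "\<And>w. w \<in> W \<Longrightarrow> 0 \<le> h w"
    and a: "\<And>w. w \<in> W \<Longrightarrow> (\<Sum>i\<in>I. norm (a w i) powr s) \<le> h w powr s"
  shows "(\<Sum>i\<in>I. norm (\<Sum>w\<in>W. a w i) powr s) \<le> (\<Sum>w\<in>W. h w) powr s"
  using W h a
proof (induction W rule: finite_induct)
  case empty
  then show ?case by simp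
next
  case (insert w W)
  have "(\<Sum>i\<in>I. norm (a w i + (\<Sum>w\<in>W. a w i)) powr s) \<le> (h w + (\<Sum>w\<in>W. h w)) powr s"
    by (rule sum_norm_add_powr_le[OF s _ _ I]) (use insert in \<open>auto intro!: sum_nonneg\<close>)
  then show ?case using insert by simp
qed

text \<open>Every norm is at most \<open>sqrt E\<close>, so a factor of exponent s - 2 can be pulled
  out: the contractive embedding of l^2 into l^s, which turns the additive square bound into one for
  the s-variation.\<close>

lemma sum_powr_le_of_sum_squares:
  fixes a :: "'i \<Rightarrow> 'v::real_normed_vector"
  assumes s: "2 \<le> s" and I: "finite I" and E: "(\<Sum>i\<in>I. (norm (a i))\<^sup>2) \<le> E"
  shows "(\<Sum>i\<in>I. norm (a i) powr s) \<le> (sqrt E) powr s"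
proof -
  have E0: "0 \<le> E" using E by (meson order_trans sum_nonneg zero_le_power2)
  have pt: "norm (a i) powr s \<le> (norm (a i))\<^sup>2 * (sqrt E) powr (s - 2)" if "i \<in> I" for i
  proof (cases "a i = 0")
    case False
    have "(norm (a i))\<^sup>2 \<le> (\<Sum>i\<in>I. (norm (a i))\<^sup>2)" by (rule member_le_sum) (use that I in auto)
    then have le: "norm (a i) \<le> sqrt E" using E by (intro real_le_rsqrt) linarith
    have "norm (a i) powr s = norm (a i) powr 2 * norm (a i) powr (s - 2)"
      by (subst powr_add[symmetric]) simp
    also have "\<dots> \<le> norm (a i) powr 2 * sqrt E powr (s - 2)"
      using s le by (intro mult_left_mono powr_mono2) auto
    finally show ?thesis using False by (simp add: powr_realpow)
  qed simp
  have "(\<Sum>i\<in>I. norm (a i) powr s) \<le> (\<Sum>i\<in>I. (norm (a i))\<^sup>2) * (sqrt E) powr (s - 2)"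
    unfolding sum_distrib_right by (intro sum_mono pt)
  also have "\<dots> \<le> E * (sqrt E) powr (s - 2)" using E by (intro mult_right_mono) auto
  also have "\<dots> = (sqrt E) powr s"
  proof (cases "E = 0")
    case False
    then have "E = sqrt E powr 2" using E0 by simp
    then have "E * (sqrt E) powr (s - 2) = sqrt E powr 2 * (sqrt E) powr (s - 2)" by simp
    also have "\<dots> = sqrt E powr s" by (simp flip: powr_add)
    finally show ?thesis .
  qed simp
  finally show ?thesis .
qed

section \<open>A discrete Sobolev estimate on dyadic blocks\<close>

lemma sum_increments_eq:
  fixes w :: "nat \<Rightarrow> 'b::comm_monoid_add"
  assumes "mono r"
  shows "(\<Sum>j<J. \<Sum>n\<in>{r j..<r (Suc j)}. w n) = (\<Sum>n\<in>{r 0..<r J}. w n)"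
proof (induction J)
  case (Suc J)
  have "r 0 \<le> r J" "r J \<le> r (Suc J)" using assms by (auto simp: monoD)
  with Suc show ?case by (simp add: sum.atLeastLessThan_concat)
qed simp

lemma sum_decrements_eq:
  fixes w :: "nat \<Rightarrow> 'b::comm_monoid_add"
  assumes "antimono r"
  shows "(\<Sum>j<J. \<Sum>n\<in>{r (Suc j)..<r j}. w n) = (\<Sum>n\<in>{r J..<r 0}. w n)"
proof (induction J)
  case (Suc J)
  have "r J \<le> r 0" "r (Suc J) \<le> r J" using assms by (auto simp: antimonoD)
  then have "(\<Sum>n\<in>{r (Suc J)..<r J}. w n) + (\<Sum>n\<in>{r J..<r 0}. w n) = (\<Sum>n\<in>{r (Suc J)..<r 0}. w n)"
    by (simp add: sum.atLeastLessThan_concat)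
  with Suc show ?case by (simp add: add.commute)
qed simp

text \<open>Discrete analogue of the H^1 energy of \<open>g\<close> in the variable log n. The term
  at n = 0 vanishes, since division by zero gives 0.\<close>

definition weighted_energy :: "(nat \<Rightarrow> complex) \<Rightarrow> nat \<Rightarrow> real" where
  "weighted_energy g n = real n * (norm (g (Suc n) - g n))\<^sup>2 + (norm (g n))\<^sup>2 / real n"

lemma weighted_energy_nonneg: "0 \<le> weighted_energy g n"
  by (simp add: weighted_energy_def)

text \<open>Cauchy-Schwarz: the interval has at most \<open>p\<close> terms and all its indices are
  at least \<open>p\<close>, so the number of terms is absorbed by the weight
  \<open>n\<close>.\<close>

lemma norm_diff_le_sum_energy_short:
  assumes "p \<le> a" "a \<le> b" "b \<le> q" "q \<le> 2 * p"
  shows "(norm (g b - g a))\<^sup>2 \<le> (\<Sum>n\<in>{p..<q}. real n * (norm (g (Suc n) - g n))\<^sup>2)"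
proof -
  have "g b - g a = (\<Sum>n\<in>{a..<b}. g (Suc n) - g n)" using assms by (simp add: sum_Suc_diff')
  then have "norm (g b - g a) \<le> (\<Sum>n\<in>{a..<b}. norm (g (Suc n) - g n))"
    by (metis norm_sum)
  then have "(norm (g b - g a))\<^sup>2 \<le> (\<Sum>n\<in>{a..<b}. norm (g (Suc n) - g n))\<^sup>2"
    by (intro power_mono) auto
  also have "\<dots> \<le> (\<Sum>n\<in>{a..<b}. (norm (g (Suc n) - g n))\<^sup>2) * real (card {a..<b})"
    by (rule sum_squared_le_sum_of_squares)
  also have "\<dots> \<le> (\<Sum>n\<in>{a..<b}. real n * (norm (g (Suc n) - g n))\<^sup>2)"
    unfolding sum_distrib_right using assms
    by (intro sum_mono) (subst mult.commute, intro mult_right_mono, auto)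
  also have "\<dots> \<le> (\<Sum>n\<in>{p..<q}. real n * (norm (g (Suc n) - g n))\<^sup>2)"
    using assms by (intro sum_mono2) auto
  finally show ?thesis .
qed

text \<open>Within the block all values differ from \<open>g e\<close> by at most
  \<open>sqrt D\<close>, so \<open>g e\<close> is compared with their average. The condition
  \<open>q \<le> 2 * (q - p) + 1\<close> gives \<open>n \<le> 2 * (q - p)\<close> on the block,
  which makes 1/n comparable to the averaging weight; the slack of 1 admits blocks that end at an
  odd number.\<close>

lemma norm_le_sum_energy:
  assumes "1 \<le> p" "p < q" "q \<le> 2 * p" "q \<le> 2 * (q - p) + 1" "p \<le> e" "e \<le> q"
  shows "(norm (g e))\<^sup>2 \<le> 4 * (\<Sum>n\<in>{p..<q}. weighted_energy g n)"
proof -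
  define D where "D = (\<Sum>n\<in>{p..<q}. real n * (norm (g (Suc n) - g n))\<^sup>2)"
  have D0: "0 \<le> D" by (simp add: D_def sum_nonneg)
  have 1: "(norm (g e))\<^sup>2 \<le> 2 * (norm (g n))\<^sup>2 + 2 * D" if "n \<in> {p..<q}" for n
  proof -
    have "(norm (g e - g n))\<^sup>2 \<le> D"
    proof (cases "n \<le> e")
      case True
      then show ?thesis unfolding D_def
        using that assms by (intro norm_diff_le_sum_energy_short) auto
    next
      case False
      then have "(norm (g n - g e))\<^sup>2 \<le> D" unfolding D_def
        using that assms by (intro norm_diff_le_sum_energy_short) auto
      then show ?thesis by (simp add: norm_minus_commute)
    qed
    moreover have "(norm (g e))\<^sup>2 \<le> 2 * (norm (g n))\<^sup>2 + 2 * (norm (g e - g n))\<^sup>2"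
    proof -
      have "norm (g e) \<le> norm (g n) + norm (g e - g n)" by (metis norm_triangle_sub)
      then have "(norm (g e))\<^sup>2 \<le> (norm (g n) + norm (g e - g n))\<^sup>2" by (intro power_mono) auto
      then show ?thesis
        using sum_squares_ge_zero[of "norm (g n) - norm (g e - g n)" 0]
        by (simp add: power2_eq_square algebra_simps)
    qed
    ultimately show ?thesis by linarith
  qed
  have qp: "real (q - p) > 0" using assms by simp
  have "real (q - p) * (norm (g e))\<^sup>2 = (\<Sum>n\<in>{p..<q}. (norm (g e))\<^sup>2)" by simp
  also have "\<dots> \<le> (\<Sum>n\<in>{p..<q}. 2 * (norm (g n))\<^sup>2 + 2 * D)" by (intro sum_mono 1)
  also have "\<dots> = 2 * (\<Sum>n\<in>{p..<q}. (norm (g n))\<^sup>2) + real (q - p) * (2 * D)"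
    by (simp add: sum.distrib sum_distrib_left)
  also have "(\<Sum>n\<in>{p..<q}. (norm (g n))\<^sup>2) \<le> (\<Sum>n\<in>{p..<q}. 2 * real (q - p) * ((norm (g n))\<^sup>2 / real n))"
  proof (intro sum_mono)
    fix n assume n: "n \<in> {p..<q}"
    with assms have "real n \<le> real (2 * (q - p))" by (intro of_nat_mono) auto
    then have "real n * (norm (g n))\<^sup>2 \<le> 2 * real (q - p) * (norm (g n))\<^sup>2"
      by (intro mult_right_mono) auto
    then show "(norm (g n))\<^sup>2 \<le> 2 * real (q - p) * ((norm (g n))\<^sup>2 / real n)"
      using n assms by (simp add: field_simps)
  qed
  also have "2 * (\<Sum>n\<in>{p..<q}. 2 * real (q - p) * ((norm (g n))\<^sup>2 / real n)) + real (q - p) * (2 * D)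
     = real (q - p) * (4 * (\<Sum>n\<in>{p..<q}. (norm (g n))\<^sup>2 / real n) + 2 * D)"
    by (simp only: sum_distrib_left[symmetric]) algebra
  finally have "(norm (g e))\<^sup>2 \<le> 4 * (\<Sum>n\<in>{p..<q}. (norm (g n))\<^sup>2 / real n) + 2 * D"
    using qp by simp
  also have "\<dots> \<le> 4 * (\<Sum>n\<in>{p..<q}. (norm (g n))\<^sup>2 / real n) + 4 * D" using D0 by simp
  also have "\<dots> = 4 * (\<Sum>n\<in>{p..<q}. weighted_energy g n)"
    by (simp add: D_def weighted_energy_def sum.distrib algebra_simps)
  finally show ?thesis .
qed

lemma norm_diff_le_sum_energy:
  assumes "1 \<le> a" "a \<le> b"
  shows "(norm (g b - g a))\<^sup>2 \<le> 16 * (\<Sum>n\<in>{a..<b}. weighted_energy g n)"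
proof (cases "b \<le> 2 * a")
  case True
  then have "(norm (g b - g a))\<^sup>2 \<le> (\<Sum>n\<in>{a..<b}. real n * (norm (g (Suc n) - g n))\<^sup>2)"
    using assms by (intro norm_diff_le_sum_energy_short) auto
  also have "\<dots> \<le> (\<Sum>n\<in>{a..<b}. weighted_energy g n)"
    by (intro sum_mono) (simp add: weighted_energy_def)
  also have "\<dots> \<le> 16 * (\<Sum>n\<in>{a..<b}. weighted_energy g n)"
    using sum_nonneg[of "{a..<b}" "weighted_energy g"] weighted_energy_nonneg by auto
  finally show ?thesis .
next
  case False
  \<comment> \<open>Past a doubling both end values are bounded separately, each on a dyadic block
    inside \<open>{a..<b}\<close>; 16 is 2 * 4 + 2 * 4.\<close>
  let ?S = "\<Sum>n\<in>{a..<b}. weighted_energy g n"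
  have "(norm (g a))\<^sup>2 \<le> 4 * (\<Sum>n\<in>{a..<2*a}. weighted_energy g n)"
    using assms by (intro norm_le_sum_energy) auto
  also have "(\<Sum>n\<in>{a..<2*a}. weighted_energy g n) \<le> ?S"
    using False by (intro sum_mono2) (auto simp: weighted_energy_nonneg)
  finally have A: "(norm (g a))\<^sup>2 \<le> 4 * ?S" by simp
  have "(norm (g b))\<^sup>2 \<le> 4 * (\<Sum>n\<in>{b - b div 2..<b}. weighted_energy g n)"
    using assms False by (intro norm_le_sum_energy) auto
  also have "(\<Sum>n\<in>{b - b div 2..<b}. weighted_energy g n) \<le> ?S"
    using False by (intro sum_mono2) (auto simp: weighted_energy_nonneg)
  finally have B: "(norm (g b))\<^sup>2 \<le> 4 * ?S" by simp
  have "(norm (g b - g a))\<^sup>2 \<le> (norm (g b) + norm (g a))\<^sup>2"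
    by (intro power_mono norm_triangle_ineq4) auto
  also have "\<dots> \<le> 2 * (norm (g b))\<^sup>2 + 2 * (norm (g a))\<^sup>2"
    using sum_squares_ge_zero[of "norm (g b) - norm (g a)" 0]
    by (simp add: power2_eq_square algebra_simps)
  finally show ?thesis using A B by linarith
qed

section \<open>Lepingle's inequality along a path\<close>

primrec run_max :: "(nat \<Rightarrow> complex) \<Rightarrow> nat \<Rightarrow> real" where
  "run_max X 0 = norm (X 0)"
| "run_max X (Suc n) = max (run_max X n) (norm (X (Suc n)))"

text \<open>The value of \<open>X\<close> at its latest jump time, a jump being a move by at least
  \<open>d\<close> times the current running maximum. The threshold is relative because an increment
  never exceeds twice the running maximum, so that the dyadic values of \<open>d\<close> from 1/2
  downwards suffice.\<close>

primrec anchor :: "real \<Rightarrow> (nat \<Rightarrow> complex) \<Rightarrow> nat \<Rightarrow> complex" where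
  "anchor d X 0 = X 0"
| "anchor d X (Suc n) =
     (if d * run_max X (Suc n) \<le> norm (X (Suc n) - anchor d X n) then X (Suc n) else anchor d X n)"

definition jump_energy :: "real \<Rightarrow> (nat \<Rightarrow> complex) \<Rightarrow> nat \<Rightarrow> real" where
  "jump_energy d X L = (\<Sum>u<L. (norm (anchor d X (Suc u) - anchor d X u))\<^sup>2)"

lemma run_max_nonneg: "0 \<le> run_max X n"
  by (induction n) (auto simp: le_max_iff_disj)

lemma norm_le_run_max: "k \<le> n \<Longrightarrow> norm (X k) \<le> run_max X n"
  by (induction n) (auto simp: le_Suc_eq)

lemma run_max_mono: "k \<le> n \<Longrightarrow> run_max X k \<le> run_max X n"
  by (induction n) (auto simp: le_Suc_eq)

lemma run_max_le: "(\<And>k. k \<le> n \<Longrightarrow> norm (X k) \<le> b) \<Longrightarrow> run_max X n \<le> b"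
  by (induction n) auto

lemma norm_anchor_le: "norm (anchor d X n) \<le> run_max X n"
  by (induction n) auto

lemma norm_diff_anchor_le: "0 \<le> d \<Longrightarrow> norm (X n - anchor d X n) \<le> d * run_max X n"
  using run_max_nonneg[of X n] by (cases n) (auto simp del: run_max.simps)

lemma anchor_const:
  "t \<le> n \<Longrightarrow> (\<And>u. t < u \<Longrightarrow> u \<le> n \<Longrightarrow> anchor d X u = anchor d X (u - 1)) \<Longrightarrow> anchor d X n = anchor d X t"
proof (induction n)
  case (Suc n)
  show ?case
  proof (cases "t = Suc n")
    case False
    with Suc have "anchor d X n = anchor d X t" by simp
    moreover have "anchor d X (Suc n) = anchor d X n" using Suc.prems(2)[of "Suc n"] False Suc.prems(1) by simp
    ultimately show ?thesis by simp
  qed simp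
qed simp

text \<open>The last change \<open>u\<close> of the anchor in \<open>{t<..t'}\<close> is a witness: from \<open>u\<close> on, \<open>X\<close> stays so close to
  \<open>X u\<close> that the running maximum at \<open>t'\<close> is at most twice the one at \<open>u\<close>.\<close>

lemma large_increment_imp_jump:
  assumes d: "0 < d" "d \<le> 1/2" and t: "t < t'"
    and large: "2 * d * run_max X t' < norm (X t' - X t)" "norm (X t' - X t) \<le> 4 * d * run_max X t'"
  obtains u where "t \<le> u" "u < t'" "norm (X t' - X t) \<le> 8 * norm (anchor d X (Suc u) - anchor d X u)"
proof -
  define J where "J = {u. t < u \<and> u \<le> t' \<and> anchor d X u \<noteq> anchor d X (u - 1)}"
  have fin: "finite J" by (rule finite_subset[of _ "{..t'}"]) (auto simp: J_def)
  \<comment> \<open>Without a jump both values lie close to one common anchor, within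
    \<open>d\<close> times the running maximum, which is too close for the assumed
    increment.\<close>
  have ne: "J \<noteq> {}"
  proof
    assume "J = {}"
    then have "anchor d X u = anchor d X (u - 1)" if "t < u" "u \<le> t'" for u
      using that unfolding J_def by blast
    then have eq: "anchor d X t' = anchor d X t" using t anchor_const[of t t' d X] by simp
    have "norm (X t' - X t) = norm ((X t' - anchor d X t') - (X t - anchor d X t))" by (simp add: eq)
    also have "\<dots> \<le> d * run_max X t' + d * run_max X t"
      using d by (intro order_trans[OF norm_triangle_ineq4] add_mono norm_diff_anchor_le) auto
    also have "\<dots> \<le> 2 * d * run_max X t'" using run_max_mono[of t t' X] t d by simp
    finally show False using large by simp
  qed
  define v where "v = Max J"
  have vJ: "v \<in> J" using fin ne by (simp add: v_def)
  have last: "u \<le> v" if "u \<in> J" for u using that fin by (simp add: v_def)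
  obtain u where u: "v = Suc u" using vJ by (cases v) (auto simp: J_def)
  from vJ have v: "t < v" "v \<le> t'" "anchor d X (Suc u) \<noteq> anchor d X u" by (auto simp: J_def u)
  then have au: "anchor d X v = X v" "d * run_max X v \<le> norm (anchor d X v - anchor d X u)"
    by (auto simp: u split: if_splits)
  have close: "norm (X k) \<le> run_max X v + d * run_max X t'" if "k \<le> t'" for k
  proof (cases "k \<le> v")
    case True
    then show ?thesis using norm_le_run_max[of k v X] run_max_nonneg[of X t'] d by (simp add: add_increasing2)
  next
    case False
    have "anchor d X u = anchor d X (u - 1)" if "v < u" "u \<le> k" for u
    proof (rule ccontr)
      assume "anchor d X u \<noteq> anchor d X (u - 1)"
      with that v \<open>k \<le> t'\<close> have "u \<in> J" unfolding J_def by simp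
      with last[of u] that show False by simp
    qed
    then have "anchor d X k = anchor d X v" using False anchor_const[of v k d X] by simp
    then have "norm (X k - X v) \<le> d * run_max X k" using norm_diff_anchor_le[of d X k] d by (simp add: au)
    also have "\<dots> \<le> d * run_max X t'" using run_max_mono[OF that] d by simp
    finally have "norm (X k) \<le> norm (X v) + d * run_max X t'" by (smt (verit) norm_triangle_sub)
    then show ?thesis using norm_le_run_max[of v v X] by simp
  qed
  have "run_max X t' \<le> run_max X v + d * run_max X t'" by (rule run_max_le) (rule close)
  also have "\<dots> \<le> run_max X v + 1/2 * run_max X t'" using d run_max_nonneg by (intro add_mono mult_right_mono) auto
  finally have half: "run_max X t' \<le> 2 * run_max X v" by simp
  have "norm (X t' - X t) \<le> 4 * d * (2 * run_max X v)"
    using large(2) half d by (smt (verit) mult_left_mono)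
  also have "\<dots> \<le> 8 * norm (anchor d X v - anchor d X u)" using au(2) by simp
  finally show ?thesis using that[of u] v u by simp
qed

text \<open>An increment of relative size about (1/2)^m enters the s-variation as its square times a
  factor of order (1/2)^((s - 2) m). These weights are summable for s > 2, while the mean jump
  energies admit a bound independent of the threshold.\<close>

definition jump_series :: "real \<Rightarrow> (nat \<Rightarrow> complex) \<Rightarrow> nat \<Rightarrow> real" where
  "jump_series s X L = (\<Sum>m. (1/2) powr ((s - 2) * real m) * jump_energy ((1/2) ^ Suc m) X L)"

lemma jump_energy_nonneg: "0 \<le> jump_energy d X L"
  by (simp add: jump_energy_def sum_nonneg)

text \<open>Crude but uniform in \<open>d\<close>; it serves the convergence of
  \<open>jump_series\<close>.\<close>

lemma jump_energy_le: "jump_energy d X L \<le> real L * (2 * run_max X L)\<^sup>2"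
proof -
  have "(norm (anchor d X (Suc u) - anchor d X u))\<^sup>2 \<le> (2 * run_max X L)\<^sup>2" if "u < L" for u
  proof (intro power_mono)
    have "norm (anchor d X (Suc u) - anchor d X u) \<le> run_max X (Suc u) + run_max X u"
      by (rule order_trans[OF norm_triangle_ineq4]) (intro add_mono norm_anchor_le)
    also have "\<dots> \<le> run_max X L + run_max X L" using that by (intro add_mono run_max_mono) auto
    finally show "norm (anchor d X (Suc u) - anchor d X u) \<le> 2 * run_max X L" by simp
  qed simp
  then have "jump_energy d X L \<le> (\<Sum>u<L. (2 * run_max X L)\<^sup>2)" unfolding jump_energy_def by (intro sum_mono) simp
  then show ?thesis by simp
qed

lemma half_powr_summable:
  assumes "0 < a" shows "summable (\<lambda>m. (1/2::real) powr (a * real m))"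
proof -
  have "(\<lambda>m. (1/2::real) powr (a * real m)) = (\<lambda>m. ((1/2) powr a) ^ m)"
    by (simp add: powr_powr[symmetric] powr_realpow)
  moreover have "(1/2::real) powr a < 1" using powr_less_mono'[of "1/2" 0 a] assms by simp
  ultimately show ?thesis by (simp add: summable_geometric)
qed

lemma jump_series_summable:
  assumes "2 < s"
  shows "summable (\<lambda>m. (1/2) powr ((s - 2) * real m) * jump_energy ((1/2) ^ Suc m) X L)"
proof (rule summable_comparison_test')
  show "summable (\<lambda>m. (1/2) powr ((s - 2) * real m) * (real L * (2 * run_max X L)\<^sup>2))"
    using half_powr_summable[of "s - 2"] assms by (intro summable_mult2) simp
  show "norm ((1/2) powr ((s - 2) * real m) * jump_energy ((1/2) ^ Suc m) X L)
      \<le> (1/2) powr ((s - 2) * real m) * (real L * (2 * run_max X L)\<^sup>2)" for m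
    using jump_energy_le jump_energy_nonneg by (auto simp: abs_mult intro!: mult_left_mono)
qed

lemma jump_series_nonneg: "2 < s \<Longrightarrow> 0 \<le> jump_series s X L"
  unfolding jump_series_def
  by (intro suminf_nonneg jump_series_summable) (auto simp: jump_energy_nonneg)

text \<open>The least exponent satisfying the lower inequality is not 0 because
  \<open>r \<le> 2\<close>; hence the threshold \<open>(1/2) ^ Suc m\<close> is at most 1/2, as the
  existence of a jump requires.\<close>

lemma exists_dyadic_scale:
  fixes r :: real assumes "0 < r" "r \<le> 2"
  obtains m where "2 * (1/2) ^ Suc m < r" "r \<le> 4 * (1/2) ^ Suc m"
proof -
  have "\<exists>m. 2 * (1/2) ^ m < r" using real_arch_pow_inv[of "r / 2" "1/2"] assms by (auto simp: field_simps)
  define m where "m = (LEAST m. 2 * (1/2) ^ m < r)"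
  have m: "2 * (1/2) ^ m < r"
    unfolding m_def by (rule LeastI_ex) fact
  have least: "r \<le> 2 * (1/2) ^ k" if "k < m" for k
    using not_less_Least[OF that[unfolded m_def]] by simp
  from m assms obtain k where "m = Suc k" by (cases m) auto
  with m least[of k] show ?thesis by (intro that[of k]) auto
qed

text \<open>One increment needs one scale only, the one matching its ratio to the running maximum.
  Its square is paid by a single jump (64 is the square of 8), the remaining power s - 2 by the
  upper bound for the ratio.\<close>

lemma norm_diff_powr_le_jumps:
  assumes s: "2 < s" and t: "t < t'" "t' \<le> L"
  obtains m where "norm (X t' - X t) powr s \<le> 64 * (2 * run_max X L) powr (s - 2) *
    ((1/2) powr ((s - 2) * real m) *
     (\<Sum>u\<in>{t..<t'}. (norm (anchor ((1/2) ^ Suc m) X (Suc u) - anchor ((1/2) ^ Suc m) X u))\<^sup>2))"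
proof (cases "X t' = X t")
  case True
  then show ?thesis by (intro that[of 0]) (simp add: sum_nonneg)
next
  case False
  let ?D = "norm (X t' - X t)" and ?M = "run_max X t'"
  have D: "0 < ?D" using False by simp
  have D2: "?D \<le> 2 * ?M"
    using norm_triangle_ineq4[of "X t'" "X t"] norm_le_run_max[of t' t' X] norm_le_run_max[of t t' X] t by linarith
  then have M: "0 < ?M" using D by linarith
  obtain m where m: "2 * (1/2) ^ Suc m < ?D / ?M" "?D / ?M \<le> 4 * (1/2) ^ Suc m"
    by (rule exists_dyadic_scale[of "?D / ?M"]) (use D D2 M in \<open>auto simp: field_simps\<close>)
  let ?d = "(1/2::real) ^ Suc m"
  have up: "?D \<le> 4 * ?d * ?M" using m M by (simp add: field_simps)
  obtain u where u: "t \<le> u" "u < t'" "?D \<le> 8 * norm (anchor ?d X (Suc u) - anchor ?d X u)"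
    by (rule large_increment_imp_jump[of ?d t t' X]) (use m M t in \<open>auto simp: field_simps power_le_one\<close>)
  let ?e = "\<lambda>u. (norm (anchor ?d X (Suc u) - anchor ?d X u))\<^sup>2"
  have e: "?D\<^sup>2 \<le> 64 * (\<Sum>u\<in>{t..<t'}. ?e u)"
  proof -
    have "?D\<^sup>2 \<le> (8 * norm (anchor ?d X (Suc u) - anchor ?d X u))\<^sup>2" using u by (intro power_mono) auto
    also have "\<dots> = 64 * ?e u" by (simp add: power_mult_distrib)
    also have "?e u \<le> (\<Sum>u\<in>{t..<t'}. ?e u)" by (rule member_le_sum) (use u in auto)
    finally show ?thesis by simp
  qed
  have "?D powr (s - 2) \<le> (4 * ?d * run_max X L) powr (s - 2)"
  proof (rule powr_mono2)
    have "4 * ?d * ?M \<le> 4 * ?d * run_max X L" using run_max_mono[OF t(2)] by (intro mult_left_mono) auto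
    then show "?D \<le> 4 * ?d * run_max X L" using up by linarith
  qed (use s in auto)
  also have "4 * ?d * run_max X L = (2 * run_max X L) * (1/2) ^ m" by simp
  also have "\<dots> powr (s - 2) = (2 * run_max X L) powr (s - 2) * ((1/2) ^ m) powr (s - 2)"
    by (rule powr_mult)
  also have "((1/2::real) ^ m) powr (s - 2) = (1/2) powr ((s - 2) * real m)"
    by (simp add: powr_realpow[symmetric] powr_powr mult.commute)
  finally have p: "?D powr (s - 2) \<le> (2 * run_max X L) powr (s - 2) * (1/2) powr ((s - 2) * real m)" .
  have "?D powr s = ?D powr 2 * ?D powr (s - 2)" by (subst powr_add[symmetric]) simp
  also have "\<dots> = ?D\<^sup>2 * ?D powr (s - 2)" using D by simp
  also have "\<dots> \<le> (64 * (\<Sum>u\<in>{t..<t'}. ?e u)) * ((2 * run_max X L) powr (s - 2) * (1/2) powr ((s - 2) * real m))"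
    by (intro mult_mono e p) (auto intro!: sum_nonneg)
  finally show ?thesis by (intro that[of m]) (simp only: mult_ac)
qed

text \<open>Jump energies are additive over disjoint intervals, so all increments together cost no
  more than the full energies. The times decrease because the dilation reverses time.\<close>

lemma jump_variation_le:
  assumes s: "2 < s" and q: "antimono q" "q 0 \<le> L"
  shows "(\<Sum>j<J. norm (X (q j) - X (q (Suc j))) powr s)
    \<le> (16 * sqrt ((run_max X L)\<^sup>2 + jump_series s X L)) powr s"
proof -
  define a where "a m u = (norm (anchor ((1/2) ^ Suc m) X (Suc u) - anchor ((1/2) ^ Suc m) X u))\<^sup>2" for m u
  define c where "c m = (1/2::real) powr ((s - 2) * real m)" for m
  define K where "K = 64 * (2 * run_max X L) powr (s - 2)"
  have K0: "0 \<le> K" by (simp add: K_def)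
  have nn: "0 \<le> c m * sum (a m) I" for m I by (simp add: c_def a_def sum_nonneg)
  have le: "sum (a m) I \<le> jump_energy ((1/2) ^ Suc m) X L" if "I \<subseteq> {..<L}" for m I
    unfolding jump_energy_def a_def using that by (intro sum_mono2) auto
  have summ: "summable (\<lambda>m. c m * sum (a m) I)" if "I \<subseteq> {..<L}" for I
    by (rule summable_comparison_test'[OF jump_series_summable[OF s, of X L]])
       (use le[OF that] nn[of _ I] in \<open>auto simp: c_def intro!: mult_left_mono\<close>)
  have sub: "{q (Suc j)..<q j} \<subseteq> {..<L}" for j
    using antimonoD[OF q(1), of 0 j] q(2) by auto
  \<comment> \<open>The scale depends on \<open>j\<close>; summing over all scales removes this
    dependence and leaves a bound that is additive over the intervals.\<close>
  have step: "norm (X (q j) - X (q (Suc j))) powr s \<le> K * (\<Sum>m. c m * sum (a m) {q (Suc j)..<q j})" for j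
  proof (cases "q (Suc j) = q j")
    case True
    then show ?thesis by simp
  next
    case False
    then have "q (Suc j) < q j" using antimonoD[OF q(1), of j "Suc j"] by simp
    moreover have "q j \<le> L" using antimonoD[OF q(1), of 0 j] q(2) by simp
    ultimately obtain m where m: "norm (X (q j) - X (q (Suc j))) powr s \<le> K * (c m * sum (a m) {q (Suc j)..<q j})"
      using norm_diff_powr_le_jumps[OF s, of "q (Suc j)" "q j" L X] unfolding K_def c_def a_def by blast
    have "c m * sum (a m) {q (Suc j)..<q j} = (\<Sum>m\<in>{m}. c m * sum (a m) {q (Suc j)..<q j})" by simp
    also have "\<dots> \<le> (\<Sum>m. c m * sum (a m) {q (Suc j)..<q j})"
      by (intro sum_le_suminf summ sub) (auto simp: nn)
    finally show ?thesis using m K0 by (meson mult_left_mono order_trans)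
  qed
  \<comment> \<open>\<open>h\<close> dominates both the running maximum and the square root of the
    jump series, so the powers s - 2 and 2 merge into a single power s.\<close>
  define h where "h = sqrt ((run_max X L)\<^sup>2 + jump_series s X L)"
  have js: "0 \<le> jump_series s X L" by (rule jump_series_nonneg[OF s])
  have hM: "run_max X L \<le> h" using js by (simp add: h_def real_le_rsqrt)
  have hJ: "jump_series s X L \<le> h\<^sup>2" using js by (simp add: h_def)
  have h0: "0 \<le> h" by (simp add: h_def js)
  have "(\<Sum>j<J. norm (X (q j) - X (q (Suc j))) powr s) \<le> (\<Sum>j<J. K * (\<Sum>m. c m * sum (a m) {q (Suc j)..<q j}))"
    by (intro sum_mono step)
  also have "\<dots> = K * (\<Sum>m. c m * sum (a m) {q J..<q 0})"
    by (simp add: sum_distrib_left[symmetric] suminf_sum[symmetric] summ sub sum_decrements_eq[OF q(1)])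
  also have "\<dots> \<le> K * jump_series s X L"
    unfolding jump_series_def using q(2)
    by (intro mult_left_mono suminf_le K0 summ jump_series_summable s)
       (auto simp: c_def simp del: power_Suc intro!: mult_left_mono le)
  also have "\<dots> \<le> (64 * (2 * h) powr (s - 2)) * h\<^sup>2"
    unfolding K_def
  proof (intro mult_mono hJ)
    show "(2 * run_max X L) powr (s - 2) \<le> (2 * h) powr (s - 2)"
      using s hM by (intro powr_mono2) (auto simp: run_max_nonneg)
  qed (auto simp: js)
  also have "\<dots> = 16 * ((2 * h) powr (s - 2) * (2 * h)\<^sup>2)" by (simp add: power2_eq_square)
  also have "\<dots> = 16 * (2 * h) powr s"
  proof (cases "h = 0")
    case False
    then have "(2 * h)\<^sup>2 = (2 * h) powr 2" using h0 by simp
    then have "(2 * h) powr (s - 2) * (2 * h)\<^sup>2 = (2 * h) powr (s - 2) * (2 * h) powr 2" by simp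
    also have "\<dots> = (2 * h) powr s" by (subst powr_add[symmetric]) simp
    finally show ?thesis by simp
  qed simp
  also have "\<dots> \<le> 8 powr s * (2 * h) powr s"
  proof (intro mult_right_mono)
    have "(8::real) powr 2 \<le> 8 powr s" using s by (intro powr_mono) auto
    moreover have "(8::real) powr 2 = 64" by simp
    ultimately show "16 \<le> (8::real) powr s" by linarith
  qed simp
  also have "\<dots> = (16 * h) powr s" using powr_mult[of 8 "2 * h" s] by simp
  finally show ?thesis by (simp add: h_def)
qed

section \<open>Coin-tossing martingales and the lazy random walk\<close>

lemma run_max_cong: "(\<And>j. j \<le> n \<Longrightarrow> X j = Y j) \<Longrightarrow> run_max X n = run_max Y n"
  by (induction n) auto

lemma anchor_cong: "(\<And>j. j \<le> n \<Longrightarrow> X j = Y j) \<Longrightarrow> anchor d X n = anchor d Y n"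
  by (induction n) (auto simp: run_max_cong[of _ X Y] simp del: run_max.simps)

text \<open>A martingale on a finite uniform space; \<open>\<sigma> k\<close> flips the \<open>k\<close>-th coin, and the martingale
  property is that flipping reflects \<open>X (k + 1)\<close> in \<open>X k\<close>.\<close>

locale flip_martingale =
  fixes \<Omega> :: "'w set" and X :: "'w \<Rightarrow> nat \<Rightarrow> complex" and \<sigma> :: "nat \<Rightarrow> 'w \<Rightarrow> 'w" and L :: nat
  assumes finite_space: "finite \<Omega>"
    and bij: "k < L \<Longrightarrow> bij_betw (\<sigma> k) \<Omega> \<Omega>"
    and past: "k < L \<Longrightarrow> w \<in> \<Omega> \<Longrightarrow> j \<le> k \<Longrightarrow> X (\<sigma> k w) j = X w j"
    and reflect: "k < L \<Longrightarrow> w \<in> \<Omega> \<Longrightarrow> X w (Suc k) + X (\<sigma> k w) (Suc k) = 2 * X w k"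
begin

lemma sum_flip:
  fixes G :: "'w \<Rightarrow> real"
  assumes "k < L" shows "(\<Sum>w\<in>\<Omega>. G w) = (\<Sum>w\<in>\<Omega>. (G w + G (\<sigma> k w)) / 2)"
  using sum.reindex_bij_betw[OF bij[OF assms], of G] by (simp add: sum.distrib flip: sum_divide_distrib)

lemma flip_run_max: "k < L \<Longrightarrow> w \<in> \<Omega> \<Longrightarrow> run_max (X (\<sigma> k w)) k = run_max (X w) k"
  by (intro run_max_cong) (simp add: past)

lemma flip_anchor: "k < L \<Longrightarrow> w \<in> \<Omega> \<Longrightarrow> anchor d (X (\<sigma> k w)) k = anchor d (X w) k"
  by (intro anchor_cong) (simp add: past)

text \<open>A Bellman function for Doob's inequality. Raising the maximum from m to x changes 2 m^2
  - 4 x m into -2 x^2, which is smaller by 2 (m - x)^2. With the maximum frozen, the reflection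
  property and the triangle inequality show that the mean norm does not decrease.\<close>

lemma doob_step:
  assumes k: "k < L"
  shows "(\<Sum>w\<in>\<Omega>. 2 * (run_max (X w) (Suc k))\<^sup>2 - 4 * norm (X w (Suc k)) * run_max (X w) (Suc k))
      \<le> (\<Sum>w\<in>\<Omega>. 2 * (run_max (X w) k)\<^sup>2 - 4 * norm (X w k) * run_max (X w) k)"
proof -
  let ?G = "\<lambda>w. 2 * (run_max (X w) k)\<^sup>2 - 4 * norm (X w (Suc k)) * run_max (X w) k"
  have "2 * (max m x)\<^sup>2 - 4 * x * max m x \<le> 2 * m\<^sup>2 - 4 * x * m" for m x :: real
    using zero_le_power2[of "m - x"] by (cases "x \<le> m") (auto simp: max_def power2_eq_square algebra_simps)
  then have "(\<Sum>w\<in>\<Omega>. 2 * (run_max (X w) (Suc k))\<^sup>2 - 4 * norm (X w (Suc k)) * run_max (X w) (Suc k)) \<le> (\<Sum>w\<in>\<Omega>. ?G w)"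
    by (intro sum_mono) simp
  also have "\<dots> = (\<Sum>w\<in>\<Omega>. (?G w + ?G (\<sigma> k w)) / 2)" by (rule sum_flip[OF k])
  also have "\<dots> \<le> (\<Sum>w\<in>\<Omega>. 2 * (run_max (X w) k)\<^sup>2 - 4 * norm (X w k) * run_max (X w) k)"
  proof (intro sum_mono)
    fix w assume w: "w \<in> \<Omega>"
    have "2 * norm (X w k) \<le> norm (X w (Suc k)) + norm (X (\<sigma> k w) (Suc k))"
      using norm_triangle_ineq[of "X w (Suc k)" "X (\<sigma> k w) (Suc k)"] reflect[OF k w] by (simp add: norm_mult)
    then have "2 * norm (X w k) * run_max (X w) k \<le> (norm (X w (Suc k)) + norm (X (\<sigma> k w) (Suc k))) * run_max (X w) k"
      by (intro mult_right_mono run_max_nonneg)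
    then show "(?G w + ?G (\<sigma> k w)) / 2 \<le> 2 * (run_max (X w) k)\<^sup>2 - 4 * norm (X w k) * run_max (X w) k"
      by (simp add: flip_run_max[OF k w] add_divide_distrib diff_divide_distrib algebra_simps)
  qed
  finally show ?thesis .
qed

text \<open>The functional of \<open>doob_step\<close> starts at -2 times the squared norm of
  \<open>X w 0\<close>, so its sum stays nonpositive. The square of
  \<open>run_max - 2 * norm\<close> then yields Doob's constant 4.\<close>

lemma doob_maximal: "(\<Sum>w\<in>\<Omega>. (run_max (X w) L)\<^sup>2) \<le> 4 * (\<Sum>w\<in>\<Omega>. (norm (X w L))\<^sup>2)"
proof -
  have "(\<Sum>w\<in>\<Omega>. 2 * (run_max (X w) k)\<^sup>2 - 4 * norm (X w k) * run_max (X w) k) \<le> 0" if "k \<le> L" for k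
    using that
  proof (induction k)
    case 0
    show ?case by (rule sum_nonpos) (simp add: power2_eq_square)
  next
    case (Suc k)
    then show ?case using doob_step[of k] by fastforce
  qed
  from this[of L] have *: "(\<Sum>w\<in>\<Omega>. 2 * (run_max (X w) L)\<^sup>2 - 4 * norm (X w L) * run_max (X w) L) \<le> 0" by simp
  have "(\<Sum>w\<in>\<Omega>. (run_max (X w) L)\<^sup>2) \<le>
      (\<Sum>w\<in>\<Omega>. (2 * (run_max (X w) L)\<^sup>2 - 4 * norm (X w L) * run_max (X w) L) + 4 * (norm (X w L))\<^sup>2)"
  proof (intro sum_mono)
    fix w
    show "(run_max (X w) L)\<^sup>2 \<le> (2 * (run_max (X w) L)\<^sup>2 - 4 * norm (X w L) * run_max (X w) L) + 4 * (norm (X w L))\<^sup>2"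
      using zero_le_power2[of "run_max (X w) L - 2 * norm (X w L)"]
      by (simp add: power2_eq_square algebra_simps)
  qed
  also have "\<dots> \<le> 4 * (\<Sum>w\<in>\<Omega>. (norm (X w L))\<^sup>2)"
    using * by (simp add: sum.distrib sum_distrib_left)
  finally show ?thesis .
qed

text \<open>Removing the squared norm of \<open>X\<close> leaves an expression affine in
  \<open>X\<close>, whose mean the reflection preserves when \<open>A\<close> depends on the past
  only.\<close>

lemma sum_dist_sq_step:
  fixes A :: "'w \<Rightarrow> complex"
  assumes k: "k < L" and A: "\<And>w. w \<in> \<Omega> \<Longrightarrow> A (\<sigma> k w) = A w"
  shows "(\<Sum>w\<in>\<Omega>. (norm (X w (Suc k) - A w))\<^sup>2 - (norm (X w (Suc k)))\<^sup>2)
       = (\<Sum>w\<in>\<Omega>. (norm (X w k - A w))\<^sup>2 - (norm (X w k))\<^sup>2)"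
proof -
  let ?G = "\<lambda>w. (norm (X w (Suc k) - A w))\<^sup>2 - (norm (X w (Suc k)))\<^sup>2"
  have dist: "(norm (z - a))\<^sup>2 - (norm z)\<^sup>2 = (norm a)\<^sup>2 - 2 * inner z a" for z a :: complex
    by (simp add: power2_norm_eq_inner inner_diff_left inner_diff_right inner_commute)
  have "(\<Sum>w\<in>\<Omega>. ?G w) = (\<Sum>w\<in>\<Omega>. (?G w + ?G (\<sigma> k w)) / 2)" by (rule sum_flip[OF k])
  also have "\<dots> = (\<Sum>w\<in>\<Omega>. (norm (X w k - A w))\<^sup>2 - (norm (X w k))\<^sup>2)"
  proof (intro sum.cong refl)
    fix w assume w: "w \<in> \<Omega>"
    have "inner (X w (Suc k)) (A w) + inner (X (\<sigma> k w) (Suc k)) (A w) = inner (2 * X w k) (A w)"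
      by (simp add: reflect[OF k w, symmetric] inner_add_left)
    also have "\<dots> = 2 * inner (X w k) (A w)" by (simp add: inner_complex_def)
    finally show "(?G w + ?G (\<sigma> k w)) / 2 = (norm (X w k - A w))\<^sup>2 - (norm (X w k))\<^sup>2"
      unfolding dist A[OF w] by simp
  qed
  finally show ?thesis .
qed

text \<open>The potential is the jump energy plus the squared distance to the anchor minus the
  squared norm. A jump moves the squared distance into the jump energy without loss, and between
  jumps the mean is conserved; hence the bound does not depend on \<open>d\<close>.\<close>

lemma sum_jump_energy_le: "(\<Sum>w\<in>\<Omega>. jump_energy d (X w) L) \<le> (\<Sum>w\<in>\<Omega>. (norm (X w L))\<^sup>2)"
proof -
  have "(\<Sum>w\<in>\<Omega>. jump_energy d (X w) k + ((norm (X w k - anchor d (X w) k))\<^sup>2 - (norm (X w k))\<^sup>2)) \<le> 0"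
    if "k \<le> L" for k
    using that
  proof (induction k)
    case 0
    show ?case by (rule sum_nonpos) (simp add: jump_energy_def)
  next
    case (Suc k)
    have pt: "jump_energy d x (Suc k) + ((norm (x (Suc k) - anchor d x (Suc k)))\<^sup>2 - n)
       = jump_energy d x k + ((norm (x (Suc k) - anchor d x k))\<^sup>2 - n)" for x :: "nat \<Rightarrow> complex" and n
      by (simp add: jump_energy_def)
    show ?case
      unfolding pt using Suc sum_dist_sq_step[of k "\<lambda>w. anchor d (X w) k"]
      by (simp add: sum.distrib flip_anchor)
  qed
  from this[of L] show ?thesis
    using sum_nonneg[of \<Omega> "\<lambda>w. (norm (X w L - anchor d (X w) L))\<^sup>2"]
    by (simp add: sum.distrib sum_subtractf)
qed

lemma sum_jump_series_le:
  assumes s: "2 < s"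
  shows "(\<Sum>w\<in>\<Omega>. jump_series s (X w) L) \<le> (\<Sum>m. (1/2) powr ((s - 2) * real m)) * (\<Sum>w\<in>\<Omega>. (norm (X w L))\<^sup>2)"
proof -
  have summ: "summable (\<lambda>m. (1/2::real) powr ((s - 2) * real m))" using s by (intro half_powr_summable) simp
  have "(\<Sum>w\<in>\<Omega>. jump_series s (X w) L) =
      (\<Sum>m. \<Sum>w\<in>\<Omega>. (1/2) powr ((s - 2) * real m) * jump_energy ((1/2) ^ Suc m) (X w) L)"
    unfolding jump_series_def by (rule suminf_sum[symmetric]) (rule jump_series_summable[OF s])
  also have "\<dots> \<le> (\<Sum>m. (1/2) powr ((s - 2) * real m) * (\<Sum>w\<in>\<Omega>. (norm (X w L))\<^sup>2))"
    unfolding sum_distrib_left[symmetric]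
  proof (rule suminf_le)
    show "summable (\<lambda>m. (1/2) powr ((s - 2) * real m) * (\<Sum>w\<in>\<Omega>. jump_energy ((1/2) ^ Suc m) (X w) L))"
      unfolding sum_distrib_left by (intro summable_sum jump_series_summable[OF s])
  qed (auto intro!: mult_left_mono sum_jump_energy_le summable_mult2 summ simp del: power_Suc)
  also have "\<dots> = (\<Sum>m. (1/2) powr ((s - 2) * real m)) * (\<Sum>w\<in>\<Omega>. (norm (X w L))\<^sup>2)"
    by (rule suminf_mult2[OF summ, symmetric])
  finally show ?thesis .
qed

text \<open>Doob's inequality for \<open>X - X 0\<close>, with the energy of the difference computed
  by orthogonality of martingale increments. The right side is kept as a difference so that it can
  telescope over consecutive blocks.\<close>

lemma sum_run_max_diff_le:
  "(\<Sum>w\<in>\<Omega>. (run_max (\<lambda>k. X w k - X w 0) L)\<^sup>2) \<le> 4 * ((\<Sum>w\<in>\<Omega>. (norm (X w L))\<^sup>2) - (\<Sum>w\<in>\<Omega>. (norm (X w 0))\<^sup>2))"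
proof -
  interpret D: flip_martingale \<Omega> "\<lambda>w k. X w k - X w 0" \<sigma> L
  proof
    fix k w assume k: "k < L" "w \<in> \<Omega>"
    show "X w (Suc k) - X w 0 + (X (\<sigma> k w) (Suc k) - X (\<sigma> k w) 0) = 2 * (X w k - X w 0)"
      using reflect[OF k] past[OF k, of 0] by (simp add: algebra_simps)
  qed (use finite_space bij past in auto)
  have "(\<Sum>w\<in>\<Omega>. (norm (X w k - X w 0))\<^sup>2 - (norm (X w k))\<^sup>2) = - (\<Sum>w\<in>\<Omega>. (norm (X w 0))\<^sup>2)" if "k \<le> L" for k
    using that
  proof (induction k)
    case (Suc k)
    then show ?case using sum_dist_sq_step[of k "\<lambda>w. X w 0"] past by simp
  qed (simp add: sum_negf)
  from this[of L] show ?thesis using D.doob_maximal by (simp add: sum_subtractf)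
qed

end

section \<open>Lazy averages and their coin-tossing representation\<close>

definition avg_fwd :: "(int \<Rightarrow> complex) \<Rightarrow> int \<Rightarrow> complex" where
  "avg_fwd F i = (F i + F (i + 1)) / 2"

definition avg_bwd :: "(int \<Rightarrow> complex) \<Rightarrow> int \<Rightarrow> complex" where
  "avg_bwd F i = (F i + F (i - 1)) / 2"

text \<open>With U the shift this is ((1 + U)/2)^n applied after ((1 + U^-1)/2)^n, two mutually
  adjoint factors. Keeping them apart is what the dilation uses; their product is the n-step lazy
  walk.\<close>

definition lazy_average :: "nat \<Rightarrow> (int \<Rightarrow> complex) \<Rightarrow> complex" where
  "lazy_average n F = (avg_fwd ^^ n) ((avg_bwd ^^ n) F) 0"

text \<open>A subset of \<open>{..<L}\<close> encodes \<open>L\<close> coin tosses.\<close>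

definition flip_coin :: "nat \<Rightarrow> nat set \<Rightarrow> nat set" where
  "flip_coin k w = (if k \<in> w then w - {k} else insert k w)"

text \<open>Conditional expectation of \<open>F (i - H)\<close>, where H is the number of heads
  among all \<open>L\<close> tosses, given the first \<open>k\<close> of them.\<close>

definition coin_walk :: "nat \<Rightarrow> (int \<Rightarrow> complex) \<Rightarrow> int \<Rightarrow> nat set \<Rightarrow> nat \<Rightarrow> complex" where
  "coin_walk L F i w k = (avg_bwd ^^ (L - k)) F (i - int (card (w \<inter> {..<k})))"

lemma bij_flip_coin: "k < L \<Longrightarrow> bij_betw (flip_coin k) (Pow {..<L}) (Pow {..<L})"
  by (rule bij_betw_byWitness[where f' = "flip_coin k"]) (auto simp: flip_coin_def)

lemma card_flip_coin_add:
  fixes g :: "nat \<Rightarrow> complex"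
  assumes "finite A" "k \<in> A"
  shows "g (card (w \<inter> A)) + g (card (flip_coin k w \<inter> A)) = g (card (w \<inter> (A - {k}))) + g (Suc (card (w \<inter> (A - {k}))))"
proof (cases "k \<in> w")
  case True
  have "w \<inter> A = insert k (w \<inter> (A - {k}))" "flip_coin k w \<inter> A = w \<inter> (A - {k})"
    using True assms by (auto simp: flip_coin_def)
  then show ?thesis using assms by simp
next
  case False
  have "flip_coin k w \<inter> A = insert k (w \<inter> (A - {k}))" "w \<inter> A = w \<inter> (A - {k})"
    using False assms by (auto simp: flip_coin_def)
  then show ?thesis using assms by simp
qed

text \<open>Of the two outcomes of toss \<open>k\<close>, one leaves the position and the other
  lowers it by 1, and \<open>avg_bwd\<close> is their mean. A horizon \<open>L'\<close> below
  \<open>L\<close> is allowed because the oscillation over a block stops the walk early.\<close>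

lemma flip_martingale_coin_walk:
  assumes "L' \<le> L"
  shows "flip_martingale (Pow {..<L}) (coin_walk L F i) flip_coin L'"
proof
  fix k w assume k: "k < L'" 
  show "coin_walk L F i (flip_coin k w) j = coin_walk L F i w j" if "j \<le> k" for j
  proof -
    have "flip_coin k w \<inter> {..<j} = w \<inter> {..<j}" using that by (auto simp: flip_coin_def)
    then show ?thesis by (simp add: coin_walk_def)
  qed
  define h where "h = (avg_bwd ^^ (L - Suc k)) F"
  have A: "{..<Suc k} - {k} = {..<k}" by auto
  have "coin_walk L F i w (Suc k) + coin_walk L F i (flip_coin k w) (Suc k)
      = h (i - int (card (w \<inter> {..<k}))) + h (i - int (card (w \<inter> {..<k})) - 1)"
    using card_flip_coin_add[of "{..<Suc k}" k "\<lambda>c. h (i - int c)" w] unfolding A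
    by (simp add: coin_walk_def h_def algebra_simps)
  also have "\<dots> = 2 * avg_bwd h (i - int (card (w \<inter> {..<k})))" by (simp add: avg_bwd_def)
  also have "avg_bwd h = (avg_bwd ^^ (L - k)) F"
    unfolding h_def using k assms by (metis Suc_diff_Suc funpow.simps(2) comp_apply less_le_trans)
  finally show "coin_walk L F i w (Suc k) + coin_walk L F i (flip_coin k w) (Suc k) = 2 * coin_walk L F i w k"
    by (simp add: coin_walk_def)
qed (use assms bij_flip_coin in auto)

lemma sum_coins_average:
  fixes g :: "int \<Rightarrow> complex"
  shows "n \<le> L \<Longrightarrow> (\<Sum>w\<in>Pow {..<L}. g (i + int (card (w \<inter> {L-n..<L})))) = 2 ^ L * (avg_fwd ^^ n) g i"
proof (induction n arbitrary: g)
  case 0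
  then show ?case by (simp add: card_Pow)
next
  case (Suc n)
  define k where "k = L - Suc n"
  have k: "k < L" "{L - Suc n..<L} - {k} = {L-n..<L}" "k \<in> {L - Suc n..<L}" using Suc.prems by (auto simp: k_def)
  let ?g = "\<lambda>w. g (i + int (card (w \<inter> {L - Suc n..<L})))"
  have "(\<Sum>w\<in>Pow {..<L}. ?g w) = (\<Sum>w\<in>Pow {..<L}. (?g w + ?g (flip_coin k w)) / 2)"
    using sum.reindex_bij_betw[OF bij_flip_coin[OF k(1)], of ?g]
    by (simp add: sum.distrib flip: sum_divide_distrib)
  also have "\<dots> = (\<Sum>w\<in>Pow {..<L}. avg_fwd g (i + int (card (w \<inter> {L-n..<L}))))"
    using card_flip_coin_add[of "{L - Suc n..<L}" k "\<lambda>c. g (i + int c)"] k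
    by (simp add: avg_fwd_def algebra_simps)
  also have "\<dots> = 2 ^ L * (avg_fwd ^^ n) (avg_fwd g) i" using Suc by simp
  finally show ?case by (simp add: funpow_swap1)
qed

text \<open>The coin walk started at the total number of heads is a reverse martingale in \<open>n\<close> whose
  conditional expectation is the lazy average (Rota's dilation).\<close>

lemma lazy_average_eq_coins:
  assumes "n \<le> L"
  shows "lazy_average n F = (\<Sum>w\<in>Pow {..<L}. coin_walk L F (int (card w)) w (L - n)) / 2 ^ L"
proof -
  have "coin_walk L F (int (card w)) w (L - n) = (avg_bwd ^^ n) F (0 + int (card (w \<inter> {L-n..<L})))"
    if "w \<in> Pow {..<L}" for w
  proof -
    \<comment> \<open>The start at the total number of heads cancels the heads among the first
      \<open>L - n\<close> tosses; only the last \<open>n\<close> tosses remain, and averaging over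
      them produces the forward factor.\<close>
    have "card w = card ((w \<inter> {..<L-n}) \<union> (w \<inter> {L-n..<L}))"
      by (rule arg_cong[where f = card]) (use that in auto)
    also have "\<dots> = card (w \<inter> {..<L-n}) + card (w \<inter> {L-n..<L})"
      by (rule card_Un_disjoint) auto
    finally have "int (card w) - int (card (w \<inter> {..<L-n})) = 0 + int (card (w \<inter> {L-n..<L}))" by simp
    then show ?thesis using assms by (simp add: coin_walk_def)
  qed
  then show ?thesis using sum_coins_average[OF assms, of "(avg_bwd ^^ n) F" 0] by (simp add: lazy_average_def)
qed

section \<open>Averages along a measure preserving transformation\<close>

locale measure_preserving_system = prob_space M for M :: "'a measure" +
  fixes T :: "'a \<Rightarrow> 'a"
  assumes preserving: "invertible_measure_preserving M T"
begin

abbreviation it :: "int \<Rightarrow> 'a \<Rightarrow> 'a" where "it \<equiv> int_iterate M T"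

lemma T_meas: "T \<in> measurable M M" and inv_meas: "inv_into (space M) T \<in> measurable M M"
  and distr_T: "distr M M T = M" and bij_T: "bij_betw T (space M) (space M)"
  using preserving by (auto simp: invertible_measure_preserving_def)

lemma T_inv: "x \<in> space M \<Longrightarrow> T (inv_into (space M) T x) = x"
  and inv_T: "x \<in> space M \<Longrightarrow> inv_into (space M) T (T x) = x"
  using bij_T by (simp_all add: bij_betw_inv_into_left bij_betw_inv_into_right)

lemma it_meas [measurable]: "it j \<in> measurable M M"
proof -
  have "f ^^ n \<in> measurable M M" if "f \<in> measurable M M" for f :: "'a \<Rightarrow> 'a" and n
    using that by (induction n) (auto simp: measurable_comp)
  then show ?thesis using T_meas inv_meas by (auto simp: int_iterate_def)
qed

lemma it_space: "x \<in> space M \<Longrightarrow> it j x \<in> space M"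
  using measurable_space[OF it_meas] .

lemma it_0 [simp]: "it 0 x = x" by (simp add: int_iterate_def)

lemma it_plus_1: "x \<in> space M \<Longrightarrow> it (j + 1) x = T (it j x)"
proof -
  assume x: "x \<in> space M"
  show ?thesis
  proof (cases "0 \<le> j")
    case True
    then show ?thesis by (simp add: int_iterate_def nat_add_distrib)
  next
    case False
    let ?S = "inv_into (space M) T"
    obtain n where n: "j = - int (Suc n)" using False by (metis not_le zero_less_iff_neq_zero int_cases nat_int of_nat_0_le_iff)
    have e: "(?S ^^ n) x \<in> space M"
      using x measurable_space[OF inv_meas] by (induction n) auto
    have nat_Suc: "nat (int k + 1) = Suc k" "nat (1 + int k) = Suc k" for k by linarith+
    have "it (j + 1) x = (?S ^^ n) x" by (cases n) (auto simp: int_iterate_def n nat_Suc)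
    moreover have "it j x = ?S ((?S ^^ n) x)"
      by (simp add: int_iterate_def n nat_Suc)
    ultimately show ?thesis by (simp add: T_inv[OF e])
  qed
qed

lemma it_minus_1: "x \<in> space M \<Longrightarrow> it (j - 1) x = inv_into (space M) T (it j x)"
  using it_plus_1[of x "j - 1"] inv_T[OF it_space, of x "j - 1"] by simp

lemma it_add: "x \<in> space M \<Longrightarrow> it (i + j) x = it i (it j x)"
proof (induction i rule: int_induct[where k = 0])
  case (step1 i)
  then show ?case using it_plus_1[of x "i + j"] it_plus_1[of "it j x" i] it_space by (simp add: algebra_simps)
next
  case (step2 i)
  then show ?case using it_minus_1[of x "i + j"] it_minus_1[of "it j x" i] it_space by (simp add: algebra_simps)
qed simp

lemma distr_it: "distr M M (it j) = M"
proof (induction j rule: int_induct[where k = 0])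
  case base
  have "distr M M (it 0) = distr M M (\<lambda>x. x)" by (intro distr_cong) auto
  then show ?case by simp
next
  case (step1 i)
  have "distr M M (it (i + 1)) = distr M M (T \<circ> it i)" by (intro distr_cong) (auto simp: it_plus_1)
  then show ?case using step1 distr_T T_meas by (simp flip: distr_distr)
next
  case (step2 i)
  have "M = distr M M (\<lambda>x. x)" by simp
  also have "\<dots> = distr M M (inv_into (space M) T \<circ> T)" by (intro distr_cong) (auto simp: inv_T)
  also have "\<dots> = distr M M (inv_into (space M) T)" using distr_T T_meas inv_meas by (simp flip: distr_distr)
  finally have S: "distr M M (inv_into (space M) T) = M" by simp
  have "distr M M (it (i - 1)) = distr M M (inv_into (space M) T \<circ> it i)"
    by (intro distr_cong) (auto simp: it_minus_1)
  then show ?case using step2 S inv_meas by (simp flip: distr_distr)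
qed

lemma nn_integral_it: "g \<in> borel_measurable M \<Longrightarrow> (\<integral>\<^sup>+x. g (it j x) \<partial>M) = (\<integral>\<^sup>+x. g x \<partial>M)"
  using nn_integral_distr[OF it_meas, of g j] by (simp add: distr_it)

lemma integral_it:
  fixes g :: "'a \<Rightarrow> complex"
  shows "g \<in> borel_measurable M \<Longrightarrow> (\<integral>x. g (it j x) \<partial>M) = (\<integral>x. g x \<partial>M)"
  using integral_distr[OF it_meas, of g j] by (simp add: distr_it)

end

lemma norm_mult_le_sum_sq:
  fixes a b :: complex
  shows "norm (a * b) \<le> (norm a)\<^sup>2 + (norm b)\<^sup>2"
  using zero_le_power2[of "norm a - norm b"] mult_nonneg_nonneg[of "norm a" "norm b"]
  by (simp add: norm_mult power2_eq_square algebra_simps del: mult_nonneg_nonneg)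

text \<open>Jensen's inequality from the nonnegativity of the variance of \<open>norm (G j)\<close>;
  an infinite right side is split off, so no integrability is assumed.\<close>

lemma norm_expectation_sq_le:
  fixes P :: "'b pmf" and G :: "'b \<Rightarrow> complex"
  shows "ennreal ((norm (\<integral>j. G j \<partial>P))\<^sup>2) \<le> (\<integral>\<^sup>+j. ennreal ((norm (G j))\<^sup>2) \<partial>P)"
proof (cases "(\<integral>\<^sup>+j. ennreal ((norm (G j))\<^sup>2) \<partial>P) < \<infinity>")
  case True
  then have i2: "integrable P (\<lambda>j. (norm (G j))\<^sup>2)" by (intro integrableI_nonneg) auto
  have i1: "integrable P (\<lambda>j. norm (G j))"
  proof (rule Bochner_Integration.integrable_bound)
    show "integrable P (\<lambda>j. 1 + (norm (G j))\<^sup>2)" using i2 by simp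
    have "norm (norm (G j)) \<le> norm (1 + (norm (G j))\<^sup>2)" for j
    proof -
      have "2 * norm (G j) \<le> 1 + (norm (G j))\<^sup>2"
        using zero_le_power2[of "norm (G j) - 1"] by (simp add: power2_eq_square algebra_simps)
      then have "norm (G j) \<le> 1 + (norm (G j))\<^sup>2" using norm_ge_zero[of "G j"] by linarith
      then show ?thesis by simp
    qed
    then show "AE j in P. norm (norm (G j)) \<le> norm (1 + (norm (G j))\<^sup>2)" by simp
  qed simp
  have "0 \<le> measure_pmf.variance P (\<lambda>j. norm (G j))" by (rule measure_pmf.variance_positive)
  then have le: "(\<integral>j. norm (G j) \<partial>P)\<^sup>2 \<le> (\<integral>j. (norm (G j))\<^sup>2 \<partial>P)"
    by (simp add: measure_pmf.variance_eq[OF i1 i2])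
  have "(norm (\<integral>j. G j \<partial>P))\<^sup>2 \<le> (\<integral>j. norm (G j) \<partial>P)\<^sup>2" by (intro power_mono integral_norm_bound) auto
  with le have "ennreal ((norm (\<integral>j. G j \<partial>P))\<^sup>2) \<le> ennreal (\<integral>j. (norm (G j))\<^sup>2 \<partial>P)" by (intro ennreal_leI) linarith
  also have "\<dots> = (\<integral>\<^sup>+j. ennreal ((norm (G j))\<^sup>2) \<partial>P)" using i2 by (intro nn_integral_eq_integral[symmetric]) auto
  finally show ?thesis .
qed (simp add: not_less top_unique)

lemma borel_measurable_cnj [measurable]:
  "g \<in> borel_measurable M \<Longrightarrow> (\<lambda>x. cnj (g x)) \<in> borel_measurable M"
  using measurable_compose[of g M borel cnj borel]
  by (simp add: borel_measurable_continuous_onI continuous_on_cnj)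

locale square_integrable_observable = measure_preserving_system +
  fixes f :: "'a \<Rightarrow> complex"
  assumes f_meas [measurable]: "f \<in> borel_measurable M"
    and f_sq: "(\<integral>\<^sup>+x. ennreal ((norm (f x))\<^sup>2) \<partial>M) < \<infinity>"
begin

definition orbit :: "'a \<Rightarrow> int \<Rightarrow> complex" where "orbit x j = f (it j x)"

definition energy :: real where "energy = (\<integral>x. (norm (f x))\<^sup>2 \<partial>M)"

text \<open>The Fourier coefficients of the spectral measure of \<open>f\<close>.\<close>

definition correlation :: "int \<Rightarrow> complex" where "correlation d = (\<integral>x. orbit x d * cnj (f x) \<partial>M)"

definition average :: "int pmf \<Rightarrow> 'a \<Rightarrow> complex" where "average P x = (\<integral>j. orbit x j \<partial>P)"

lemma orbit_meas [measurable]: "(\<lambda>x. orbit x j) \<in> borel_measurable M"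
  unfolding orbit_def by measurable

lemma orbit_shift: "x \<in> space M \<Longrightarrow> orbit (it i x) j = orbit x (i + j)"
  by (simp add: orbit_def it_add[symmetric] add.commute)

lemma nn_integral_energy: "(\<integral>\<^sup>+x. ennreal ((norm (f x))\<^sup>2) \<partial>M) = ennreal energy"
  unfolding energy_def using f_sq by (intro nn_integral_eq_integral integrableI_nonneg) auto

lemma energy_nonneg: "0 \<le> energy" by (simp add: energy_def)

lemma nn_integral_orbit_sq: "(\<integral>\<^sup>+x. ennreal ((norm (orbit x j))\<^sup>2) \<partial>M) = ennreal energy"
  using nn_integral_it[of "\<lambda>x. ennreal ((norm (f x))\<^sup>2)" j] by (simp add: orbit_def nn_integral_energy)

lemma orbit_pair_meas [measurable]:
  fixes P :: "int pmf"
  shows "(\<lambda>(x, j). orbit x j) \<in> borel_measurable (M \<Otimes>\<^sub>M measure_pmf P)"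
proof -
  have "(\<lambda>z. orbit (fst z) (snd z)) \<in> borel_measurable (M \<Otimes>\<^sub>M count_space UNIV)"
    by (rule measurable_compose_countable'[where f = "\<lambda>j z. orbit (fst z) j" and g = snd and I = UNIV]) auto
  then have "(\<lambda>(x, j). orbit x j) \<in> borel_measurable (M \<Otimes>\<^sub>M count_space UNIV)"
    by (simp add: case_prod_beta)
  also have "borel_measurable (M \<Otimes>\<^sub>M count_space UNIV) = borel_measurable (M \<Otimes>\<^sub>M measure_pmf P)"
    by (intro measurable_cong_sets sets_pair_measure_cong) auto
  finally show ?thesis .
qed

lemma average_meas [measurable]: "average P \<in> borel_measurable M"
proof -
  have "(\<lambda>x. \<integral>j. orbit x j \<partial>P) \<in> borel_measurable M"
    by (rule measure_pmf.borel_measurable_lebesgue_integral) measurable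
  then show ?thesis by (simp add: average_def[abs_def])
qed

lemma nn_integral_orbit_average:
  fixes P :: "int pmf"
  shows "(\<integral>\<^sup>+x. \<integral>\<^sup>+j. ennreal ((norm (orbit x j))\<^sup>2) \<partial>P \<partial>M) = ennreal energy"
proof -
  interpret PS: pair_sigma_finite M "measure_pmf P" ..
  have "(\<integral>\<^sup>+x. \<integral>\<^sup>+j. ennreal ((norm (orbit x j))\<^sup>2) \<partial>P \<partial>M) = (\<integral>\<^sup>+j. \<integral>\<^sup>+x. ennreal ((norm (orbit x j))\<^sup>2) \<partial>M \<partial>P)"
    by (rule PS.Fubini'[symmetric]) measurable
  also have "\<dots> = ennreal energy" by (simp add: nn_integral_orbit_sq)
  finally show ?thesis .
qed

lemma nn_integral_average_sq: "(\<integral>\<^sup>+x. ennreal ((norm (average P x))\<^sup>2) \<partial>M) \<le> ennreal energy"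
proof -
  have "(\<integral>\<^sup>+x. ennreal ((norm (average P x))\<^sup>2) \<partial>M) \<le> (\<integral>\<^sup>+x. \<integral>\<^sup>+j. ennreal ((norm (orbit x j))\<^sup>2) \<partial>P \<partial>M)"
    unfolding average_def by (intro nn_integral_mono norm_expectation_sq_le)
  then show ?thesis by (simp add: nn_integral_orbit_average)
qed

lemma integral_average_mult:
  assumes [measurable]: "b \<in> borel_measurable M" and b: "(\<integral>\<^sup>+x. ennreal ((norm (b x))\<^sup>2) \<partial>M) < \<infinity>"
  shows "(\<integral>x. average P x * b x \<partial>M) = (\<integral>j. (\<integral>x. orbit x j * b x \<partial>M) \<partial>P)"
proof -
  interpret PS: pair_sigma_finite M "measure_pmf P" ..
  have "integrable (M \<Otimes>\<^sub>M measure_pmf P) (\<lambda>(x, j). orbit x j * b x)"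
  proof (rule integrableI_bounded)
    have "(\<integral>\<^sup>+z. ennreal (norm (case z of (x, j) \<Rightarrow> orbit x j * b x)) \<partial>(M \<Otimes>\<^sub>M measure_pmf P))
       = (\<integral>\<^sup>+x. \<integral>\<^sup>+j. ennreal (norm (orbit x j * b x)) \<partial>P \<partial>M)"
      by (subst measure_pmf.nn_integral_fst[symmetric]) (auto simp: case_prod_beta)
    also have "\<dots> \<le> (\<integral>\<^sup>+x. \<integral>\<^sup>+j. ennreal ((norm (orbit x j))\<^sup>2) + ennreal ((norm (b x))\<^sup>2) \<partial>P \<partial>M)"
      by (intro nn_integral_mono) (simp add: norm_mult_le_sum_sq flip: ennreal_plus)
    also have "\<dots> = (\<integral>\<^sup>+x. (\<integral>\<^sup>+j. ennreal ((norm (orbit x j))\<^sup>2) \<partial>P) + ennreal ((norm (b x))\<^sup>2) \<partial>M)"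
      by (simp add: nn_integral_add)
    also have "\<dots> = ennreal energy + (\<integral>\<^sup>+x. ennreal ((norm (b x))\<^sup>2) \<partial>M)"
      by (subst nn_integral_add) (auto simp: nn_integral_orbit_average)
    also have "\<dots> < \<infinity>" using b by simp
    finally show "(\<integral>\<^sup>+z. ennreal (norm (case z of (x, j) \<Rightarrow> orbit x j * b x)) \<partial>(M \<Otimes>\<^sub>M measure_pmf P)) < \<infinity>" .
  qed measurable
  from PS.Fubini_integral[OF this]
  have "(\<integral>j. (\<integral>x. orbit x j * b x \<partial>M) \<partial>P) = (\<integral>x. (\<integral>j. orbit x j * b x \<partial>P) \<partial>M)" .
  also have "\<dots> = (\<integral>x. average P x * b x \<partial>M)" by (simp add: average_def)
  finally show ?thesis by simp
qed

lemma integral_orbit_orbit: "(\<integral>x. orbit x i * cnj (orbit x j) \<partial>M) = correlation (i - j)"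
proof -
  have [measurable]: "(\<lambda>x. orbit x (i - j) * cnj (f x)) \<in> borel_measurable M" by measurable
  have "correlation (i - j) = (\<integral>x. orbit (it j x) (i - j) * cnj (f (it j x)) \<partial>M)"
    unfolding correlation_def by (rule integral_it[symmetric]) measurable
  also have "\<dots> = (\<integral>x. orbit x i * cnj (orbit x j) \<partial>M)"
    by (intro Bochner_Integration.integral_cong refl) (simp add: orbit_shift, simp add: orbit_def)
  finally show ?thesis by simp
qed

lemma integral_average_average:
  "(\<integral>x. average P x * cnj (average Q x) \<partial>M) = (\<integral>j. cnj (\<integral>l. correlation (l - j) \<partial>Q) \<partial>P)"
proof -
  have "(\<integral>x. average P x * cnj (average Q x) \<partial>M) = (\<integral>j. (\<integral>x. orbit x j * cnj (average Q x) \<partial>M) \<partial>P)"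
    using nn_integral_average_sq[of Q] by (intro integral_average_mult) (auto simp: le_less_trans)
  moreover have "(\<integral>x. orbit x j * cnj (average Q x) \<partial>M) = cnj (\<integral>l. correlation (l - j) \<partial>Q)" for j
  proof -
    have "(\<integral>x. orbit x j * cnj (average Q x) \<partial>M) = cnj (\<integral>x. average Q x * cnj (orbit x j) \<partial>M)"
      by (subst Bochner_Integration.integral_cnj[symmetric]) (simp add: mult.commute)
    also have "(\<integral>x. average Q x * cnj (orbit x j) \<partial>M) = (\<integral>l. (\<integral>x. orbit x l * cnj (orbit x j) \<partial>M) \<partial>Q)"
      using nn_integral_orbit_sq[of j] by (intro integral_average_mult) auto
    finally show ?thesis by (simp add: integral_orbit_orbit)
  qed
  ultimately show ?thesis by simp
qed

end

section \<open>Square functions and Fourier multipliers\<close>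

definition charfun :: "int pmf \<Rightarrow> real \<Rightarrow> complex" where
  "charfun P t = (\<integral>k. cis (- 2 * pi * of_int k * t) \<partial>P)"

definition grid :: "nat \<Rightarrow> nat \<Rightarrow> real" where
  "grid R r = real r / (2 * real R) - 1 / 2"

lemma grid_range: "r < 2 * R \<Longrightarrow> grid R r \<in> {-1/2..<1/2}"
  by (auto simp: grid_def field_simps)

text \<open>A geometric sum over a root of unity, which differs from 1 because 0 < |k| < 2R. The
  start of the grid at -1/2 contributes a constant phase.\<close>

lemma sum_cis_grid:
  assumes R: "0 < R" and k: "\<bar>k\<bar> < 2 * int R"
  shows "(\<Sum>r<2*R. cis (2 * pi * of_int k * grid R r)) = (if k = 0 then of_nat (2 * R) else 0)"
proof (cases "k = 0")
  case False
  define z where "z = cis (pi * of_int k / real R)"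
  have power_form: "cis (2 * pi * of_int k * grid R r) = cis (- pi * of_int k) * z ^ r" for r
    unfolding z_def Complex.DeMoivre cis_mult grid_def using R
    by (intro arg_cong[where f = cis]) (simp add: field_simps)
  have z1: "z \<noteq> 1"
  proof
    assume "z = 1"
    then obtain n :: int where "pi * of_int k / real R = of_int n * (2 * pi)" by (auto simp: z_def cis_eq_1_iff)
    then have "real_of_int k = real_of_int (2 * int R * n)" using R by (simp add: field_simps)
    then have "k = 2 * int R * n" by (simp only: of_int_eq_iff)
    moreover have "n \<noteq> 0" using False \<open>k = 2 * int R * n\<close> by auto
    moreover from this have "2 * int R * 1 \<le> 2 * int R * \<bar>n\<bar>" by (intro mult_left_mono) auto
    ultimately show False using k by (simp add: abs_mult)
  qed
  have "z ^ (2 * R) = cis (2 * pi * of_int k)"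
    unfolding z_def Complex.DeMoivre using R by (intro arg_cong[where f = cis]) (simp add: field_simps)
  also have "\<dots> = 1" by (simp add: cis_eq_1_iff)
  finally have "(\<Sum>r<2*R. z ^ r) = 0" using z1 by (simp add: geometric_sum)
  then show ?thesis using False by (simp add: power_form sum_distrib_left[symmetric])
qed (simp)

lemma card_pairs_diff:
  assumes "\<bar>d\<bar> \<le> int R"
  shows "int (card {(i, j). i < R \<and> j < R \<and> int i - int j = d}) = int R - \<bar>d\<bar>"
proof (cases "0 \<le> d")
  case True
  have "{(i, j). i < R \<and> j < R \<and> int i - int j = d} = (\<lambda>j. (j + nat d, j)) ` {..<R - nat d}"
    using True by (auto simp: image_iff)
  then show ?thesis using True assms by (simp add: card_image inj_on_def of_nat_diff)
next
  case False
  have "{(i, j). i < R \<and> j < R \<and> int i - int j = d} = (\<lambda>i. (i, i + nat (- d))) ` {..<R - nat (- d)}"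
    using False by (auto simp: image_iff)
  then show ?thesis using False assms by (simp add: card_image inj_on_def of_nat_diff)
qed

context square_integrable_observable
begin

text \<open>The Fejer means of the spectral measure of \<open>f\<close>, discretised on a grid of \<open>2 R\<close> points.\<close>

definition spectral_weight :: "nat \<Rightarrow> nat \<Rightarrow> real" where
  "spectral_weight R r =
     (\<integral>x. (norm (\<Sum>i<R. orbit x (int i) * cis (- 2 * pi * of_int (int i) * grid R r)))\<^sup>2 \<partial>M) / (2 * (real R)\<^sup>2)"

lemma spectral_weight_nonneg: "0 \<le> spectral_weight R r"
  by (simp add: spectral_weight_def)

lemma integrable_orbit_orbit: "integrable M (\<lambda>x. orbit x i * cnj (orbit x j))"
proof (rule Bochner_Integration.integrable_bound)
  show "integrable M (\<lambda>x. (norm (orbit x i))\<^sup>2 + (norm (orbit x j))\<^sup>2)"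
    using nn_integral_orbit_sq by (intro Bochner_Integration.integrable_add integrableI_nonneg) auto
  have "norm (orbit x i * cnj (orbit x j)) \<le> norm ((norm (orbit x i))\<^sup>2 + (norm (orbit x j))\<^sup>2)" for x
    using norm_mult_le_sum_sq[of "orbit x i" "cnj (orbit x j)"] by simp
  then show "AE x in M. norm (orbit x i * cnj (orbit x j)) \<le> norm ((norm (orbit x i))\<^sup>2 + (norm (orbit x j))\<^sup>2)"
    by simp
qed measurable

lemma of_real_spectral_weight:
  "of_real (spectral_weight R r) = (\<Sum>i<R. \<Sum>j<R. correlation (int i - int j) *
      cis (- 2 * pi * of_int (int i - int j) * grid R r)) / (2 * of_nat R * of_nat R)"
proof -
  let ?c = "\<lambda>i. cis (- 2 * pi * of_int (int i) * grid R r)"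
  have c: "?c i * cnj (?c j) = cis (- 2 * pi * of_int (int i - int j) * grid R r)" for i j
    unfolding cis_cnj cis_mult by (intro arg_cong[where f = cis]) (simp add: algebra_simps)
  have "complex_of_real (\<integral>x. (norm (\<Sum>i<R. orbit x (int i) * ?c i))\<^sup>2 \<partial>M)
      = (\<integral>x. (\<Sum>i<R. orbit x (int i) * ?c i) * cnj (\<Sum>j<R. orbit x (int j) * ?c j) \<partial>M)"
    by (simp only: integral_complex_of_real[symmetric] complex_norm_square)
  also have "\<dots> = (\<integral>x. (\<Sum>i<R. \<Sum>j<R. (orbit x (int i) * cnj (orbit x (int j))) * (?c i * cnj (?c j))) \<partial>M)"
    by (simp only: cnj_sum complex_cnj_mult sum_product mult_ac)
  also have "\<dots> = (\<Sum>i<R. \<Sum>j<R. correlation (int i - int j) * (?c i * cnj (?c j)))"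
    by (subst Bochner_Integration.integral_sum)
       (auto simp: integral_orbit_orbit integrable_orbit_orbit
         intro!: Bochner_Integration.integrable_sum integrable_mult_left)
  finally show ?thesis unfolding c by (simp add: spectral_weight_def power2_eq_square)
qed

text \<open>The Fejer polynomial has frequencies below R in absolute value, and the character adds
  at most R. All frequencies thus stay below 2R, so a grid of 2R points sums them without aliasing;
  the factor in front counts the pairs with difference \<open>d\<close>.\<close>

lemma sum_spectral_weight:
  assumes R: "0 < R" and d: "\<bar>d\<bar> \<le> int R"
  shows "(\<Sum>r<2*R. of_real (spectral_weight R r) * cis (2 * pi * of_int d * grid R r))
      = (1 - of_int \<bar>d\<bar> / of_nat R) * correlation d"
proof -
  define S where "S = {(i, j). i < R \<and> j < R \<and> int i - int j = d}"
  have "(\<Sum>r<2*R. of_real (spectral_weight R r) * cis (2 * pi * of_int d * grid R r))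
     = (\<Sum>r<2*R. \<Sum>i<R. \<Sum>j<R. correlation (int i - int j) *
          cis (2 * pi * of_int (d - (int i - int j)) * grid R r)) / (2 * of_nat R * of_nat R)"
    unfolding of_real_spectral_weight sum_divide_distrib[symmetric] times_divide_eq_left sum_distrib_right mult.assoc cis_mult
    by (intro arg_cong2[where f = "(/)"] sum.cong refl arg_cong2[where f = "(*)"] arg_cong[where f = cis])
       (simp add: algebra_simps)
  also have "(\<Sum>r<2*R. \<Sum>i<R. \<Sum>j<R. correlation (int i - int j) *
          cis (2 * pi * of_int (d - (int i - int j)) * grid R r))
      = (\<Sum>i<R. \<Sum>j<R. correlation (int i - int j) * (\<Sum>r<2*R. cis (2 * pi * of_int (d - (int i - int j)) * grid R r)))"
  proof -
    define g where "g i j r = correlation (int i - int j) * cis (2 * pi * of_int (d - (int i - int j)) * grid R r)"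
      for i j r
    have "(\<Sum>r<2*R. \<Sum>i<R. \<Sum>j<R. g i j r) = (\<Sum>i<R. \<Sum>r<2*R. \<Sum>j<R. g i j r)" by (rule sum.swap)
    also have "\<dots> = (\<Sum>i<R. \<Sum>j<R. \<Sum>r<2*R. g i j r)" by (intro sum.cong refl sum.swap)
    finally show ?thesis by (simp only: g_def sum_distrib_left)
  qed
  also have "\<dots> = (\<Sum>i<R. \<Sum>j<R. if int i - int j = d then of_nat (2 * R) * correlation d else 0)"
  proof (intro sum.cong refl)
    fix i j assume ij: "i \<in> {..<R}" "j \<in> {..<R}"
    then have "\<bar>d - (int i - int j)\<bar> < 2 * int R" using d by auto
    from sum_cis_grid[OF R this]
    show "correlation (int i - int j) * (\<Sum>r<2*R. cis (2 * pi * of_int (d - (int i - int j)) * grid R r))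
       = (if int i - int j = d then of_nat (2 * R) * correlation d else 0)"
      by auto
  qed
  also have "\<dots> = (\<Sum>p\<in>{..<R} \<times> {..<R}. if p \<in> S then of_nat (2 * R) * correlation d else 0)"
    by (simp add: sum.cartesian_product case_prod_beta S_def)
       (intro sum.cong refl, auto)
  also have "\<dots> = (\<Sum>p\<in>({..<R} \<times> {..<R}) \<inter> S. of_nat (2 * R) * correlation d)"
    by (rule sum.inter_restrict[symmetric]) simp
  also have "({..<R} \<times> {..<R}) \<inter> S = S" by (auto simp: S_def)
  also have "(\<Sum>p\<in>S. of_nat (2 * R) * correlation d) = of_nat (card S) * (of_nat (2 * R) * correlation d)" by simp
  also have "(of_nat (card S) :: complex) = of_int (int R - \<bar>d\<bar>)"
    using card_pairs_diff[OF d] by (metis S_def of_int_of_nat_eq)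
  also have "of_int (int R - \<bar>d\<bar>) * (of_nat (2 * R) * correlation d) / (2 * of_nat R * of_nat R)
      = (1 - of_int \<bar>d\<bar> / of_nat R) * correlation d"
    using R by (simp add: field_simps)
  finally show ?thesis .
qed

lemma correlation_0: "correlation 0 = of_real energy"
proof -
  have "correlation 0 = (\<integral>x. complex_of_real ((norm (f x))\<^sup>2) \<partial>M)"
    unfolding correlation_def complex_norm_square by (simp add: orbit_def)
  also have "\<dots> = of_real energy" unfolding energy_def by (rule integral_complex_of_real)
  finally show ?thesis .
qed

lemma spectral_weight_total: "0 < R \<Longrightarrow> (\<Sum>r<2*R. spectral_weight R r) = energy"
proof -
  assume R: "0 < R"
  have "complex_of_real (\<Sum>r<2*R. spectral_weight R r) = of_real energy"
    using sum_spectral_weight[OF R, of 0] by (simp add: correlation_0)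
  then show ?thesis by (simp only: of_real_eq_iff)
qed

lemma spectral_weight_tendsto:
  "(\<lambda>R. \<Sum>r<2*R. of_real (spectral_weight R r) * cis (2 * pi * of_int d * grid R r)) \<longlonglongrightarrow> correlation d"
proof -
  have "(\<lambda>R. (1 - of_int \<bar>d\<bar> / of_nat R) * correlation d) \<longlonglongrightarrow> (1 - 0) * correlation d"
    by (intro tendsto_intros lim_const_over_n)
  moreover have "\<forall>\<^sub>F R in sequentially. (1 - of_int \<bar>d\<bar> / of_nat R) * correlation d =
      (\<Sum>r<2*R. of_real (spectral_weight R r) * cis (2 * pi * of_int d * grid R r))"
    using eventually_ge_at_top[of "Suc (nat \<bar>d\<bar>)"]
  proof eventually_elim
    case (elim R)
    then show ?case using sum_spectral_weight[of R d] by simp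
  qed
  ultimately show ?thesis by (auto intro: Lim_transform_eventually)
qed

lemma norm_sum_spectral_weight_le:
  "norm (\<Sum>r<2*R. of_real (spectral_weight R r) * cis (a r)) \<le> energy"
proof (cases "R = 0")
  case False
  have "norm (\<Sum>r<2*R. of_real (spectral_weight R r) * cis (a r)) \<le> (\<Sum>r<2*R. spectral_weight R r)"
    by (rule sum_norm_le) (simp add: norm_mult spectral_weight_nonneg)
  then show ?thesis using spectral_weight_total[of R] False by simp
qed (simp add: energy_nonneg)

text \<open>Correlations are replaced by their Fejer approximations. These are bounded by
  \<open>energy\<close>, so dominated convergence applies under \<open>Q\<close> and then under
  \<open>P\<close>; for fixed R the double integral factors into characteristic functions.\<close>

lemma average_inner_tendsto:
  "(\<lambda>R. \<Sum>r<2*R. of_real (spectral_weight R r) * (cnj (charfun P (grid R r)) * charfun Q (grid R r)))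
     \<longlonglongrightarrow> (\<integral>x. average P x * cnj (average Q x) \<partial>M)"
proof -
  define S where "S R d = (\<Sum>r<2*R. of_real (spectral_weight R r) * cis (2 * pi * of_int d * grid R r))" for R and d :: int
  have bound: "norm (S R d) \<le> energy" for R d unfolding S_def by (rule norm_sum_spectral_weight_le)
  have int_cis: "integrable (measure_pmf P) (\<lambda>k. c * cis (u k))" for P :: "int pmf" and u c
    by (rule measure_pmf.integrable_const_bound[where B = "norm c"]) (auto simp: norm_mult)
  have int_S: "integrable (measure_pmf Q) (\<lambda>l. S R (l - j))" for R j
    by (rule measure_pmf.integrable_const_bound[where B = energy]) (auto simp: bound)
  have inner: "(\<lambda>R. \<integral>l. S R (l - j) \<partial>Q) \<longlonglongrightarrow> (\<integral>l. correlation (l - j) \<partial>Q)" for j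
  proof (rule integral_dominated_convergence[where w = "\<lambda>_. energy"])
    show "AE l in Q. (\<lambda>R. S R (l - j)) \<longlonglongrightarrow> correlation (l - j)"
      unfolding S_def using spectral_weight_tendsto by (simp del: of_int_diff)
  qed (auto simp: bound)
  have inner_bound: "norm (\<integral>l. S R (l - j) \<partial>Q) \<le> energy" for R j
  proof -
    have "norm (\<integral>l. S R (l - j) \<partial>Q) \<le> (\<integral>l. norm (S R (l - j)) \<partial>Q)" by (rule integral_norm_bound)
    also have "\<dots> \<le> (\<integral>l. energy \<partial>Q)" by (intro integral_mono integrable_norm int_S bound) simp
    finally show ?thesis by simp
  qed
  have "(\<lambda>R. \<integral>j. cnj (\<integral>l. S R (l - j) \<partial>Q) \<partial>P) \<longlonglongrightarrow> (\<integral>j. cnj (\<integral>l. correlation (l - j) \<partial>Q) \<partial>P)"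
  proof (rule integral_dominated_convergence[where w = "\<lambda>_. energy"])
    show "AE j in P. (\<lambda>R. cnj (\<integral>l. S R (l - j) \<partial>Q)) \<longlonglongrightarrow> cnj (\<integral>l. correlation (l - j) \<partial>Q)"
      using inner by (simp add: tendsto_cnj)
  qed (use inner_bound in auto)
  moreover have "(\<integral>j. cnj (\<integral>l. S R (l - j) \<partial>Q) \<partial>P) =
      (\<Sum>r<2*R. of_real (spectral_weight R r) * (cnj (charfun P (grid R r)) * charfun Q (grid R r)))" for R
  proof -
    have split: "cis (2 * pi * of_int (l - j) * t) = cis (- (2 * pi * of_int j * t)) * cnj (cis (- 2 * pi * of_int l * t))"
      for l j :: int and t
      unfolding cis_cnj cis_mult by (intro arg_cong[where f = cis]) (simp add: algebra_simps)
    have "(\<integral>l. S R (l - j) \<partial>Q) = (\<Sum>r<2*R. of_real (spectral_weight R r) *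
        (cis (- (2 * pi * of_int j * grid R r)) * cnj (charfun Q (grid R r))))" for j
    proof -
      have "(\<integral>l. S R (l - j) \<partial>Q) = (\<Sum>r<2*R. \<integral>l. of_real (spectral_weight R r) * cis (2 * pi * of_int (l - j) * grid R r) \<partial>Q)"
        unfolding S_def by (rule Bochner_Integration.integral_sum) (rule int_cis)
      then show ?thesis unfolding split by (simp add: charfun_def)
    qed
    then have "(\<integral>j. cnj (\<integral>l. S R (l - j) \<partial>Q) \<partial>P) = (\<integral>j. (\<Sum>r<2*R. (of_real (spectral_weight R r) * charfun Q (grid R r))
        * cis (2 * pi * of_int j * grid R r)) \<partial>P)"
      by (simp add: cis_cnj mult_ac)
    also have "\<dots> = (\<Sum>r<2*R. \<integral>j. (of_real (spectral_weight R r) * charfun Q (grid R r)) * cis (2 * pi * of_int j * grid R r) \<partial>P)"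
      by (rule Bochner_Integration.integral_sum) (rule int_cis)
    also have "\<dots> = (\<Sum>r<2*R. of_real (spectral_weight R r) * (cnj (charfun P (grid R r)) * charfun Q (grid R r)))"
      by (simp add: charfun_def Bochner_Integration.integral_cnj[symmetric] cis_cnj mult_ac)
    finally show ?thesis .
  qed
  ultimately show ?thesis by (simp add: integral_average_average)
qed

lemma average_integrable: "integrable M (\<lambda>x. average P x * cnj (average Q x))"
proof (rule Bochner_Integration.integrable_bound)
  show "integrable M (\<lambda>x. (norm (average P x))\<^sup>2 + (norm (average Q x))\<^sup>2)"
    using nn_integral_average_sq le_less_trans[OF nn_integral_average_sq ennreal_less_top]
    by (intro Bochner_Integration.integrable_add integrableI_nonneg) (auto simp: top.not_eq_extremum)
  have "norm (average P x * cnj (average Q x)) \<le> norm ((norm (average P x))\<^sup>2 + (norm (average Q x))\<^sup>2)" for x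
    using norm_mult_le_sum_sq[of "average P x" "cnj (average Q x)"] by simp
  then show "AE x in M. norm (average P x * cnj (average Q x)) \<le> norm ((norm (average P x))\<^sup>2 + (norm (average Q x))\<^sup>2)"
    by simp
qed measurable

lemma average_diff_sq_tendsto:
  "(\<lambda>R. \<Sum>r<2*R. spectral_weight R r * (norm (charfun P (grid R r) - charfun Q (grid R r)))\<^sup>2)
     \<longlonglongrightarrow> (\<integral>x. (norm (average P x - average Q x))\<^sup>2 \<partial>M)"
proof -
  define I where "I P Q = (\<integral>x. average P x * cnj (average Q x) \<partial>M)" for P Q
  define W where "W P Q R = (\<Sum>r<2*R. of_real (spectral_weight R r) * (cnj (charfun P (grid R r)) * charfun Q (grid R r)))" for P Q R
  have W: "W P Q \<longlonglongrightarrow> I P Q" for P Q unfolding W_def I_def by (rule average_inner_tendsto)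
  have "(\<lambda>R. W P P R - W P Q R - W Q P R + W Q Q R) \<longlonglongrightarrow> I P P - I P Q - I Q P + I Q Q"
    by (intro tendsto_intros W)
  also have "(\<lambda>R. W P P R - W P Q R - W Q P R + W Q Q R) =
     (\<lambda>R. of_real (\<Sum>r<2*R. spectral_weight R r * (norm (charfun P (grid R r) - charfun Q (grid R r)))\<^sup>2))"
    unfolding W_def sum_subtractf[symmetric] sum.distrib[symmetric] of_real_sum of_real_mult
      complex_norm_square complex_cnj_diff
    by (intro ext sum.cong refl) (simp add: algebra_simps)
  also have "I P P - I P Q - I Q P + I Q Q = (\<integral>x. (average P x * cnj (average P x) - average P x * cnj (average Q x)
      - average Q x * cnj (average P x)) + average Q x * cnj (average Q x) \<partial>M)"
    unfolding I_def by (simp add: average_integrable)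
  also have "\<dots> = (\<integral>x. complex_of_real ((norm (average P x - average Q x))\<^sup>2) \<partial>M)"
    by (intro Bochner_Integration.integral_cong refl) (simp only: complex_norm_square complex_cnj_diff, simp add: algebra_simps)
  also have "\<dots> = of_real (\<integral>x. (norm (average P x - average Q x))\<^sup>2 \<partial>M)" by (rule integral_complex_of_real)
  finally show ?thesis by (simp only: tendsto_of_real_iff)
qed

lemma average_diff_integrable: "integrable M (\<lambda>x. (norm (average P x - average Q x))\<^sup>2)"
proof -
  have "integrable M (\<lambda>x. Re ((average P x * cnj (average P x) - average P x * cnj (average Q x)
      - average Q x * cnj (average P x)) + average Q x * cnj (average Q x)))"
    by (intro integrable_Re Bochner_Integration.integrable_add Bochner_Integration.integrable_diff average_integrable)
  also have "(\<lambda>x. Re ((average P x * cnj (average P x) - average P x * cnj (average Q x)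
      - average Q x * cnj (average P x)) + average Q x * cnj (average Q x))) = (\<lambda>x. (norm (average P x - average Q x))\<^sup>2)"
    by (rule ext) (simp only: cmod_power2, simp add: power2_eq_square algebra_simps)
  finally show ?thesis .
qed

text \<open>The spectral weights are nonnegative with total mass \<open>energy\<close>, so a bound
  on the symbols uniform in t integrates to one on the averages. Only finite sums pass through the
  limit in R; since \<open>B\<close> is independent of K, the full series follows.\<close>

lemma square_function_le:
  assumes c: "\<And>k. 0 \<le> c k" and B: "0 \<le> B"
    and symbol: "\<And>t K. t \<in> {-1/2..<1/2} \<Longrightarrow> (\<Sum>k<K. c k * (norm (charfun (P k) t - charfun (Q k) t))\<^sup>2) \<le> B"
  shows "(\<integral>\<^sup>+x. (\<Sum>k. ennreal (c k * (norm (average (P k) x - average (Q k) x))\<^sup>2)) \<partial>M) \<le> ennreal (B * energy)"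
proof -
  define J where "J k = (\<integral>x. (norm (average (P k) x - average (Q k) x))\<^sup>2 \<partial>M)" for k
  have fin: "(\<Sum>k<K. c k * J k) \<le> B * energy" for K
  proof (rule LIMSEQ_le_const2)
    show "(\<lambda>R. \<Sum>k<K. c k * (\<Sum>r<2*R. spectral_weight R r * (norm (charfun (P k) (grid R r) - charfun (Q k) (grid R r)))\<^sup>2))
      \<longlonglongrightarrow> (\<Sum>k<K. c k * J k)"
      unfolding J_def by (intro tendsto_intros average_diff_sq_tendsto)
    have "(\<Sum>k<K. c k * (\<Sum>r<2*R. spectral_weight R r * (norm (charfun (P k) (grid R r) - charfun (Q k) (grid R r)))\<^sup>2)) \<le> B * energy"
      if "1 \<le> R" for R
    proof -
      have "(\<Sum>k<K. c k * (\<Sum>r<2*R. spectral_weight R r * (norm (charfun (P k) (grid R r) - charfun (Q k) (grid R r)))\<^sup>2))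
        = (\<Sum>r<2*R. spectral_weight R r * (\<Sum>k<K. c k * (norm (charfun (P k) (grid R r) - charfun (Q k) (grid R r)))\<^sup>2))"
        unfolding sum_distrib_left by (subst sum.swap) (simp add: mult_ac)
      also have "\<dots> \<le> (\<Sum>r<2*R. spectral_weight R r * B)"
        by (intro sum_mono mult_left_mono symbol grid_range spectral_weight_nonneg) auto
      also have "\<dots> = B * energy" using spectral_weight_total[of R] that by (simp flip: sum_distrib_right)
      finally show ?thesis .
    qed
    then show "\<exists>N. \<forall>R\<ge>N. (\<Sum>k<K. c k * (\<Sum>r<2*R. spectral_weight R r *
        (norm (charfun (P k) (grid R r) - charfun (Q k) (grid R r)))\<^sup>2)) \<le> B * energy" by blast
  qed
  have "(\<integral>\<^sup>+x. (\<Sum>k. ennreal (c k * (norm (average (P k) x - average (Q k) x))\<^sup>2)) \<partial>M)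
      = (\<Sum>k. \<integral>\<^sup>+x. ennreal (c k * (norm (average (P k) x - average (Q k) x))\<^sup>2) \<partial>M)"
    by (rule nn_integral_suminf) measurable
  also have "\<dots> = (\<Sum>k. ennreal (c k * J k))"
  proof (rule suminf_cong)
    fix k
    have "(\<integral>\<^sup>+x. ennreal (c k * (norm (average (P k) x - average (Q k) x))\<^sup>2) \<partial>M)
        = ennreal (\<integral>x. c k * (norm (average (P k) x - average (Q k) x))\<^sup>2 \<partial>M)"
      by (intro nn_integral_eq_integral integrable_mult_right average_diff_integrable) (simp add: c)
    then show "(\<integral>\<^sup>+x. ennreal (c k * (norm (average (P k) x - average (Q k) x))\<^sup>2) \<partial>M) = ennreal (c k * J k)"
      by (simp add: J_def)
  qed
  also have "\<dots> \<le> ennreal (B * energy)"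
  proof (rule suminf_le_const)
    show "(\<Sum>k<K. ennreal (c k * J k)) \<le> ennreal (B * energy)" for K
      by (subst sum_ennreal) (auto simp: c J_def intro!: ennreal_leI fin[unfolded J_def])
  qed simp
  finally show ?thesis .
qed

end

section \<open>Multiplier estimates for convolution products\<close>

text \<open>The partial sums of \<open>K - b k\<close> are nonnegative and decreasing weights keep
  them so. This form is required because the squared moments are bounded on average but not
  individually.\<close>

lemma sum_mult_decreasing_le:
  fixes b w :: "nat \<Rightarrow> real"
  assumes w: "decseq w" "\<And>n. 0 \<le> w n" and b: "\<And>n. (\<Sum>k<n. b k) \<le> K * real n"
  shows "(\<Sum>k<n. w k * b k) \<le> K * (\<Sum>k<n. w k)"
proof -
  define d where "d k = K - b k" for k
  have d: "0 \<le> (\<Sum>k<n. d k)" for n using b[of n] by (simp add: d_def sum_subtractf mult.commute)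
  have "w n * (\<Sum>k<n. d k) \<le> (\<Sum>k<n. w k * d k)"
  proof (induction n)
    case (Suc n)
    have "w (Suc n) * (\<Sum>k<Suc n. d k) \<le> w n * (\<Sum>k<Suc n. d k)"
      using d[of "Suc n"] decseq_SucD[OF w(1), of n] by (intro mult_right_mono) auto
    also have "\<dots> \<le> (\<Sum>k<Suc n. w k * d k)" using Suc by (simp add: distrib_left)
    finally show ?case .
  qed simp
  then have "0 \<le> (\<Sum>k<n. w k * d k)" using mult_nonneg_nonneg[OF w(2)[of n] d[of n]] by linarith
  then show ?thesis by (simp add: d_def right_diff_distrib sum_subtractf sum_distrib_left mult.commute)
qed

text \<open>A geometric sum with ratio \<open>\<rho>\<close> whose gap \<open>1 - \<rho>\<close> is
  at least c \<theta> / (1 + c), by exp x \<ge> 1 + x and \<theta> \<le> 1. The factor \<theta>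
  cancels the gap, so the bound is uniform in \<theta>.\<close>

lemma mult_sum_exp_le:
  fixes c \<theta> :: real
  assumes c: "0 < c" and \<theta>: "0 \<le> \<theta>" "\<theta> \<le> 1"
  shows "\<theta> * (\<Sum>k<n. exp (- c * real k * \<theta>)) \<le> 1 + 1 / c"
proof (cases "\<theta> = 0")
  case True
  then show ?thesis using c by simp
next
  case False
  define \<rho> where "\<rho> = exp (- c * \<theta>)"
  have x: "0 < c * \<theta>" using c \<theta> False by simp
  have \<rho>: "0 < \<rho>" "\<rho> < 1" using x by (auto simp: \<rho>_def)
  have "exp (- c * real k * \<theta>) = \<rho> ^ k" for k
    by (simp add: \<rho>_def exp_of_nat_mult[symmetric] mult_ac)
  then have "(\<Sum>k<n. exp (- c * real k * \<theta>)) = (1 - \<rho> ^ n) / (1 - \<rho>)"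
    using \<rho> by (simp add: sum_gp_strict)
  also have "\<dots> \<le> 1 / (1 - \<rho>)" using \<rho> by (intro divide_right_mono) auto
  finally have 1: "(\<Sum>k<n. exp (- c * real k * \<theta>)) \<le> 1 / (1 - \<rho>)" .
  have "\<rho> * (1 + c * \<theta>) \<le> \<rho> * exp (c * \<theta>)" using \<rho> exp_ge_add_one_self[of "c * \<theta>"] by (intro mult_left_mono) auto
  also have "\<dots> = 1" by (simp add: \<rho>_def flip: exp_add)
  finally have "c * \<theta> \<le> (1 - \<rho>) * (1 + c * \<theta>)" by (simp add: algebra_simps)
  also have "\<dots> \<le> (1 - \<rho>) * (1 + c)" using \<rho> c \<theta> by (intro mult_left_mono) (auto simp: mult_left_le)
  finally have "\<theta> / (1 - \<rho>) \<le> 1 + 1 / c" using \<rho> c by (simp add: field_simps)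
  moreover have "\<theta> * (\<Sum>k<n. exp (- c * real k * \<theta>)) \<le> \<theta> * (1 / (1 - \<rho>))" using 1 \<theta> by (intro mult_left_mono)
  ultimately show ?thesis by simp
qed

text \<open>One convolution sequence at one fixed frequency t, with \<theta> = t^2:
  \<open>p n\<close> is the symbol of the product and \<open>z n\<close> that of the next factor.
  The constants \<open>A\<close>, \<open>c\<close>, \<open>K\<close> do not refer to t, so all
  estimates come out uniform.\<close>

locale symbol =
  fixes p z :: "nat \<Rightarrow> complex" and m :: "nat \<Rightarrow> real" and A c K \<theta> :: real
  assumes c: "0 < c" and A: "0 \<le> A" and K: "0 \<le> K" and \<theta>: "0 \<le> \<theta>" "\<theta> \<le> 1"
    and p_0: "p 0 = 1" and p_Suc: "p (Suc n) = p n * z n"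
    and p_decay: "norm (p n) \<le> A * exp (- c * real n * \<theta>)" and p_le_1: "norm (p n) \<le> 1"
    and z: "norm (1 - z n) \<le> m n * \<theta>"
    and m: "\<And>n. 0 \<le> m n" "\<And>n. (\<Sum>k<n. (m k)\<^sup>2) \<le> K * real n"
begin

lemma sum_weighted_increments_le: "(\<Sum>n<N. real n * (norm (p (Suc n) - p n))\<^sup>2) \<le> A\<^sup>2 / c * K * (1 + 1 / c)"
proof -
  have pt: "real n * (norm (p (Suc n) - p n))\<^sup>2 \<le> A\<^sup>2 / c * (\<theta> * (exp (- c * real n * \<theta>) * (m n)\<^sup>2))" for n
  proof -
    let ?e = "exp (- c * real n * \<theta>)"
    have "norm (p (Suc n) - p n) = norm (p n) * norm (1 - z n)"
      by (simp add: p_Suc norm_mult[symmetric] right_diff_distrib norm_minus_commute)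
    also have "\<dots> \<le> (A * ?e) * (m n * \<theta>)" using p_decay z A by (intro mult_mono) auto
    finally have "(norm (p (Suc n) - p n))\<^sup>2 \<le> ((A * ?e) * (m n * \<theta>))\<^sup>2" by (intro power_mono) auto
    then have "real n * (norm (p (Suc n) - p n))\<^sup>2 \<le> real n * ((A * ?e) * (m n * \<theta>))\<^sup>2" by (intro mult_left_mono) auto
    \<comment> \<open>Of the two exponentials one absorbs the weight n, through x exp(-x) \<le> 1;
      the other, with one factor \<theta>, is kept for the summation by parts.\<close>
    also have "\<dots> = (c * real n * \<theta> * ?e) * (A\<^sup>2 / c * (\<theta> * (?e * (m n)\<^sup>2)))"
      using c by (simp add: power2_eq_square field_simps)
    also have "\<dots> \<le> 1 * (A\<^sup>2 / c * (\<theta> * (?e * (m n)\<^sup>2)))"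
    proof (rule mult_right_mono)
      have "c * real n * \<theta> * ?e \<le> exp (c * real n * \<theta>) * ?e"
        using exp_ge_add_one_self[of "c * real n * \<theta>"] by (intro mult_right_mono) (linarith, simp)
      then show "c * real n * \<theta> * ?e \<le> 1" by (simp flip: exp_add)
    qed (use c \<theta> in auto)
    finally show ?thesis by simp
  qed
  have "(\<Sum>n<N. real n * (norm (p (Suc n) - p n))\<^sup>2) \<le> (\<Sum>n<N. A\<^sup>2 / c * (\<theta> * (exp (- c * real n * \<theta>) * (m n)\<^sup>2)))"
    by (intro sum_mono pt)
  also have "\<dots> = A\<^sup>2 / c * (\<theta> * (\<Sum>n<N. exp (- c * real n * \<theta>) * (m n)\<^sup>2))" by (simp add: sum_distrib_left)
  also have "\<dots> \<le> A\<^sup>2 / c * (\<theta> * (K * (\<Sum>n<N. exp (- c * real n * \<theta>))))"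
    using c \<theta> m by (intro mult_left_mono sum_mult_decreasing_le) (auto simp: decseq_def mult_left_mono mult_right_mono)
  also have "\<dots> = A\<^sup>2 / c * K * (\<theta> * (\<Sum>n<N. exp (- c * real n * \<theta>)))" by simp
  also have "\<dots> \<le> A\<^sup>2 / c * K * (1 + 1 / c)"
    using c K \<theta> by (intro mult_left_mono mult_sum_exp_le) auto
  finally show ?thesis .
qed

text \<open>Telescoping gives the sum of the \<open>m k\<close>, and Cauchy-Schwarz turns the bound
  on the sum of their squares into linear growth.\<close>

lemma norm_1_minus_le: "norm (1 - p n) \<le> sqrt K * real n * \<theta>"
proof -
  have "norm (1 - p n) \<le> (\<Sum>k<n. m k) * \<theta>" for n
  proof (induction n)
    case (Suc n)
    have "norm (1 - p (Suc n)) = norm ((1 - p n) + p n * (1 - z n))" by (simp add: p_Suc algebra_simps)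
    also have "\<dots> \<le> norm (1 - p n) + norm (p n) * norm (1 - z n)" by (metis norm_triangle_ineq norm_mult)
    also have "\<dots> \<le> norm (1 - p n) + 1 * norm (1 - z n)" by (intro add_left_mono mult_right_mono p_le_1) auto
    also have "\<dots> \<le> (\<Sum>k<Suc n. m k) * \<theta>" using Suc z[of n] by (simp add: distrib_right)
    finally show ?case .
  qed (simp add: p_0)
  also have "(\<Sum>k<n. m k) * \<theta> \<le> (sqrt K * real n) * \<theta>"
  proof (intro mult_right_mono \<theta>)
    have "(\<Sum>k<n. m k)\<^sup>2 \<le> (\<Sum>k<n. (m k)\<^sup>2) * real (card {..<n})" by (rule sum_squared_le_sum_of_squares)
    also have "\<dots> \<le> (K * real n) * real n" using m(2)[of n] by (simp add: mult_right_mono)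
    also have "\<dots> = (sqrt K * real n)\<^sup>2" using K by (simp add: power_mult_distrib power2_eq_square)
    finally show "(\<Sum>k<n. m k) \<le> sqrt K * real n" by (rule power2_le_imp_le) (use K in auto)
  qed
  finally show ?thesis .
qed

end

text \<open>One factor of the square is bounded by 2 sqrt K n \<theta>, the other by the exponential
  decay. The n cancels 1/n and leaves \<theta> exp(-c n \<theta>), whose sum is bounded uniformly;
  without the cancellation at small n the sum would depend on \<theta>.\<close>

lemma sum_symbol_diff_le:
  assumes p: "symbol p z m A c K \<theta>" and q: "symbol q z' m' A c K \<theta>"
  shows "(\<Sum>n<N. 1 / real n * (norm (p n - q n))\<^sup>2) \<le> 4 * sqrt K * A * (1 + 1 / c)"
proof -
  interpret p: symbol p z m A c K \<theta> by fact
  interpret q: symbol q z' m' A c K \<theta> by fact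
  have pt: "1 / real n * (norm (p n - q n))\<^sup>2 \<le> 4 * sqrt K * A * (\<theta> * exp (- c * real n * \<theta>))" for n
  proof (cases "n = 0")
    case False
    let ?e = "exp (- c * real n * \<theta>)"
    have "norm (p n - q n) \<le> norm (1 - q n) + norm (1 - p n)"
      using norm_triangle_ineq4[of "1 - q n" "1 - p n"] by simp
    then have 1: "norm (p n - q n) \<le> 2 * (sqrt K * real n * \<theta>)" using p.norm_1_minus_le[of n] q.norm_1_minus_le[of n] by linarith
    have 2: "norm (p n - q n) \<le> 2 * (A * ?e)"
      using norm_triangle_ineq4[of "p n" "q n"] p.p_decay[of n] q.p_decay[of n] by linarith
    have "(norm (p n - q n))\<^sup>2 \<le> (2 * (sqrt K * real n * \<theta>)) * (2 * (A * ?e))"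
      unfolding power2_eq_square using p.K p.\<theta> by (intro mult_mono 1 2) auto
    then show ?thesis using False by (simp add: field_simps)
  qed (use p.A p.K p.\<theta> in auto)
  have "(\<Sum>n<N. 1 / real n * (norm (p n - q n))\<^sup>2) \<le> 4 * sqrt K * A * (\<theta> * (\<Sum>n<N. exp (- c * real n * \<theta>)))"
    unfolding sum_distrib_left by (intro sum_mono) (use pt in \<open>simp add: mult_ac\<close>)
  also have "\<dots> \<le> 4 * sqrt K * A * (1 + 1 / c)"
    using p.A p.K p.c p.\<theta> by (intro mult_left_mono mult_sum_exp_le) auto
  finally show ?thesis .
qed

section \<open>Sums, integrals and characteristic functions of probability mass functions\<close>

lemma integral_pmf_eq_infsum_aux:
  fixes g :: "'b \<Rightarrow> 'c::{banach, second_countable_topology, real_normed_algebra_1}"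
  assumes "(\<lambda>k. of_real (pmf P k) * g k) summable_on UNIV \<Longrightarrow>
     (\<lambda>k. norm (of_real (pmf P k) * g k)) summable_on UNIV"
  shows "(\<Sum>\<^sub>\<infinity>k. of_real (pmf P k) * g k) = (\<integral>k. g k \<partial>P)"
proof -
  let ?h = "\<lambda>k. of_real (pmf P k) * g k"
  have I: "(\<integral>k. g k \<partial>P) = infsetsum ?h UNIV"
    unfolding infsetsum_def measure_pmf_eq_density by (subst integral_density) (simp_all add: scaleR_conv_of_real)
  show ?thesis
  proof (cases "Infinite_Set_Sum.abs_summable_on ?h UNIV")
    case True
    then show ?thesis by (simp add: I infsetsum_infsum)
  next
    case False
    then have "\<not> ?h summable_on UNIV" using assms abs_summable_equivalent[of ?h UNIV] by blast
    then show ?thesis using False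
      by (simp add: I infsum_not_exists infsetsum_def Infinite_Set_Sum.abs_summable_on_def not_integrable_integral_eq)
  qed
qed

text \<open>True for every \<open>g\<close>: summability and absolute summability agree here, and
  both sides default to 0 otherwise.\<close>

lemma integral_pmf_eq_infsum: "(\<Sum>\<^sub>\<infinity>k. of_real (pmf P k) * g k) = (\<integral>k. g k \<partial>P)" for g :: "'b \<Rightarrow> complex"
  by (rule integral_pmf_eq_infsum_aux) (rule iffD1[OF summable_on_iff_abs_summable_on_complex])

lemma integral_pmf_eq_infsum_real: "(\<Sum>\<^sub>\<infinity>k. pmf P k * g k) = (\<integral>k. g k \<partial>P)" for g :: "'b \<Rightarrow> real"
  using integral_pmf_eq_infsum_aux[OF iffD1[OF summable_on_iff_abs_summable_on_real], of P g] by simp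

lemma fourier_eq_charfun: "fourier P t = charfun P t"
  unfolding fourier_def integral_pmf_eq_infsum charfun_def
  by (intro Bochner_Integration.integral_cong refl) (simp add: cis_conv_exp mult_ac)

lemma mean_eq_integral: "mean P = (\<integral>k. real_of_int k \<partial>P)"
  unfolding mean_def using integral_pmf_eq_infsum_real[of P real_of_int] by (simp add: mult.commute)

lemma abs_moment_2_finite:
  assumes "abs_moment 2 P \<noteq> \<infinity>"
  shows "integrable P (\<lambda>k. (real_of_int k)\<^sup>2)" and "abs_moment 2 P = ennreal (\<integral>k. (real_of_int k)\<^sup>2 \<partial>P)"
proof -
  let ?h = "\<lambda>k. pmf P k * (real_of_int k)\<^sup>2"
  have eq: "ennreal (real_of_int (\<bar>k\<bar> ^ 2) * pmf P k) = ennreal (?h k)" for k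
    by (simp add: mult.commute)
  have h: "abs_moment 2 P = (SUP F\<in>{F. finite F \<and> F \<subseteq> UNIV}. ennreal (sum ?h F))"
    unfolding abs_moment_def eq
    by (subst nonneg_infsum_complete) (auto intro!: SUP_cong sum_ennreal)
  have summ: "?h summable_on UNIV"
  proof (rule nonneg_bdd_above_summable_on)
    obtain B where B: "abs_moment 2 P = ennreal B" "0 \<le> B" using assms by (cases "abs_moment 2 P") auto
    have "sum ?h F \<le> B" if "finite F" for F
    proof -
      have "ennreal (sum ?h F) \<le> ennreal B" unfolding B(1)[symmetric] h using that by (intro SUP_upper) auto
      then show ?thesis using B by simp
    qed
    then show "bdd_above (sum ?h ` {F. F \<subseteq> UNIV \<and> finite F})" by (intro bdd_aboveI2) auto
  qed simp
  then have "Infinite_Set_Sum.abs_summable_on ?h UNIV"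
    using iffD1[OF summable_on_iff_abs_summable_on_real] abs_summable_equivalent by blast
  then have "integrable (density (count_space UNIV) (\<lambda>k. ennreal (pmf P k))) (\<lambda>k. (real_of_int k)\<^sup>2)"
    by (subst integrable_density) (simp_all add: Infinite_Set_Sum.abs_summable_on_def)
  then show "integrable P (\<lambda>k. (real_of_int k)\<^sup>2)" by (simp add: measure_pmf_eq_density)
  show "abs_moment 2 P = ennreal (\<integral>k. (real_of_int k)\<^sup>2 \<partial>P)"
    unfolding h integral_pmf_eq_infsum_real[symmetric]
    by (rule infsum_nonneg_is_SUPREMUM_ennreal[symmetric]) (use summ in auto)
qed

lemma integrable_cis: "integrable (measure_pmf P) (\<lambda>k. cis (u k))"
  by (rule measure_pmf.integrable_const_bound[where B = 1]) auto

lemma norm_charfun_le_1: "norm (charfun P t) \<le> 1"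
proof -
  have "norm (charfun P t) \<le> (\<integral>k. norm (cis (- 2 * pi * real_of_int k * t)) \<partial>P)" unfolding charfun_def by (rule integral_norm_bound)
  then show ?thesis by simp
qed

text \<open>The mean being zero, the linear Taylor term can be subtracted for free; |e^(iu) - 1 -
  iu| \<le> u^2 / 2 at u = -2 pi k t gives 2 pi^2. The finite second moment makes the mean a genuine
  integral.\<close>

lemma norm_1_minus_charfun_le:
  fixes P :: "int pmf"
  assumes int2: "integrable P (\<lambda>k. (real_of_int k)\<^sup>2)" and mean: "mean P = 0"
  shows "norm (1 - charfun P t) \<le> 2 * pi\<^sup>2 * (\<integral>k. (real_of_int k)\<^sup>2 \<partial>P) * t\<^sup>2"
proof -
  let ?u = "\<lambda>k::int. - 2 * pi * real_of_int k * t"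
  have int1: "integrable P real_of_int"
  proof (rule Bochner_Integration.integrable_bound[OF int2])
    have "\<bar>real_of_int k\<bar> \<le> (real_of_int k)\<^sup>2" for k :: int
    proof -
      have "\<bar>k\<bar> * 1 \<le> \<bar>k\<bar> * \<bar>k\<bar>"
      proof (cases "k = 0")
        case False
        then have "1 \<le> \<bar>k\<bar>" by simp
        then show ?thesis by (rule mult_left_mono) simp
      qed simp
      then have "real_of_int (\<bar>k\<bar>) \<le> real_of_int (\<bar>k\<bar> * \<bar>k\<bar>)" by (subst of_int_le_iff) simp
      then show ?thesis by (simp add: power2_eq_square abs_mult_self_eq)
    qed
    then show "AE k in P. norm (real_of_int k) \<le> norm ((real_of_int k)\<^sup>2)" by simp
  qed simp
  have int1c: "integrable P (\<lambda>k. complex_of_real (real_of_int k))" using int1 by (rule integrable_of_real)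
  have int3: "integrable P (\<lambda>k. \<i> * complex_of_real (?u k))"
  proof -
    have "integrable P (\<lambda>k. (- 2 * of_real pi * of_real t * \<i>) * complex_of_real (real_of_int k))"
      using int1c by (intro integrable_mult_right)
    also have "(\<lambda>k. (- 2 * of_real pi * of_real t * \<i>) * complex_of_real (real_of_int k))
        = (\<lambda>k. \<i> * complex_of_real (?u k))"
      by (rule ext) simp
    finally show ?thesis .
  qed
  have zero: "(\<integral>k. \<i> * complex_of_real (?u k) \<partial>P) = 0"
  proof -
    have "(\<integral>k. \<i> * complex_of_real (?u k) \<partial>P) = (\<integral>k. (- 2 * of_real pi * of_real t * \<i>) * complex_of_real (real_of_int k) \<partial>P)"
      by (intro Bochner_Integration.integral_cong refl) simp
    also have "\<dots> = (- 2 * of_real pi * of_real t * \<i>) * (\<integral>k. complex_of_real (real_of_int k) \<partial>P)" by simp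
    also have "(\<integral>k. complex_of_real (real_of_int k) \<partial>P) = complex_of_real (mean P)"
      unfolding mean_eq_integral by (rule integral_complex_of_real)
    finally show ?thesis by (simp add: mean)
  qed
  have i1: "integrable P (\<lambda>k. cis (?u k) - 1)" by (intro Bochner_Integration.integrable_diff integrable_cis) simp
  have "(\<integral>k. cis (?u k) - 1 \<partial>P) = charfun P t - 1"
    unfolding charfun_def by (subst Bochner_Integration.integral_diff) (use integrable_cis in auto)
  then have "charfun P t - 1 = (\<integral>k. cis (?u k) - 1 - \<i> * complex_of_real (?u k) \<partial>P)"
    unfolding Bochner_Integration.integral_diff[OF i1 int3] zero by simp
  also have "norm \<dots> \<le> (\<integral>k. norm (cis (?u k) - 1 - \<i> * complex_of_real (?u k)) \<partial>P)" by (rule integral_norm_bound)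
  also have "\<dots> \<le> (\<integral>k. 2 * pi\<^sup>2 * t\<^sup>2 * (real_of_int k)\<^sup>2 \<partial>P)"
  proof (rule integral_mono)
    show "integrable P (\<lambda>k. norm (cis (?u k) - 1 - \<i> * complex_of_real (?u k)))"
      by (intro integrable_norm Bochner_Integration.integrable_diff[OF i1 int3])
    show "integrable P (\<lambda>k. 2 * pi\<^sup>2 * t\<^sup>2 * (real_of_int k)\<^sup>2)" using int2 by simp
    have "norm (cis x - 1 - \<i> * complex_of_real x) \<le> x\<^sup>2 / 2" for x
      using iexp_approx1[of x 1] by (simp add: cis_conv_exp power2_eq_square abs_mult_self_eq algebra_simps)
    from this[of "?u k" for k]
    show "norm (cis (?u k) - 1 - \<i> * complex_of_real (?u k)) \<le> 2 * pi\<^sup>2 * t\<^sup>2 * (real_of_int k)\<^sup>2" for k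
      by (simp add: power_mult_distrib mult_ac)
  qed
  finally show ?thesis by (simp add: norm_minus_commute mult_ac)
qed

primrec walk_pmf :: "(nat \<Rightarrow> int pmf) \<Rightarrow> nat \<Rightarrow> int pmf" where
  "walk_pmf \<nu> 0 = return_pmf 0"
| "walk_pmf \<nu> (Suc n) = bind_pmf (walk_pmf \<nu> n) (\<lambda>j. map_pmf (\<lambda>k. j + k) (\<nu> (Suc n)))"

lemma conv_prod_eq_pmf: "conv_prod \<nu> n = pmf (walk_pmf \<nu> n)"
proof (induction n)
  case 0
  then show ?case by (auto simp: fun_eq_iff)
next
  case (Suc n)
  show ?case
  proof
    fix k
    have "pmf (map_pmf (\<lambda>k. j + k) (\<nu> (Suc n))) k = pmf (\<nu> (Suc n)) (k - j)" for j
      using pmf_map_inj'[of "\<lambda>k. j + k" "\<nu> (Suc n)" "k - j"] by (simp add: inj_on_def)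
    then have "pmf (walk_pmf \<nu> (Suc n)) k = (\<integral>j. pmf (\<nu> (Suc n)) (k - j) \<partial>walk_pmf \<nu> n)"
      by (simp add: pmf_bind)
    then show "conv_prod \<nu> (Suc n) k = pmf (walk_pmf \<nu> (Suc n)) k"
      by (simp add: Suc conv_def integral_pmf_eq_infsum_real)
  qed
qed

lemma integral_bind_pmf_bounded:
  fixes g :: "'b \<Rightarrow> real"
  assumes "\<And>x. \<bar>g x\<bar> \<le> B"
  shows "(\<integral>x. g x \<partial>bind_pmf P Q) = (\<integral>y. (\<integral>x. g x \<partial>Q y) \<partial>P)"
  unfolding measure_pmf_bind
  by (rule integral_bind[where K = "count_space UNIV" and B = B and B' = 1])
     (use assms in \<open>auto simp: measure_pmf.finite_measure measure_pmf.emeasure_space_1[simplified]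
       intro!: measure_pmf_in_subprob_algebra\<close>)

lemma integral_bind_pmf_bounded_complex:
  fixes g :: "'b \<Rightarrow> complex" and P :: "'c pmf" and Q :: "'c \<Rightarrow> 'b pmf"
  assumes g: "\<And>x. norm (g x) \<le> B"
  shows "(\<integral>x. g x \<partial>bind_pmf P Q) = (\<integral>y. (\<integral>x. g x \<partial>Q y) \<partial>P)"
proof -
  have i: "integrable (measure_pmf R) g" for R :: "'b pmf"
    by (rule measure_pmf.integrable_const_bound[where B = B]) (use g in auto)
  have "norm (\<integral>x. g x \<partial>R) \<le> B" for R :: "'b pmf"
  proof -
    have "norm (\<integral>x. g x \<partial>R) \<le> (\<integral>x. norm (g x) \<partial>R)" by (rule integral_norm_bound)
    also have "\<dots> \<le> (\<integral>x. B \<partial>R)" by (intro integral_mono integrable_norm i g) simp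
    finally show ?thesis by simp
  qed
  then have i2: "integrable (measure_pmf P) (\<lambda>y. \<integral>x. g x \<partial>Q y)"
    by (intro measure_pmf.integrable_const_bound[where B = B]) auto
  have "\<bar>Re (g x)\<bar> \<le> B" "\<bar>Im (g x)\<bar> \<le> B" for x
    using g[of x] abs_Re_le_cmod[of "g x"] abs_Im_le_cmod[of "g x"] by linarith+
  then show ?thesis
    by (simp add: complex_eq_iff i i2 integral_bind_pmf_bounded[where B = B] flip: integral_Re integral_Im)
qed

lemma charfun_walk_Suc: "charfun (walk_pmf \<nu> (Suc n)) t = charfun (walk_pmf \<nu> n) t * charfun (\<nu> (Suc n)) t"
proof -
  let ?P = "walk_pmf \<nu> n" and ?Q = "\<lambda>j. map_pmf (\<lambda>k. j + k) (\<nu> (Suc n))"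
  let ?e = "\<lambda>k::int. cis (- 2 * pi * real_of_int k * t)"
  have "(\<integral>k. ?e k \<partial>bind_pmf ?P ?Q) = (\<integral>j. (\<integral>k. ?e k \<partial>?Q j) \<partial>?P)"
    by (rule integral_bind_pmf_bounded_complex[where B = 1]) simp
  also have "\<dots> = (\<integral>j. (\<integral>k. ?e j * ?e k \<partial>\<nu> (Suc n)) \<partial>?P)"
  proof -
    have "?e (j + k) = ?e j * ?e k" for j k :: int
      unfolding cis_mult by (intro arg_cong[where f = cis]) (simp add: algebra_simps)
    then show ?thesis by (simp only: integral_map_pmf)
  qed
  also have "\<dots> = charfun ?P t * charfun (\<nu> (Suc n)) t" by (simp add: charfun_def)
  finally show ?thesis by (simp add: charfun_def)
qed

section \<open>The convolution products and the lazy walk\<close>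

text \<open>Lets two symbols share their constants, as their comparison demands.\<close>

lemma symbol_mono:
  assumes "symbol p z m A c K \<theta>" "A \<le> A'" "0 < c'" "c' \<le> c" "K \<le> K'"
  shows "symbol p z m A' c' K' \<theta>"
proof -
  interpret symbol p z m A c K \<theta> by fact
  show ?thesis
  proof
    show "norm (p n) \<le> A' * exp (- c' * real n * \<theta>)" for n
    proof -
      have "c' * real n * \<theta> \<le> c * real n * \<theta>" using assms \<theta> by (intro mult_right_mono) auto
      then have "A * exp (- c * real n * \<theta>) \<le> A' * exp (- c' * real n * \<theta>)"
        using A assms(2) by (intro mult_mono) auto
      then show ?thesis using p_decay[of n] by linarith
    qed
    show "(\<Sum>k<n. (m k)\<^sup>2) \<le> K' * real n" for n
      using m(2)[of n] mult_right_mono[OF assms(5), of "real n"] by simp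
  qed (use assms A K \<theta> p_0 p_Suc p_le_1 z m in auto)
qed

lemma charfun_return_0 [simp]: "charfun (return_pmf 0) t = 1"
  by (simp add: charfun_def)

text \<open>The O(n) bound holds for large n only. It forces every single moment to be finite, since
  each occurs in a large sum, and the finitely many smaller n are covered by the partial sum up to
  \<open>n1\<close> at the price of the factor \<open>n1\<close>.\<close>

lemma second_moment_bound:
  assumes "\<exists>K::real. \<forall>\<^sub>F n in sequentially. (\<Sum>i=1..n. (abs_moment 2 (\<nu> i))\<^sup>2) \<le> ennreal (K * real n)"
  obtains K where "0 \<le> K" "\<And>i. 1 \<le> i \<Longrightarrow> abs_moment 2 (\<nu> i) \<noteq> \<infinity>"
    "\<And>n. (\<Sum>k<n. (\<integral>j. (real_of_int j)\<^sup>2 \<partial>\<nu> (Suc k))\<^sup>2) \<le> K * real n"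
proof -
  obtain K n0 where K: "\<And>n. n0 \<le> n \<Longrightarrow> (\<Sum>i=1..n. (abs_moment 2 (\<nu> i))\<^sup>2) \<le> ennreal (K * real n)"
    using assms by (auto simp: eventually_sequentially)
  define n1 where "n1 = Suc n0"
  have fin: "abs_moment 2 (\<nu> i) \<noteq> \<infinity>" if "1 \<le> i" for i
  proof
    assume "abs_moment 2 (\<nu> i) = \<infinity>"
    then have "\<infinity> = (abs_moment 2 (\<nu> i))\<^sup>2" by (simp add: power2_eq_square)
    also have "\<dots> \<le> (\<Sum>i=1..i + n0. (abs_moment 2 (\<nu> i))\<^sup>2)" by (rule member_le_sum) (use that in auto)
    also have "\<dots> \<le> ennreal (K * real (i + n0))" by (rule K) simp
    finally show False by (simp add: top_unique)
  qed
  define b where "b k = (\<integral>j. (real_of_int j)\<^sup>2 \<partial>\<nu> (Suc k))\<^sup>2" for k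
  have b0: "0 \<le> b k" for k by (simp add: b_def)
  have sum_eq: "ennreal (\<Sum>k<n. b k) = (\<Sum>i=1..n. (abs_moment 2 (\<nu> i))\<^sup>2)" for n
  proof -
    have "ennreal (\<Sum>k<n. b k) = (\<Sum>k<n. ennreal (b k))" by (rule sum_ennreal[symmetric]) (simp add: b0)
    also have "\<dots> = (\<Sum>k<n. (abs_moment 2 (\<nu> (Suc k)))\<^sup>2)"
      using abs_moment_2_finite(2)[OF fin] by (simp add: b_def ennreal_power)
    also have "\<dots> = (\<Sum>i=1..n. (abs_moment 2 (\<nu> i))\<^sup>2)"
      by (rule sum.reindex_bij_witness[of _ "\<lambda>i. i - 1" Suc]) auto
    finally show ?thesis .
  qed
  have large: "(\<Sum>k<n. b k) \<le> \<bar>K\<bar> * real n" if "n0 \<le> n" for n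
  proof -
    have "ennreal (\<Sum>k<n. b k) \<le> ennreal (\<bar>K\<bar> * real n)"
      unfolding sum_eq by (rule order_trans[OF K[OF that]]) (auto intro!: ennreal_leI mult_right_mono)
    then show ?thesis by (subst (asm) ennreal_le_iff) auto
  qed
  have "(\<Sum>k<n. b k) \<le> (\<bar>K\<bar> * real n1) * real n" for n
  proof (cases "n = 0 \<or> n0 \<le> n")
    case True
    have "\<bar>K\<bar> * 1 \<le> \<bar>K\<bar> * real n1" by (intro mult_left_mono) (auto simp: n1_def)
    then have "\<bar>K\<bar> * real n \<le> (\<bar>K\<bar> * real n1) * real n" by (intro mult_right_mono) auto
    with True large[of n] show ?thesis by auto
  next
    case False
    then have "(\<Sum>k<n. b k) \<le> (\<Sum>k<n1. b k)" by (intro sum_mono2) (auto simp: b0 n1_def)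
    also have "\<dots> \<le> (\<bar>K\<bar> * real n1) * 1" using large[of n1] by (simp add: n1_def)
    also have "\<dots> \<le> (\<bar>K\<bar> * real n1) * real n" using False by (intro mult_left_mono) auto
    finally show ?thesis .
  qed
  then show ?thesis using fin by (intro that[of "\<bar>K\<bar> * real n1"]) (auto simp: b_def)
qed

text \<open>The first \<open>N\<^sub>0\<close> factors are bounded only by 1. As t^2 \<le> 1, the
  decay lost on them is at most the factor exp(c \<open>N\<^sub>0\<close>), the origin of the
  constant A.\<close>

lemma symbol_walk:
  assumes mean: "\<And>n. n \<ge> 1 \<Longrightarrow> mean (\<nu> n) = 0"
    and K: "0 \<le> K" "\<And>i. 1 \<le> i \<Longrightarrow> abs_moment 2 (\<nu> i) \<noteq> \<infinity>"
      "\<And>n. (\<Sum>k<n. (\<integral>j. (real_of_int j)\<^sup>2 \<partial>\<nu> (Suc k))\<^sup>2) \<le> K * real n"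
    and c: "0 < c" and decay: "\<And>n. n > N\<^sub>0 \<Longrightarrow> norm (charfun (\<nu> n) t) \<le> exp (- c * t\<^sup>2)"
    and t: "t \<in> {-1/2..<1/2}"
  shows "symbol (\<lambda>n. charfun (walk_pmf \<nu> n) t) (\<lambda>n. charfun (\<nu> (Suc n)) t)
    (\<lambda>n. 2 * pi\<^sup>2 * (\<integral>j. (real_of_int j)\<^sup>2 \<partial>\<nu> (Suc n))) (exp (c * real N\<^sub>0)) c (4 * pi ^ 4 * K) (t\<^sup>2)"
proof
  have "t\<^sup>2 \<le> 1\<^sup>2" using t by (intro power2_le_iff_abs_le[THEN iffD2]) auto
  then show t2: "t\<^sup>2 \<le> 1" by simp
  show "norm (charfun (walk_pmf \<nu> n) t) \<le> exp (c * real N\<^sub>0) * exp (- c * real n * t\<^sup>2)" for n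
  proof (induction n)
    case 0
    then show ?case using c by simp
  next
    case (Suc n)
    show ?case
    proof (cases "Suc n \<le> N\<^sub>0")
      case True
      have "norm (charfun (walk_pmf \<nu> (Suc n)) t) \<le> exp 0" using norm_charfun_le_1 by simp
      also have "\<dots> \<le> exp (c * real N\<^sub>0 + - c * real (Suc n) * t\<^sup>2)"
      proof (subst exp_le_cancel_iff)
        have "real (Suc n) * t\<^sup>2 \<le> real N\<^sub>0 * 1" using True t2 by (intro mult_mono) auto
        then have "c * (real (Suc n) * t\<^sup>2) \<le> c * real N\<^sub>0" using c by simp
        then show "0 \<le> c * real N\<^sub>0 + - c * real (Suc n) * t\<^sup>2" by (simp add: mult.assoc)
      qed
      finally show ?thesis by (simp only: exp_add)
    next
      case False
      have "norm (charfun (walk_pmf \<nu> (Suc n)) t) \<le> (exp (c * real N\<^sub>0) * exp (- c * real n * t\<^sup>2)) * exp (- c * t\<^sup>2)"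
        unfolding charfun_walk_Suc norm_mult using False by (intro mult_mono Suc decay) auto
      also have "\<dots> = exp (c * real N\<^sub>0) * exp (- c * real (Suc n) * t\<^sup>2)"
        by (simp add: mult.assoc exp_add[symmetric] algebra_simps)
      finally show ?thesis .
    qed
  qed
  show "norm (1 - charfun (\<nu> (Suc n)) t) \<le> 2 * pi\<^sup>2 * (\<integral>j. (real_of_int j)\<^sup>2 \<partial>\<nu> (Suc n)) * t\<^sup>2" for n
    by (intro norm_1_minus_charfun_le abs_moment_2_finite K mean) auto
  show "(\<Sum>k<n. (2 * pi\<^sup>2 * (\<integral>j. (real_of_int j)\<^sup>2 \<partial>\<nu> (Suc k)))\<^sup>2) \<le> 4 * pi ^ 4 * K * real n" for n
  proof -
    have "(\<Sum>k<n. (2 * pi\<^sup>2 * (\<integral>j. (real_of_int j)\<^sup>2 \<partial>\<nu> (Suc k)))\<^sup>2)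
        = 4 * pi ^ 4 * (\<Sum>k<n. (\<integral>j. (real_of_int j)\<^sup>2 \<partial>\<nu> (Suc k))\<^sup>2)"
      by (simp add: power_mult_distrib sum_distrib_left)
    also have "\<dots> \<le> 4 * pi ^ 4 * (K * real n)" by (intro mult_left_mono K) auto
    finally show ?thesis by simp
  qed
qed (use c K in \<open>auto simp: charfun_walk_Suc norm_charfun_le_1 simp del: walk_pmf.simps(2)\<close>)

text \<open>Steps -1, 1, 0 with probabilities 1/4, 1/4, 1/2, the law of the difference of two fair
  bits. Its symbol is cos(pi t)^2; the simple walk would have symbol -1 at t = -1/2 and no decay
  there.\<close>

definition lazy_pmf :: "int pmf" where
  "lazy_pmf = map_pmf (\<lambda>i. if i = 0 then - 1 else if i = 1 then 1 else 0) (pmf_of_set {..<4::nat})"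

lemma integral_lazy_pmf:
  fixes g :: "int \<Rightarrow> complex"
  shows "(\<integral>k. g k \<partial>lazy_pmf) = (g (- 1) + g 1 + 2 * g 0) / 4"
proof -
  have "(\<integral>k. g k \<partial>lazy_pmf) = (\<integral>i. g (if i = 0 then - 1 else if i = 1 then 1 else 0) \<partial>pmf_of_set {..<4::nat})"
    by (simp add: lazy_pmf_def integral_map_pmf)
  also have "\<dots> = (\<Sum>i<4. pmf (pmf_of_set {..<4::nat}) i *\<^sub>R g (if i = 0 then - 1 else if i = 1 then 1 else 0))"
    by (rule integral_measure_pmf) (auto simp: lessThan_empty_iff)
  also have "\<dots> = (g (- 1) + g 1 + 2 * g 0) / 4"
    by (simp add: lessThan_empty_iff eval_nat_numeral lessThan_Suc scaleR_conv_of_real field_simps)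
  finally show ?thesis .
qed

lemma finite_set_lazy_pmf: "finite (set_pmf lazy_pmf)"
  by (simp add: lazy_pmf_def lessThan_empty_iff)

lemma charfun_lazy: "charfun lazy_pmf t = of_real (1 - (sin (pi * t))\<^sup>2)"
proof -
  have "charfun lazy_pmf t = (cis (2 * pi * t) + cis (- (2 * pi * t)) + 2) / 4"
    by (simp add: charfun_def integral_lazy_pmf)
  also have "\<dots> = of_real ((1 + cos (2 * (pi * t))) / 2)"
    by (simp add: complex_eq_iff mult.assoc)
  also have "(1 + cos (2 * (pi * t))) / 2 = 1 - (sin (pi * t))\<^sup>2" unfolding cos_double_sin by simp
  finally show ?thesis .
qed

text \<open>A weak Jordan inequality from the cubic Taylor bound: |x| \<le> 1.7 makes |x|^3 / 6 at
  most |x| / 2, and pi \<ge> 2 does the rest.\<close>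

lemma sin_sq_ge:
  fixes t :: real assumes "\<bar>t\<bar> \<le> 1/2" shows "t\<^sup>2 \<le> (sin (pi * t))\<^sup>2"
proof -
  let ?x = "pi * t"
  have "\<bar>sin ?x - (\<Sum>m<3. sin_coeff m * ?x ^ m)\<bar> \<le> inverse (fact 3) * \<bar>?x\<bar> ^ 3" by (rule Maclaurin_sin_bound)
  then have "\<bar>sin ?x - ?x\<bar> \<le> \<bar>?x\<bar> ^ 3 / 6" by (simp add: eval_nat_numeral sin_coeff_def fact_numeral)
  also have "\<bar>?x\<bar> ^ 3 / 6 \<le> \<bar>?x\<bar> / 2"
  proof -
    have "\<bar>?x\<bar> \<le> 1.7"
    proof -
      have "\<bar>?x\<bar> \<le> pi * (1/2)" using assms by (simp add: abs_mult)
      also have "\<dots> \<le> 1.7" using pi_less_4 pi_approx by simp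
      finally show ?thesis .
    qed
    then have "\<bar>?x\<bar> * \<bar>?x\<bar> \<le> 1.7 * 1.7" by (intro mult_mono) auto
    then have "\<bar>?x\<bar> * \<bar>?x\<bar> * \<bar>?x\<bar> \<le> 3 * \<bar>?x\<bar>" by (intro mult_right_mono) auto
    then show ?thesis unfolding power3_eq_cube by linarith
  qed
  finally have "\<bar>?x\<bar> / 2 \<le> \<bar>sin ?x\<bar>" by linarith
  moreover have "2 * \<bar>t\<bar> \<le> \<bar>?x\<bar>" using pi_ge_two by (simp add: abs_mult mult_right_mono)
  ultimately have "\<bar>t\<bar> \<le> \<bar>sin ?x\<bar>" by linarith
  then show ?thesis by (simp add: abs_le_square_iff)
qed

lemma symbol_lazy:
  assumes t: "t \<in> {-1/2..<1/2}"
  shows "symbol (\<lambda>n. charfun (walk_pmf (\<lambda>_. lazy_pmf) n) t) (\<lambda>n. charfun lazy_pmf t) (\<lambda>n. pi\<^sup>2) 1 1 (pi ^ 4) (t\<^sup>2)"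
proof
  have "t\<^sup>2 \<le> 1\<^sup>2" using t by (intro power2_le_iff_abs_le[THEN iffD2]) auto
  then show "t\<^sup>2 \<le> 1" by simp
  have z: "norm (charfun lazy_pmf t) \<le> exp (- t\<^sup>2)"
  proof -
    have "norm (charfun lazy_pmf t) = 1 - (sin (pi * t))\<^sup>2"
      unfolding charfun_lazy norm_of_real using abs_sin_le_one[of "pi * t"]
      by (simp add: abs_square_le_1)
    also have "\<dots> \<le> 1 - t\<^sup>2" using sin_sq_ge[of t] t by auto
    also have "\<dots> \<le> exp (- t\<^sup>2)" using exp_ge_add_one_self[of "- t\<^sup>2"] by simp
    finally show ?thesis .
  qed
  show "norm (charfun (walk_pmf (\<lambda>_. lazy_pmf) n) t) \<le> 1 * exp (- 1 * real n * t\<^sup>2)" for n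
  proof (induction n)
    case (Suc n)
    have "norm (charfun (walk_pmf (\<lambda>_. lazy_pmf) (Suc n)) t) \<le> exp (- 1 * real n * t\<^sup>2) * exp (- t\<^sup>2)"
      unfolding charfun_walk_Suc norm_mult using Suc z by (intro mult_mono) auto
    then show ?case by (simp add: exp_add[symmetric] algebra_simps)
  qed simp
  show "norm (1 - charfun lazy_pmf t) \<le> pi\<^sup>2 * t\<^sup>2"
  proof -
    have "norm (1 - charfun lazy_pmf t) = (sin (pi * t))\<^sup>2"
      unfolding charfun_lazy by (simp add: norm_power)
    also have "\<dots> \<le> (pi * t)\<^sup>2" using abs_sin_x_le_abs_x[of "pi * t"] by (simp only: abs_le_square_iff)
    finally show ?thesis by (simp add: power_mult_distrib)
  qed
qed (auto simp: charfun_walk_Suc norm_charfun_le_1 simp del: walk_pmf.simps(2))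

lemma avg_fwd_bwd_commute: "avg_fwd (avg_bwd F) = avg_bwd (avg_fwd F)"
  by (rule ext) (simp add: avg_fwd_def avg_bwd_def add.commute)

lemma lazy_average_Suc: "lazy_average (Suc n) F = lazy_average n (avg_fwd (avg_bwd F))"
proof -
  have "avg_fwd ((avg_bwd ^^ n) G) = (avg_bwd ^^ n) (avg_fwd G)" for G
    by (induction n) (auto simp: avg_fwd_bwd_commute)
  then show ?thesis by (simp add: lazy_average_def funpow_Suc_right del: funpow.simps)
qed

lemma integral_walk_lazy:
  "(\<integral>j. F j \<partial>walk_pmf (\<lambda>_. lazy_pmf) n) = lazy_average n F"
proof (induction n arbitrary: F)
  case 0
  then show ?case by (simp add: lazy_average_def)
next
  case (Suc n)
  let ?P = "walk_pmf (\<lambda>_. lazy_pmf) n"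
  have fin: "finite (set_pmf ?P)" by (induction n) (auto simp: finite_set_lazy_pmf)
  have avg: "(\<integral>k. F (j + k) \<partial>lazy_pmf) = avg_fwd (avg_bwd F) j" for j
    by (simp add: integral_lazy_pmf avg_fwd_def avg_bwd_def field_simps)
  have "(\<integral>j. F j \<partial>walk_pmf (\<lambda>_. lazy_pmf) (Suc n))
      = (\<Sum>a\<in>set_pmf ?P. pmf ?P a *\<^sub>R (\<integral>k. F (a + k) \<partial>lazy_pmf))"
    using fin by (simp add: pmf_expectation_bind[of "set_pmf ?P"] finite_set_lazy_pmf)
  also have "\<dots> = (\<integral>j. avg_fwd (avg_bwd F) j \<partial>?P)"
    unfolding avg by (rule integral_measure_pmf[symmetric]) (use fin in auto)
  also have "\<dots> = lazy_average (Suc n) F" by (simp add: Suc lazy_average_Suc)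
  finally show ?case .
qed

section \<open>Dilation of the lazy averages\<close>

lemma square_sum_le_card_mult:
  fixes h :: "'b \<Rightarrow> real"
  assumes "real (card W) = N" "0 < N"
  shows "((\<Sum>w\<in>W. h w) / N)\<^sup>2 \<le> (\<Sum>w\<in>W. (h w)\<^sup>2) / N"
  using sum_squared_le_sum_of_squares[of h W] assms by (simp add: power_divide field_simps power2_eq_square)

text \<open>The starting point depends on all tosses, so on a fixed orbit this need not be a
  martingale in the tosses. Invariance of the measure removes the starting point after integration
  over the system.\<close>

definition coin_dilation :: "nat \<Rightarrow> (int \<Rightarrow> complex) \<Rightarrow> nat set \<Rightarrow> nat \<Rightarrow> complex" where
  "coin_dilation L F w = coin_walk L F (int (card w)) w"

text \<open>The mean over the tosses of the squared pathwise bound from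
  \<open>jump_variation_le\<close>; 256 is the square of 16.\<close>

definition variation_bound :: "real \<Rightarrow> nat \<Rightarrow> (int \<Rightarrow> complex) \<Rightarrow> real" where
  "variation_bound s L F = (\<Sum>w\<in>Pow {..<L}. 256 *
     ((run_max (coin_dilation L F w) L)\<^sup>2 + jump_series s (coin_dilation L F w) L)) / 2 ^ L"

definition oscillation_bound :: "nat \<Rightarrow> nat \<Rightarrow> (int \<Rightarrow> complex) \<Rightarrow> real" where
  "oscillation_bound a b F = (\<Sum>w\<in>Pow {..<b}. 4 *
     (run_max (\<lambda>k. coin_dilation b F w k - coin_dilation b F w 0) (b - a))\<^sup>2) / 2 ^ b"

definition variation_const :: "real \<Rightarrow> real" where
  "variation_const s = 256 * (4 + (\<Sum>m. (1/2) powr ((s - 2) * real m)))"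

lemma variation_const_nonneg: "2 < s \<Longrightarrow> 0 \<le> variation_const s"
  unfolding variation_const_def
  by (intro mult_nonneg_nonneg add_nonneg_nonneg suminf_nonneg half_powr_summable) auto

lemma card_coins: "real (card (Pow {..<L})) = 2 ^ L"
  by (simp add: card_Pow)

lemma variation_bound_nonneg: "2 < s \<Longrightarrow> 0 \<le> variation_bound s L F"
  unfolding variation_bound_def by (intro divide_nonneg_pos sum_nonneg) (auto simp: jump_series_nonneg)

lemma oscillation_bound_nonneg: "0 \<le> oscillation_bound a b F"
  unfolding oscillation_bound_def by (intro divide_nonneg_pos sum_nonneg) auto

text \<open>Minkowski's inequality moves the s-variation inside the mean over the tosses, where the
  pathwise bound applies in reversed time; Cauchy-Schwarz then passes to the mean square. Any
  \<open>L\<close> beyond the last index will do, and the bound does not mention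
  \<open>r\<close>.\<close>

lemma lazy_average_variation_le:
  assumes s: "2 < s" and r: "mono r" "r J \<le> L"
  shows "(\<Sum>j<J. norm (lazy_average (r j) F - lazy_average (r (Suc j)) F) powr s) \<le> (sqrt (variation_bound s L F)) powr s"
proof -
  let ?W = "Pow {..<L}" and ?X = "coin_dilation L F"
  define h where "h w = 16 * sqrt ((run_max (?X w) L)\<^sup>2 + jump_series s (?X w) L)" for w
  define a where "a w j = ?X w (L - r j) - ?X w (L - r (Suc j))" for w j
  have arg: "0 \<le> (run_max (?X w) L)\<^sup>2 + jump_series s (?X w) L" for w by (simp add: jump_series_nonneg[OF s])
  have h0: "0 \<le> h w" for w by (simp add: h_def arg)
  have anti: "antimono (\<lambda>j. L - r j)" using r(1) by (auto simp: antimono_def mono_def intro: diff_le_mono2)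
  have le: "(\<Sum>j<J. norm (\<Sum>w\<in>?W. a w j) powr s) \<le> (\<Sum>w\<in>?W. h w) powr s"
    unfolding a_def
    by (rule sum_norm_sum_powr_le) (use s h0 jump_variation_le[OF s anti, of L] in \<open>auto simp: h_def\<close>)
  have diff: "lazy_average (r j) F - lazy_average (r (Suc j)) F = (\<Sum>w\<in>?W. a w j) / 2 ^ L" if "j < J" for j
  proof -
    have "r j \<le> L" "r (Suc j) \<le> L" using that r monoD[OF r(1), of j J] monoD[OF r(1), of "Suc j" J] by auto
    then show ?thesis
      by (simp add: lazy_average_eq_coins a_def coin_dilation_def sum_subtractf diff_divide_distrib)
  qed
  have "(\<Sum>j<J. norm (lazy_average (r j) F - lazy_average (r (Suc j)) F) powr s)
      = (\<Sum>j<J. norm (\<Sum>w\<in>?W. a w j) powr s) / (2 ^ L) powr s"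
  proof -
    have "norm (z / 2 ^ L) powr s = norm z powr s / (2 ^ L) powr s" for z :: complex
      by (simp add: norm_divide norm_power powr_divide)
    then show ?thesis unfolding sum_divide_distrib by (intro sum.cong refl) (simp add: diff)
  qed
  also have "\<dots> \<le> (\<Sum>w\<in>?W. h w) powr s / (2 ^ L) powr s" by (intro divide_right_mono le) simp
  also have "\<dots> = ((\<Sum>w\<in>?W. h w) / 2 ^ L) powr s" by (rule powr_divide[symmetric])
  also have "\<dots> \<le> (sqrt (variation_bound s L F)) powr s"
  proof (intro powr_mono2 real_le_rsqrt)
    have "((\<Sum>w\<in>?W. h w) / 2 ^ L)\<^sup>2 \<le> (\<Sum>w\<in>?W. (h w)\<^sup>2) / 2 ^ L"
      by (rule square_sum_le_card_mult) (auto simp: card_coins)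
    also have "\<dots> = variation_bound s L F"
      by (simp add: h_def power_mult_distrib arg variation_bound_def)
    finally show "((\<Sum>w\<in>?W. h w) / 2 ^ L)\<^sup>2 \<le> variation_bound s L F" .
  qed (use s h0 in \<open>auto intro!: divide_nonneg_pos sum_nonneg\<close>)
  finally show ?thesis .
qed

lemma lazy_average_oscillation_le:
  assumes ab: "a \<le> n" "n \<le> b"
  shows "(norm (lazy_average n F - lazy_average a F))\<^sup>2 \<le> oscillation_bound a b F"
proof -
  let ?W = "Pow {..<b}" and ?X = "coin_dilation b F"
  define R where "R w = run_max (\<lambda>k. ?X w k - ?X w 0) (b - a)" for w
  have avg: "lazy_average m F = (\<Sum>w\<in>?W. ?X w (b - m)) / 2 ^ b" if "m \<le> b" for m
    using lazy_average_eq_coins[OF that, of F] by (simp add: coin_dilation_def)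
  have pt: "norm (?X w (b - n) - ?X w (b - a)) \<le> 2 * R w" for w
  proof -
    have "norm (?X w (b - n) - ?X w 0) \<le> R w" "norm (?X w (b - a) - ?X w 0) \<le> R w"
      unfolding R_def using ab by (auto intro: norm_le_run_max[of _ _ "\<lambda>k. ?X w k - ?X w 0"])
    then show ?thesis
      using norm_triangle_ineq4[of "?X w (b - n) - ?X w 0" "?X w (b - a) - ?X w 0"] by simp
  qed
  have "norm (lazy_average n F - lazy_average a F) = norm (\<Sum>w\<in>?W. ?X w (b - n) - ?X w (b - a)) / 2 ^ b"
    using ab by (simp add: avg sum_subtractf norm_divide norm_power flip: diff_divide_distrib)
  also have "\<dots> \<le> (\<Sum>w\<in>?W. 2 * R w) / 2 ^ b"
    by (intro divide_right_mono sum_norm_le pt) auto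
  finally have "(norm (lazy_average n F - lazy_average a F))\<^sup>2 \<le> ((\<Sum>w\<in>?W. 2 * R w) / 2 ^ b)\<^sup>2"
    by (intro power_mono) auto
  also have "\<dots> \<le> (\<Sum>w\<in>?W. (2 * R w)\<^sup>2) / 2 ^ b"
    by (rule square_sum_le_card_mult) (auto simp: card_coins)
  also have "\<dots> = oscillation_bound a b F" by (simp add: oscillation_bound_def R_def power_mult_distrib)
  finally show ?thesis .
qed

section \<open>Integrating the coin bounds over the system\<close>

lemma funpow_Suc_avg_bwd: "(avg_bwd ^^ Suc n) F j = ((avg_bwd ^^ n) F j + (avg_bwd ^^ n) F (j - 1)) / 2"
  unfolding funpow.simps comp_apply by (rule avg_bwd_def)

lemma funpow_avg_bwd_shift: "(avg_bwd ^^ n) (\<lambda>j. F (i + j)) j = (avg_bwd ^^ n) F (i + j)"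
  by (induction n arbitrary: j) (auto simp: avg_bwd_def algebra_simps)

lemma coin_walk_shift: "coin_walk L (\<lambda>j. F (i + j)) 0 w k = coin_walk L F i w k"
  by (simp add: coin_walk_def funpow_avg_bwd_shift)

lemma run_max_measurable [measurable]:
  assumes [measurable]: "\<And>k. (\<lambda>x. X x k) \<in> borel_measurable M"
  shows "(\<lambda>x. run_max (X x) n) \<in> borel_measurable M"
  by (induction n) auto

lemma anchor_measurable [measurable]:
  assumes [measurable]: "\<And>k. (\<lambda>x. X x k) \<in> borel_measurable M"
  shows "(\<lambda>x. anchor d (X x) n) \<in> borel_measurable M"
proof (induction n)
  case (Suc n)
  note Suc [measurable] and run_max_measurable[OF assms, measurable]
  show ?case unfolding anchor.simps by measurable
qed simp

lemma jump_series_measurable [measurable]: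
  assumes [measurable]: "\<And>k. (\<lambda>x. X x k) \<in> borel_measurable M"
  shows "(\<lambda>x. jump_series s (X x) n) \<in> borel_measurable M"
proof -
  note anchor_measurable[OF assms, measurable]
  show ?thesis unfolding jump_series_def jump_energy_def by measurable
qed

context square_integrable_observable
begin

lemma funpow_avg_bwd_orbit:
  shows funpow_avg_bwd_measurable [measurable]: "(\<lambda>x. (avg_bwd ^^ n) (orbit x) j) \<in> borel_measurable M"
    and funpow_avg_bwd_integrable: "integrable M (\<lambda>x. (norm ((avg_bwd ^^ n) (orbit x) j))\<^sup>2)"
proof (induction n arbitrary: j)
  case 0
  case 1 show ?case by simp
  case 2 show ?case using nn_integral_orbit_sq[of j] by (intro integrableI_nonneg) auto
next
  case (Suc n)
  note Suc(1) [measurable]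
  case 1 show ?case unfolding funpow_Suc_avg_bwd by measurable
  case 2
  let ?u = "\<lambda>x j. (avg_bwd ^^ n) (orbit x) j"
  show ?case
  proof (rule Bochner_Integration.integrable_bound)
    show "integrable M (\<lambda>x. (norm (?u x j))\<^sup>2 + (norm (?u x (j - 1)))\<^sup>2)"
      by (intro Bochner_Integration.integrable_add Suc(2))
    have "(norm ((avg_bwd ^^ Suc n) (orbit x) j))\<^sup>2 \<le> (norm (?u x j))\<^sup>2 + (norm (?u x (j - 1)))\<^sup>2" for x
    proof -
      have "(norm ((avg_bwd ^^ Suc n) (orbit x) j))\<^sup>2 \<le> ((norm (?u x j) + norm (?u x (j - 1))) / 2)\<^sup>2"
        by (intro power_mono) (auto simp: funpow_Suc_avg_bwd norm_divide norm_triangle_ineq simp del: funpow.simps)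
      also have "\<dots> \<le> (norm (?u x j))\<^sup>2 + (norm (?u x (j - 1)))\<^sup>2"
      proof -
        have "v\<^sup>2 + w\<^sup>2 - ((v + w) / 2)\<^sup>2 = ((v - w) / 2)\<^sup>2 + (v\<^sup>2 + w\<^sup>2) / 2" for v w :: real
          by (simp add: power2_eq_square field_simps)
        moreover have "0 \<le> ((v - w) / 2)\<^sup>2 + (v\<^sup>2 + w\<^sup>2) / 2" for v w :: real by simp
        ultimately show ?thesis by (smt (verit))
      qed
      finally show ?thesis .
    qed
    then show "AE x in M. norm ((norm ((avg_bwd ^^ Suc n) (orbit x) j))\<^sup>2) \<le> norm ((norm (?u x j))\<^sup>2 + (norm (?u x (j - 1)))\<^sup>2)"
      by simp
  qed (unfold funpow_Suc_avg_bwd, measurable)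
qed

text \<open>Squared L2 norm of the n-fold backward average of \<open>f\<close>. Differences of these
  numbers bound the oscillation over a block, so their sum over the blocks telescopes.\<close>

definition bwd_energy :: "nat \<Rightarrow> real" where
  "bwd_energy n = (\<integral>x. (norm ((avg_bwd ^^ n) (orbit x) 0))\<^sup>2 \<partial>M)"

lemma orbit_shift_fun: "x \<in> space M \<Longrightarrow> orbit (it i x) = (\<lambda>j. orbit x (i + j))"
  by (rule ext) (rule orbit_shift)

lemma integral_funpow_avg_bwd: "(\<integral>x. (norm ((avg_bwd ^^ n) (orbit x) j))\<^sup>2 \<partial>M) = bwd_energy n"
proof -
  have "ennreal (\<integral>x. (norm ((avg_bwd ^^ n) (orbit x) j))\<^sup>2 \<partial>M) = (\<integral>\<^sup>+x. ennreal ((norm ((avg_bwd ^^ n) (orbit x) j))\<^sup>2) \<partial>M)"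
    by (intro nn_integral_eq_integral[symmetric] funpow_avg_bwd_integrable) simp
  also have "\<dots> = (\<integral>\<^sup>+x. ennreal ((norm ((avg_bwd ^^ n) (orbit (it j x)) 0))\<^sup>2) \<partial>M)"
    by (intro nn_integral_cong) (simp add: orbit_shift_fun funpow_avg_bwd_shift)
  also have "\<dots> = (\<integral>\<^sup>+x. ennreal ((norm ((avg_bwd ^^ n) (orbit x) 0))\<^sup>2) \<partial>M)"
    by (rule nn_integral_it) measurable
  also have "\<dots> = ennreal (bwd_energy n)"
    unfolding bwd_energy_def by (intro nn_integral_eq_integral funpow_avg_bwd_integrable) simp
  finally show ?thesis by (simp add: bwd_energy_def)
qed

lemma coin_walk_measurable [measurable]: "(\<lambda>x. coin_walk L (orbit x) i w k) \<in> borel_measurable M"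
  unfolding coin_walk_def by measurable

lemma coin_dilation_measurable [measurable]: "(\<lambda>x. coin_dilation L (orbit x) w k) \<in> borel_measurable M"
  unfolding coin_dilation_def by measurable

lemma variation_bound_measurable [measurable]: "(\<lambda>x. variation_bound s L (orbit x)) \<in> borel_measurable M"
proof -
  note run_max_measurable[OF coin_dilation_measurable, measurable]
    jump_series_measurable[OF coin_dilation_measurable, measurable]
  show ?thesis unfolding variation_bound_def by measurable
qed

lemma oscillation_bound_measurable [measurable]: "(\<lambda>x. oscillation_bound a b (orbit x)) \<in> borel_measurable M"
proof -
  have [measurable]: "(\<lambda>x. run_max (\<lambda>k. coin_dilation b (orbit x) w k - coin_dilation b (orbit x) w 0) n) \<in> borel_measurable M" for w n
    by (rule run_max_measurable) measurable
  show ?thesis unfolding oscillation_bound_def by measurable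
qed

text \<open>For fixed \<open>w\<close> the dilation along the orbit of \<open>x\<close> is the walk
  started at 0 along the orbit of \<open>it (int (card w)) x\<close>, and this shift preserves the
  measure. Afterwards all tosses share one starting point, so a martingale inequality valid for each
  single sequence \<open>F\<close> applies.\<close>

lemma nn_integral_coin_dilation:
  fixes G :: "(nat \<Rightarrow> complex) \<Rightarrow> real"
  assumes meas: "\<And>w. (\<lambda>x. G (coin_walk L (orbit x) 0 w)) \<in> borel_measurable M" and G: "\<And>X. 0 \<le> G X"
    and le: "\<And>F. (\<Sum>w\<in>Pow {..<L}. G (coin_walk L F 0 w)) \<le> H F"
  shows "(\<integral>\<^sup>+x. ennreal ((\<Sum>w\<in>Pow {..<L}. G (coin_dilation L (orbit x) w)) / 2 ^ L) \<partial>M)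
      \<le> (\<integral>\<^sup>+x. ennreal (H (orbit x) / 2 ^ L) \<partial>M)"
proof -
  let ?W = "Pow {..<L}"
  note meas [measurable]
  have eq: "G (coin_dilation L (orbit x) w) = G (coin_walk L (orbit (it (int (card w)) x)) 0 w)" if "x \<in> space M" for x w
  proof -
    have "coin_dilation L (orbit x) w = coin_walk L (orbit (it (int (card w)) x)) 0 w"
      by (rule ext) (simp add: coin_dilation_def orbit_shift_fun[OF that] coin_walk_shift)
    then show ?thesis by simp
  qed
  have meas': "(\<lambda>x. ennreal (G (coin_walk L (orbit (it i x)) 0 w) / 2 ^ L)) \<in> borel_measurable M" for w i
    by (rule measurable_compose[OF it_meas, of "\<lambda>x. ennreal (G (coin_walk L (orbit x) 0 w) / 2 ^ L)"]) measurable
  have "(\<integral>\<^sup>+x. ennreal ((\<Sum>w\<in>?W. G (coin_dilation L (orbit x) w)) / 2 ^ L) \<partial>M)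
      = (\<integral>\<^sup>+x. (\<Sum>w\<in>?W. ennreal (G (coin_walk L (orbit (it (int (card w)) x)) 0 w) / 2 ^ L)) \<partial>M)"
    by (intro nn_integral_cong) (simp add: eq sum_divide_distrib sum_ennreal G)
  also have "\<dots> = (\<Sum>w\<in>?W. \<integral>\<^sup>+x. ennreal (G (coin_walk L (orbit (it (int (card w)) x)) 0 w) / 2 ^ L) \<partial>M)"
    by (rule nn_integral_sum) (rule meas')
  also have "\<dots> = (\<Sum>w\<in>?W. \<integral>\<^sup>+x. ennreal (G (coin_walk L (orbit x) 0 w) / 2 ^ L) \<partial>M)"
    by (intro sum.cong refl nn_integral_it) measurable
  also have "\<dots> = (\<integral>\<^sup>+x. (\<Sum>w\<in>?W. ennreal (G (coin_walk L (orbit x) 0 w) / 2 ^ L)) \<partial>M)"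
    by (rule nn_integral_sum[symmetric]) measurable
  also have "\<dots> = (\<integral>\<^sup>+x. ennreal ((\<Sum>w\<in>?W. G (coin_walk L (orbit x) 0 w)) / 2 ^ L) \<partial>M)"
    by (intro nn_integral_cong) (simp add: sum_divide_distrib sum_ennreal G)
  also have "\<dots> \<le> (\<integral>\<^sup>+x. ennreal (H (orbit x) / 2 ^ L) \<partial>M)"
    by (intro nn_integral_mono ennreal_leI divide_right_mono le) simp
  finally show ?thesis .
qed

lemma coin_walk_terminal: "w \<in> Pow {..<L} \<Longrightarrow> coin_walk L F 0 w L = F (- int (card w))"
  by (simp add: coin_walk_def Int_absorb2)

lemma nn_integral_variation_bound:
  assumes s: "2 < s"
  shows "(\<integral>\<^sup>+x. ennreal (variation_bound s L (orbit x)) \<partial>M) \<le> ennreal (variation_const s * energy)"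
proof -
  let ?W = "Pow {..<L}"
  have K0: "0 \<le> variation_const s / 2 ^ L" using variation_const_nonneg[OF s] by simp
  define H where "H F = variation_const s * (\<Sum>w\<in>?W. (norm (F (- int (card w))))\<^sup>2)" for F :: "int \<Rightarrow> complex"
  have "(\<integral>\<^sup>+x. ennreal (variation_bound s L (orbit x)) \<partial>M) \<le> (\<integral>\<^sup>+x. ennreal (H (orbit x) / 2 ^ L) \<partial>M)"
    unfolding variation_bound_def
  proof (rule nn_integral_coin_dilation)
    fix F :: "int \<Rightarrow> complex"
    interpret flip_martingale ?W "coin_walk L F 0" flip_coin L by (rule flip_martingale_coin_walk) simp
    have "(\<Sum>w\<in>?W. 256 * ((run_max (coin_walk L F 0 w) L)\<^sup>2 + jump_series s (coin_walk L F 0 w) L))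
       = 256 * ((\<Sum>w\<in>?W. (run_max (coin_walk L F 0 w) L)\<^sup>2) + (\<Sum>w\<in>?W. jump_series s (coin_walk L F 0 w) L))"
      by (simp add: sum_distrib_left[symmetric] sum.distrib)
    also have "\<dots> \<le> 256 * (4 * (\<Sum>w\<in>?W. (norm (coin_walk L F 0 w L))\<^sup>2) +
        (\<Sum>m. (1/2) powr ((s - 2) * real m)) * (\<Sum>w\<in>?W. (norm (coin_walk L F 0 w L))\<^sup>2))"
      by (intro mult_left_mono add_mono doob_maximal sum_jump_series_le s) simp
    also have "\<dots> = H F" by (simp add: H_def variation_const_def coin_walk_terminal distrib_right)
    finally show "(\<Sum>w\<in>?W. 256 * ((run_max (coin_walk L F 0 w) L)\<^sup>2 + jump_series s (coin_walk L F 0 w) L)) \<le> H F" .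
  next
    show "(\<lambda>x. 256 * ((run_max (coin_walk L (orbit x) 0 w) L)\<^sup>2 + jump_series s (coin_walk L (orbit x) 0 w) L)) \<in> borel_measurable M" for w
      using run_max_measurable[OF coin_walk_measurable] jump_series_measurable[OF coin_walk_measurable]
      by (intro borel_measurable_times borel_measurable_add borel_measurable_power) auto
  qed (simp add: jump_series_nonneg[OF s])
  also have "\<dots> = (\<integral>\<^sup>+x. (\<Sum>w\<in>?W. ennreal (variation_const s / 2 ^ L) * ennreal ((norm (orbit x (- int (card w))))\<^sup>2)) \<partial>M)"
  proof (intro nn_integral_cong)
    fix x
    have "H (orbit x) / 2 ^ L = (\<Sum>w\<in>?W. variation_const s / 2 ^ L * (norm (orbit x (- int (card w))))\<^sup>2)"
      by (simp add: H_def sum_distrib_left sum_divide_distrib)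
    also have "ennreal \<dots> = (\<Sum>w\<in>?W. ennreal (variation_const s / 2 ^ L * (norm (orbit x (- int (card w))))\<^sup>2))"
      by (rule sum_ennreal[symmetric]) (use K0 in \<open>simp only: mult_nonneg_nonneg zero_le_power2\<close>)
    finally show "ennreal (H (orbit x) / 2 ^ L) = (\<Sum>w\<in>?W. ennreal (variation_const s / 2 ^ L) * ennreal ((norm (orbit x (- int (card w))))\<^sup>2))"
      by (simp only: ennreal_mult'[OF K0])
  qed
  also have "\<dots> = (\<Sum>w\<in>?W. ennreal (variation_const s / 2 ^ L) * ennreal energy)"
    by (subst nn_integral_sum) (auto simp: nn_integral_cmult nn_integral_orbit_sq)
  also have "\<dots> = (\<Sum>w\<in>?W. ennreal (variation_const s / 2 ^ L * energy))"
    by (simp only: ennreal_mult'[OF K0])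
  also have "\<dots> = ennreal (\<Sum>w\<in>?W. variation_const s / 2 ^ L * energy)"
    by (rule sum_ennreal) (use K0 energy_nonneg in \<open>simp only: mult_nonneg_nonneg\<close>)
  also have "(\<Sum>w\<in>?W. variation_const s / 2 ^ L * energy) = variation_const s * energy"
    by (simp add: card_Pow)
  finally show ?thesis .
qed

text \<open>Doob's inequality gives a majorant \<open>H\<close> whose integral is computed exactly
  as the energy drop; being the integral of a nonnegative function, the drop is nonnegative, which
  is the second claim. The 16 is 4 from the triangle inequality times Doob's 4.\<close>

lemma
  assumes ab: "a \<le> b"
  shows nn_integral_oscillation_bound:
      "(\<integral>\<^sup>+x. ennreal (oscillation_bound a b (orbit x)) \<partial>M) \<le> ennreal (16 * (bwd_energy a - bwd_energy b))"
    and bwd_energy_antimono: "bwd_energy b \<le> bwd_energy a"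
proof -
  let ?W = "Pow {..<b}"
  define H where "H F = 16 * ((\<Sum>w\<in>?W. (norm (coin_walk b F 0 w (b - a)))\<^sup>2) - (\<Sum>w\<in>?W. (norm (coin_walk b F 0 w 0))\<^sup>2))" for F
  have le: "(\<Sum>w\<in>?W. 4 * (run_max (\<lambda>k. coin_walk b F 0 w k - coin_walk b F 0 w 0) (b - a))\<^sup>2) \<le> H F" for F
  proof -
    interpret flip_martingale ?W "coin_walk b F 0" flip_coin "b - a" by (rule flip_martingale_coin_walk) simp
    show ?thesis using sum_run_max_diff_le by (simp add: H_def flip: sum_distrib_left)
  qed
  have H0: "0 \<le> H F" for F by (rule order_trans[OF _ le]) (simp add: sum_nonneg)
  have int: "integrable M (\<lambda>x. (norm (coin_walk b (orbit x) 0 w k))\<^sup>2)" for w k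
    unfolding coin_walk_def by (rule funpow_avg_bwd_integrable)
  have val: "(\<integral>x. (norm (coin_walk b (orbit x) 0 w k))\<^sup>2 \<partial>M) = bwd_energy (b - k)" for w k
    unfolding coin_walk_def by (rule integral_funpow_avg_bwd)
  have intH: "integrable M (\<lambda>x. H (orbit x) / 2 ^ b)"
    unfolding H_def by (intro integrable_divide integrable_mult_right Bochner_Integration.integrable_diff
      Bochner_Integration.integrable_sum int)
  have drop: "(\<integral>x. H (orbit x) / 2 ^ b \<partial>M) = 16 * (bwd_energy a - bwd_energy b)"
  proof -
    have "(\<integral>x. H (orbit x) / 2 ^ b \<partial>M) = 16 * ((\<Sum>w\<in>?W. bwd_energy a) - (\<Sum>w\<in>?W. bwd_energy b)) / 2 ^ b"
      unfolding H_def using ab int by (simp add: val Bochner_Integration.integral_diff Bochner_Integration.integral_sum)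
    also have "\<dots> = 16 * (bwd_energy a - bwd_energy b)" by (simp add: card_Pow field_simps)
    finally show ?thesis .
  qed
  moreover have "0 \<le> (\<integral>x. H (orbit x) / 2 ^ b \<partial>M)" by (intro Bochner_Integration.integral_nonneg) (simp add: H0)
  ultimately show "bwd_energy b \<le> bwd_energy a" by simp
  have "(\<integral>\<^sup>+x. ennreal (oscillation_bound a b (orbit x)) \<partial>M) \<le> (\<integral>\<^sup>+x. ennreal (H (orbit x) / 2 ^ b) \<partial>M)"
    unfolding oscillation_bound_def
  proof (rule nn_integral_coin_dilation[where G = "\<lambda>X. 4 * (run_max (\<lambda>k. X k - X 0) (b - a))\<^sup>2"])
    show "(\<lambda>x. 4 * (run_max (\<lambda>k. coin_walk b (orbit x) 0 w k - coin_walk b (orbit x) 0 w 0) (b - a))\<^sup>2) \<in> borel_measurable M" for w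
      using run_max_measurable[of "\<lambda>x k. coin_walk b (orbit x) 0 w k - coin_walk b (orbit x) 0 w 0" M "b - a"]
      by (intro borel_measurable_times borel_measurable_power) auto
  qed (use le in auto)
  also have "\<dots> = ennreal (\<integral>x. H (orbit x) / 2 ^ b \<partial>M)"
    by (intro nn_integral_eq_integral intH) (simp add: H0)
  finally show "(\<integral>\<^sup>+x. ennreal (oscillation_bound a b (orbit x)) \<partial>M) \<le> ennreal (16 * (bwd_energy a - bwd_energy b))"
    by (simp only: drop)
qed

lemma bwd_energy_0: "bwd_energy 0 = energy"
  by (simp add: bwd_energy_def energy_def orbit_def)

lemma bwd_energy_nonneg: "0 \<le> bwd_energy n"
  by (simp add: bwd_energy_def)

end

section \<open>The variation and oscillation inequalities\<close>

lemma enn_powr_ennreal: "0 \<le> x \<Longrightarrow> enn_powr (ennreal x) a = ennreal (x powr a)"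
  by (simp add: enn_powr_def)

lemma enn_powr_half_sq: "(enn_powr x (1/2))\<^sup>2 = x"
proof (cases x)
  case (real r)
  then show ?thesis by (simp add: enn_powr_ennreal ennreal_power powr_half_sqrt)
qed (simp add: enn_powr_def power2_eq_square)

lemma enn_powr_half_mono: "x \<le> y \<Longrightarrow> enn_powr x (1/2) \<le> enn_powr y (1/2)"
proof (cases y)
  case (real r)
  moreover assume "x \<le> y"
  ultimately obtain q where "x = ennreal q" "0 \<le> q" by (cases x) (auto simp: top_unique)
  then show ?thesis using real \<open>x \<le> y\<close> by (auto simp: enn_powr_ennreal intro!: ennreal_leI powr_mono2)
qed (simp add: enn_powr_def)

lemma ennreal_add_multiples:
  "0 \<le> a \<Longrightarrow> 0 \<le> b \<Longrightarrow> 32 * ennreal a + 2 * ennreal b = ennreal (32 * a + 2 * b)"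
  by (simp add: ennreal_plus ennreal_mult)

lemma sum_energy_increments_le:
  assumes r: "mono r" "\<And>j. 0 < r j" and e: "(\<Sum>n. ennreal (weighted_energy g n)) = ennreal e" "0 \<le> e"
  shows "(\<Sum>j<J. (norm (g (r j) - g (r (Suc j))))\<^sup>2) \<le> 16 * e"
proof -
  have "(\<Sum>j<J. (norm (g (r j) - g (r (Suc j))))\<^sup>2) \<le> (\<Sum>j<J. 16 * (\<Sum>n\<in>{r j..<r (Suc j)}. weighted_energy g n))"
  proof (intro sum_mono)
    fix j
    have "1 \<le> r j" "r j \<le> r (Suc j)" using r(2)[of j] monoD[OF r(1), of j "Suc j"] by auto
    from norm_diff_le_sum_energy[OF this, of g]
    show "(norm (g (r j) - g (r (Suc j))))\<^sup>2 \<le> 16 * (\<Sum>n\<in>{r j..<r (Suc j)}. weighted_energy g n)"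
      by (simp add: norm_minus_commute)
  qed
  also have "\<dots> = 16 * (\<Sum>n\<in>{r 0..<r J}. weighted_energy g n)"
    by (simp add: sum_distrib_left[symmetric] sum_increments_eq[OF r(1)])
  also have "(\<Sum>n\<in>{r 0..<r J}. weighted_energy g n) \<le> e"
  proof -
    have "ennreal (\<Sum>n\<in>{r 0..<r J}. weighted_energy g n) = (\<Sum>n\<in>{r 0..<r J}. ennreal (weighted_energy g n))"
      by (rule sum_ennreal[symmetric]) (rule weighted_energy_nonneg)
    also have "\<dots> \<le> (\<Sum>n. ennreal (weighted_energy g n))" by (rule sum_le_suminf) auto
    finally show ?thesis using e by simp
  qed
  finally show ?thesis by simp
qed

text \<open>The difference \<open>x - y\<close> is bounded in 2-variation by the energy and hence in
  s-variation, and Minkowski's inequality adds \<open>y\<close>. The bound on \<open>y\<close> holds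
  for all large \<open>L\<close> whatever the indices, so a liminf, independent of \<open>r\<close>,
  replaces a choice of \<open>L\<close>.\<close>

lemma variation_norm_sq_le:
  fixes x y :: "nat \<Rightarrow> complex"
  assumes s: "2 < s" and v: "\<And>L. 0 \<le> v L"
    and y: "\<And>r J L. mono r \<Longrightarrow> r J \<le> L \<Longrightarrow>
      (\<Sum>j<J. norm (y (r j) - y (r (Suc j))) powr s) \<le> (sqrt (v L)) powr s"
  shows "(variation_norm s x)\<^sup>2 \<le> 32 * (\<Sum>n. ennreal (weighted_energy (\<lambda>n. x n - y n) n)) + 2 * liminf (\<lambda>L. ennreal (v L))"
    (is "_ \<le> ?U")
proof (cases "?U = \<infinity>")
  case False
  define g where "g = (\<lambda>n. x n - y n)"
  define l where "l = liminf (\<lambda>L. ennreal (v L))"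
  have "(\<Sum>n. ennreal (weighted_energy g n)) \<noteq> \<infinity>" using False by (auto simp: g_def ennreal_mult_eq_top_iff)
  then obtain e where e: "(\<Sum>n. ennreal (weighted_energy g n)) = ennreal e" "0 \<le> e"
    by (cases "\<Sum>n. ennreal (weighted_energy g n)") auto
  obtain u where u: "?U = ennreal u" "0 \<le> u" using False by (cases ?U) auto
  have bound: "(\<Sum>j<J. norm (x (r j) - x (r (Suc j))) powr s) \<le> u powr (s / 2)"
    if r: "mono r" "\<And>j. 0 < r j" for r J
  proof -
    define A where "A = (\<Sum>j<J. norm (x (r j) - x (r (Suc j))) powr s)"
    have A0: "0 \<le> A" by (simp add: A_def sum_nonneg)
    define q where "q = A powr (2 / s)"
    \<comment> \<open>Solved for \<open>v L\<close>, so that a constant lower bound passes to the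
      liminf; a negative value becomes 0 in \<open>ennreal\<close>, whence the \<open>max 0\<close>
      below.\<close>
    have "(q - 32 * e) / 2 \<le> v L" if L: "r J \<le> L" for L
    proof -
      have gs: "(\<Sum>j<J. norm (g (r j) - g (r (Suc j))) powr s) \<le> (sqrt (16 * e)) powr s"
        by (rule sum_powr_le_of_sum_squares) (use s sum_energy_increments_le[OF r e] in auto)
      have "(\<Sum>j<J. norm ((g (r j) - g (r (Suc j))) + (y (r j) - y (r (Suc j)))) powr s) \<le> (sqrt (16 * e) + sqrt (v L)) powr s"
        by (rule sum_norm_add_powr_le[OF _ _ _ _ gs y[OF r(1) L]]) (use s e v in auto)
      then have "A \<le> (sqrt (16 * e) + sqrt (v L)) powr s" by (simp add: A_def g_def)
      then have "q \<le> ((sqrt (16 * e) + sqrt (v L)) powr s) powr (2 / s)"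
        unfolding q_def using s A0 by (intro powr_mono2) auto
      also have "\<dots> = (sqrt (16 * e) + sqrt (v L)) powr 2" using s by (simp add: powr_powr)
      also have "\<dots> = (sqrt (16 * e) + sqrt (v L))\<^sup>2" using e v by simp
      also have "\<dots> \<le> 2 * (sqrt (16 * e))\<^sup>2 + 2 * (sqrt (v L))\<^sup>2"
        using zero_le_power2[of "sqrt (16 * e) - sqrt (v L)"] by (simp only: power2_eq_square algebra_simps)
      also have "\<dots> = 32 * e + 2 * v L" using e v by simp
      finally show ?thesis by simp
    qed
    then have "\<forall>\<^sub>F L in sequentially. ennreal ((q - 32 * e) / 2) \<le> ennreal (v L)"
      by (intro eventually_sequentiallyI[of "r J"] ennreal_leI)
    then have "ennreal ((q - 32 * e) / 2) \<le> l" unfolding l_def by (rule Liminf_bounded)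
    then have "32 * ennreal e + 2 * ennreal ((q - 32 * e) / 2) \<le> ennreal u"
      using u e by (simp add: g_def l_def[symmetric] mult_left_mono flip: u(1))
    moreover have "32 * ennreal e + 2 * ennreal ((q - 32 * e) / 2) = ennreal (32 * e + 2 * max 0 ((q - 32 * e) / 2))"
      using e by (simp add: ennreal_plus ennreal_mult max_def ennreal_neg)
    ultimately have "ennreal (32 * e + 2 * max 0 ((q - 32 * e) / 2)) \<le> ennreal u" by simp
    then have le_u: "32 * e + 2 * max 0 ((q - 32 * e) / 2) \<le> u" using u(2) by (subst (asm) ennreal_le_iff) auto
    have "q = 32 * e + 2 * ((q - 32 * e) / 2)" by (simp add: diff_divide_distrib)
    also have "\<dots> \<le> 32 * e + 2 * max 0 ((q - 32 * e) / 2)" by (intro add_left_mono mult_left_mono) auto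
    also note le_u
    finally have "q \<le> u" .
    then have "q powr (s / 2) \<le> u powr (s / 2)" using s by (intro powr_mono2) (auto simp: q_def)
    moreover have "q powr (s / 2) = A" using s A0 by (simp add: q_def powr_powr)
    ultimately show ?thesis by (simp add: A_def)
  qed
  have "variation_norm s x \<le> enn_powr ?U (1/2)"
    unfolding variation_norm_def
  proof (rule SUP_least)
    fix r :: "nat \<Rightarrow> nat" assume "r \<in> {r. mono r \<and> (\<forall>j. 0 < r j)}"
    then have r: "mono r" "\<And>j. 0 < r j" by auto
    define Z where "Z = (\<Sum>j. ennreal (norm (x (r j) - x (r (Suc j))) powr s))"
    have "Z \<le> ennreal (u powr (s / 2))"
      unfolding Z_def by (rule suminf_le_const) (auto simp: sum_ennreal intro!: ennreal_leI bound r)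
    then obtain b where b: "Z = ennreal b" "0 \<le> b" "b \<le> u powr (s / 2)"
      by (cases Z) (auto simp: top_unique)
    have "b powr (1 / s) \<le> (u powr (s / 2)) powr (1 / s)" using b(2,3) s by (intro powr_mono2) auto
    also have "\<dots> = u powr (1/2)" using s by (simp add: powr_powr)
    finally show "enn_powr (\<Sum>j. ennreal (norm (x (r j) - x (r (Suc j))) powr s)) (1 / s) \<le> enn_powr ?U (1/2)"
      unfolding Z_def[symmetric] b(1) u(1) using b(2) u(2) by (simp add: enn_powr_ennreal ennreal_leI)
  qed
  then have "(variation_norm s x)\<^sup>2 \<le> (enn_powr ?U (1/2))\<^sup>2" by (rule power_mono) simp
  then show ?thesis by (simp only: enn_powr_half_sq)
next
  case True
  show ?thesis unfolding True by simp
qed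

lemma oscillation_norm_sq_le:
  fixes x y :: "nat \<Rightarrow> complex"
  assumes N: "strict_mono N" "\<And>k. 0 < N k" and v: "\<And>k. 0 \<le> v k"
    and y: "\<And>k n. N k \<le> n \<Longrightarrow> n \<le> N (Suc k) \<Longrightarrow> (norm (y n - y (N k)))\<^sup>2 \<le> v k"
  shows "(oscillation_norm N 2 x)\<^sup>2 \<le> 32 * (\<Sum>n. ennreal (weighted_energy (\<lambda>n. x n - y n) n)) + 2 * (\<Sum>k. ennreal (v k))"
proof -
  define g where "g = (\<lambda>n. x n - y n)"
  define B where "B k = (\<Sum>n\<in>{N k..<N (Suc k)}. weighted_energy g n)" for k
  have B0: "0 \<le> B k" for k by (simp add: B_def sum_nonneg weighted_energy_nonneg)
  have mono: "mono N" using N(1) by (rule strict_mono_mono)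
  have le: "Max ((\<lambda>n. norm (x n - x (N k)) powr 2) ` {N k..N (Suc k)}) \<le> 32 * B k + 2 * v k" for k
  proof (subst Max_le_iff)
    show "\<forall>a\<in>(\<lambda>n. norm (x n - x (N k)) powr 2) ` {N k..N (Suc k)}. a \<le> 32 * B k + 2 * v k"
    proof safe
      fix n assume n: "n \<in> {N k..N (Suc k)}"
      have "(norm (g n - g (N k)))\<^sup>2 \<le> 16 * (\<Sum>n\<in>{N k..<n}. weighted_energy g n)"
        using n N(2)[of k] by (intro norm_diff_le_sum_energy) auto
      also have "(\<Sum>n\<in>{N k..<n}. weighted_energy g n) \<le> B k"
        unfolding B_def using n by (intro sum_mono2) (auto simp: weighted_energy_nonneg)
      finally have 1: "(norm (g n - g (N k)))\<^sup>2 \<le> 16 * B k" by simp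
      have 2: "(norm (y n - y (N k)))\<^sup>2 \<le> v k" using n by (intro y) auto
      have "norm (x n - x (N k)) \<le> norm (g n - g (N k)) + norm (y n - y (N k))"
        using norm_triangle_ineq[of "g n - g (N k)" "y n - y (N k)"] by (simp add: g_def)
      then have "(norm (x n - x (N k)))\<^sup>2 \<le> (norm (g n - g (N k)) + norm (y n - y (N k)))\<^sup>2"
        by (intro power_mono) auto
      also have "\<dots> \<le> 2 * (norm (g n - g (N k)))\<^sup>2 + 2 * (norm (y n - y (N k)))\<^sup>2"
        using zero_le_power2[of "norm (g n - g (N k)) - norm (y n - y (N k))"]
        by (simp add: power2_eq_square algebra_simps)
      finally have "(norm (x n - x (N k)))\<^sup>2 \<le> 32 * B k + 2 * v k" using 1 2 by linarith
      then show "norm (x n - x (N k)) powr 2 \<le> 32 * B k + 2 * v k" by simp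
    qed
  qed (use monoD[OF mono, of k "Suc k"] in auto)
  have "(oscillation_norm N 2 x)\<^sup>2 = (\<Sum>k. ennreal (Max ((\<lambda>n. norm (x n - x (N k)) powr 2) ` {N k..N (Suc k)})))"
    unfolding oscillation_norm_def by (rule enn_powr_half_sq)
  also have "\<dots> \<le> (\<Sum>k. 32 * ennreal (B k) + 2 * ennreal (v k))"
  proof (intro suminf_le)
    show "ennreal (Max ((\<lambda>n. norm (x n - x (N k)) powr 2) ` {N k..N (Suc k)})) \<le> 32 * ennreal (B k) + 2 * ennreal (v k)" for k
      using ennreal_leI[OF le[of k]] B0[of k] v[of k] by (simp add: ennreal_plus ennreal_mult)
  qed auto
  also have "\<dots> = 32 * (\<Sum>k. ennreal (B k)) + 2 * (\<Sum>k. ennreal (v k))"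
    by (simp add: suminf_add[symmetric] ennreal_suminf_cmult)
  also have "(\<Sum>k. ennreal (B k)) \<le> (\<Sum>n. ennreal (weighted_energy g n))"
  proof (rule suminf_le_const)
    fix K
    have "(\<Sum>k<K. ennreal (B k)) = (\<Sum>k<K. \<Sum>n\<in>{N k..<N (Suc k)}. ennreal (weighted_energy g n))"
      by (simp add: B_def sum_ennreal weighted_energy_nonneg)
    also have "\<dots> = (\<Sum>n\<in>{N 0..<N K}. ennreal (weighted_energy g n))" by (rule sum_increments_eq[OF mono])
    also have "\<dots> \<le> (\<Sum>n. ennreal (weighted_energy g n))" by (rule sum_le_suminf) auto
    finally show "(\<Sum>k<K. ennreal (B k)) \<le> (\<Sum>n. ennreal (weighted_energy g n))" .
  qed simp
  finally show ?thesis by (simp add: g_def add_mono mult_left_mono)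
qed

text \<open>The first two sums control the increments of each process, hence those of their
  difference; the third controls the difference itself. Together they are the symbols of
  \<open>weighted_energy\<close>, with the term of 1/n at n = 0 equal to 0.\<close>

definition multiplier_bound :: "(nat \<Rightarrow> int pmf) \<Rightarrow> real \<Rightarrow> bool" where
  "multiplier_bound P B \<longleftrightarrow> 0 \<le> B \<and> (\<forall>t\<in>{-1/2..<1/2}. \<forall>K. let Q = walk_pmf (\<lambda>_. lazy_pmf) in
     (\<Sum>n<K. real n * (norm (charfun (P (Suc n)) t - charfun (P n) t))\<^sup>2) \<le> B \<and>
     (\<Sum>n<K. real n * (norm (charfun (Q (Suc n)) t - charfun (Q n) t))\<^sup>2) \<le> B \<and>
     (\<Sum>n<K. 1 / real n * (norm (charfun (P n) t - charfun (Q n) t))\<^sup>2) \<le> B)"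

lemma multiplier_bound_walk:
  assumes mean: "\<And>n. n \<ge> 1 \<Longrightarrow> mean (\<nu> n) = 0"
    and moments: "\<exists>K::real. \<forall>\<^sub>F n in sequentially. (\<Sum>i=1..n. (abs_moment 2 (\<nu> i))\<^sup>2) \<le> ennreal (K * real n)"
    and decay: "\<exists>c::real. c > 0 \<and> (\<exists>N\<^sub>0::nat. N\<^sub>0 > 0 \<and>
         (\<forall>n>N\<^sub>0. \<forall>t\<in>{-1/2..<1/2}. norm (fourier (\<nu> n) t) \<le> exp (- c * t\<^sup>2)))"
  obtains B where "multiplier_bound (walk_pmf \<nu>) B"
proof -
  obtain c N\<^sub>0 where c: "0 < c" and dec: "\<And>n t. n > N\<^sub>0 \<Longrightarrow> t \<in> {-1/2..<1/2} \<Longrightarrow> norm (charfun (\<nu> n) t) \<le> exp (- c * t\<^sup>2)"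
    using decay[unfolded fourier_eq_charfun] by blast
  obtain K where K: "0 \<le> K" "\<And>i. 1 \<le> i \<Longrightarrow> abs_moment 2 (\<nu> i) \<noteq> \<infinity>"
    "\<And>n. (\<Sum>k<n. (\<integral>j. (real_of_int j)\<^sup>2 \<partial>\<nu> (Suc k))\<^sup>2) \<le> K * real n"
    using second_moment_bound[OF moments] by blast
  define A where "A = exp (c * real N\<^sub>0)"
  \<comment> \<open>Common constants for both walks: the lazy walk decays at rate 1 and has moment
    constant pi^4.\<close>
  define c' where "c' = min c 1"
  define K' where "K' = 4 * pi ^ 4 * K + pi ^ 4"
  have A: "1 \<le> A" using c by (simp add: A_def)
  have c': "0 < c'" using c by (simp add: c'_def)
  have K': "0 \<le> K'" using K by (simp add: K'_def)
  define B1 where "B1 = A\<^sup>2 / c' * K' * (1 + 1 / c')"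
  define B2 where "B2 = 4 * sqrt K' * A * (1 + 1 / c')"
  have B: "0 \<le> B1" "0 \<le> B2" using A c' K' by (auto simp: B1_def B2_def)
  let ?Q = "walk_pmf (\<lambda>_. lazy_pmf)"
  have "multiplier_bound (walk_pmf \<nu>) (B1 + B2)"
    unfolding multiplier_bound_def Let_def
  proof (intro conjI ballI allI)
    fix t :: real and n assume t: "t \<in> {-1/2..<1/2}"
    interpret P: symbol "\<lambda>n. charfun (walk_pmf \<nu> n) t" "\<lambda>n. charfun (\<nu> (Suc n)) t"
      "\<lambda>n. 2 * pi\<^sup>2 * (\<integral>j. (real_of_int j)\<^sup>2 \<partial>\<nu> (Suc n))" A c' K' "t\<^sup>2"
      by (rule symbol_mono[OF symbol_walk[OF mean K c dec t]]) (use t c' in \<open>auto simp: A_def K'_def c'_def\<close>)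
    interpret Q: symbol "\<lambda>n. charfun (?Q n) t" "\<lambda>n. charfun lazy_pmf t" "\<lambda>n. pi\<^sup>2" A c' K' "t\<^sup>2"
      by (rule symbol_mono[OF symbol_lazy[OF t]]) (use A K c' in \<open>auto simp: K'_def c'_def\<close>)
    show "(\<Sum>k<n. real k * (norm (charfun (walk_pmf \<nu> (Suc k)) t - charfun (walk_pmf \<nu> k) t))\<^sup>2) \<le> B1 + B2"
      using P.sum_weighted_increments_le[of n] B unfolding B1_def[symmetric] by linarith
    show "(\<Sum>k<n. real k * (norm (charfun (?Q (Suc k)) t - charfun (?Q k) t))\<^sup>2) \<le> B1 + B2"
      using Q.sum_weighted_increments_le[of n] B unfolding B1_def[symmetric] by linarith
    show "(\<Sum>k<n. 1 / real k * (norm (charfun (walk_pmf \<nu> k) t - charfun (?Q k) t))\<^sup>2) \<le> B1 + B2"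
      using sum_symbol_diff_le[OF P.symbol_axioms Q.symbol_axioms, of n] B unfolding B2_def[symmetric] by linarith
  qed (use B in simp)
  then show ?thesis by (rule that)
qed

section \<open>From pointwise to integrated inequalities\<close>

context square_integrable_observable
begin

definition comparison_energy :: "(nat \<Rightarrow> int pmf) \<Rightarrow> 'a \<Rightarrow> ennreal" where
  "comparison_energy P x = (\<Sum>n. ennreal (weighted_energy (\<lambda>n. average (P n) x - lazy_average n (orbit x)) n))"

lemma lazy_average_eq_average: "lazy_average n (orbit x) = average (walk_pmf (\<lambda>_. lazy_pmf) n) x"
  by (simp add: average_def integral_walk_lazy)

lemma comparison_energy_measurable [measurable]: "comparison_energy P \<in> borel_measurable M"
  unfolding comparison_energy_def[abs_def] weighted_energy_def lazy_average_eq_average by measurable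

text \<open>The increment of a difference is split as (a + b)^2 \<le> 2 a^2 + 2 b^2, so the three
  multiplier sums enter with weights 2, 2 and 1, which add up to 5.\<close>

lemma nn_integral_comparison_energy:
  assumes "multiplier_bound P B"
  shows "(\<integral>\<^sup>+x. comparison_energy P x \<partial>M) \<le> ennreal (5 * B * energy)"
proof -
  let ?Q = "walk_pmf (\<lambda>_. lazy_pmf)"
  have B: "0 \<le> B" using assms by (simp add: multiplier_bound_def)
  define S where "S c P' Q' x = (\<Sum>n. ennreal (c n * (norm (average (P' n) x - average (Q' n) x))\<^sup>2))"
    for c :: "nat \<Rightarrow> real" and P' Q' x
  have S_meas [measurable]: "S c P' Q' \<in> borel_measurable M" for c P' Q'
    unfolding S_def[abs_def] by measurable
  have 1: "(\<integral>\<^sup>+x. S real (\<lambda>n. P (Suc n)) P x \<partial>M) \<le> ennreal (B * energy)"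
    unfolding S_def by (rule square_function_le) (use assms in \<open>auto simp: multiplier_bound_def Let_def\<close>)
  have 2: "(\<integral>\<^sup>+x. S real (\<lambda>n. ?Q (Suc n)) ?Q x \<partial>M) \<le> ennreal (B * energy)"
    unfolding S_def by (rule square_function_le) (use assms in \<open>auto simp: multiplier_bound_def Let_def simp del: walk_pmf.simps\<close>)
  have 3: "(\<integral>\<^sup>+x. S (\<lambda>n. 1 / real n) P ?Q x \<partial>M) \<le> ennreal (B * energy)"
    unfolding S_def by (rule square_function_le) (use assms in \<open>auto simp: multiplier_bound_def Let_def\<close>)
  have pt: "comparison_energy P x \<le> 2 * S real (\<lambda>n. P (Suc n)) P x + 2 * S real (\<lambda>n. ?Q (Suc n)) ?Q x + S (\<lambda>n. 1 / real n) P ?Q x" for x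
  proof -
    let ?p = "\<lambda>n. average (P n) x" and ?q = "\<lambda>n. average (?Q n) x"
    have "ennreal (weighted_energy (\<lambda>n. ?p n - ?q n) n) \<le> 2 * ennreal (real n * (norm (?p (Suc n) - ?p n))\<^sup>2)
        + 2 * ennreal (real n * (norm (?q (Suc n) - ?q n))\<^sup>2) + ennreal (1 / real n * (norm (?p n - ?q n))\<^sup>2)" for n
    proof -
      have "norm ((?p (Suc n) - ?q (Suc n)) - (?p n - ?q n)) = norm ((?p (Suc n) - ?p n) - (?q (Suc n) - ?q n))"
        by (simp add: algebra_simps)
      also have "\<dots> \<le> norm (?p (Suc n) - ?p n) + norm (?q (Suc n) - ?q n)" by (rule norm_triangle_ineq4)
      finally have "(norm ((?p (Suc n) - ?q (Suc n)) - (?p n - ?q n)))\<^sup>2 \<le> (norm (?p (Suc n) - ?p n) + norm (?q (Suc n) - ?q n))\<^sup>2"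
        by (intro power_mono) auto
      also have "\<dots> \<le> 2 * (norm (?p (Suc n) - ?p n))\<^sup>2 + 2 * (norm (?q (Suc n) - ?q n))\<^sup>2"
        using zero_le_power2[of "norm (?p (Suc n) - ?p n) - norm (?q (Suc n) - ?q n)"]
        by (simp add: power2_eq_square algebra_simps)
      finally have "real n * (norm ((?p (Suc n) - ?q (Suc n)) - (?p n - ?q n)))\<^sup>2
          \<le> real n * (2 * (norm (?p (Suc n) - ?p n))\<^sup>2 + 2 * (norm (?q (Suc n) - ?q n))\<^sup>2)"
        by (intro mult_left_mono) auto
      then have "weighted_energy (\<lambda>n. ?p n - ?q n) n \<le> 2 * (real n * (norm (?p (Suc n) - ?p n))\<^sup>2)
        + 2 * (real n * (norm (?q (Suc n) - ?q n))\<^sup>2) + 1 / real n * (norm (?p n - ?q n))\<^sup>2"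
        by (simp add: weighted_energy_def algebra_simps del: walk_pmf.simps)
      then have "ennreal (weighted_energy (\<lambda>n. ?p n - ?q n) n) \<le> ennreal (2 * (real n * (norm (?p (Suc n) - ?p n))\<^sup>2)
        + 2 * (real n * (norm (?q (Suc n) - ?q n))\<^sup>2) + 1 / real n * (norm (?p n - ?q n))\<^sup>2)"
        by (rule ennreal_leI)
      then show ?thesis by (simp add: ennreal_plus ennreal_mult' del: walk_pmf.simps)
    qed
    then have "comparison_energy P x \<le> (\<Sum>n. 2 * ennreal (real n * (norm (?p (Suc n) - ?p n))\<^sup>2)
        + 2 * ennreal (real n * (norm (?q (Suc n) - ?q n))\<^sup>2) + ennreal (1 / real n * (norm (?p n - ?q n))\<^sup>2))"
      unfolding comparison_energy_def lazy_average_eq_average by (intro suminf_le) auto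
    also have "\<dots> = 2 * S real (\<lambda>n. P (Suc n)) P x + 2 * S real (\<lambda>n. ?Q (Suc n)) ?Q x + S (\<lambda>n. 1 / real n) P ?Q x"
      unfolding S_def by (simp add: suminf_add[symmetric] ennreal_suminf_cmult del: walk_pmf.simps)
    finally show ?thesis .
  qed
  have "(\<integral>\<^sup>+x. comparison_energy P x \<partial>M) \<le> (\<integral>\<^sup>+x. 2 * S real (\<lambda>n. P (Suc n)) P x + 2 * S real (\<lambda>n. ?Q (Suc n)) ?Q x + S (\<lambda>n. 1 / real n) P ?Q x \<partial>M)"
    by (intro nn_integral_mono pt)
  also have "\<dots> = 2 * (\<integral>\<^sup>+x. S real (\<lambda>n. P (Suc n)) P x \<partial>M) + 2 * (\<integral>\<^sup>+x. S real (\<lambda>n. ?Q (Suc n)) ?Q x \<partial>M)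
      + (\<integral>\<^sup>+x. S (\<lambda>n. 1 / real n) P ?Q x \<partial>M)"
    by (simp add: nn_integral_add nn_integral_cmult del: walk_pmf.simps)
  also have "\<dots> \<le> 2 * ennreal (B * energy) + 2 * ennreal (B * energy) + ennreal (B * energy)"
    by (intro add_mono mult_left_mono 1 2 3) auto
  also have "\<dots> = 5 * ennreal (B * energy)"
  proof -
    have "2 * a + 2 * a + 1 * a = (2 + 2 + 1) * a" for a :: ennreal by (simp only: distrib_right)
    then show ?thesis by simp
  qed
  also have "\<dots> = ennreal (5 * B * energy)" using B energy_nonneg by (simp add: ennreal_mult mult.assoc)
  finally show ?thesis .
qed

text \<open>Fatou's lemma carries the bound, uniform in \<open>L\<close>, through the liminf over
  the number of tosses; 160 is 32 * 5.\<close>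

lemma variation_norm_average_le:
  assumes s: "2 < s" and B: "multiplier_bound P B"
  shows "(\<integral>\<^sup>+x. (variation_norm s (\<lambda>n. average (P n) x))\<^sup>2 \<partial>M) \<le> ennreal ((160 * B + 2 * variation_const s) * energy)"
proof -
  have "(\<integral>\<^sup>+x. (variation_norm s (\<lambda>n. average (P n) x))\<^sup>2 \<partial>M)
      \<le> (\<integral>\<^sup>+x. 32 * comparison_energy P x + 2 * liminf (\<lambda>L. ennreal (variation_bound s L (orbit x))) \<partial>M)"
    unfolding comparison_energy_def
    by (intro nn_integral_mono variation_norm_sq_le s variation_bound_nonneg lazy_average_variation_le)
  also have "\<dots> = 32 * (\<integral>\<^sup>+x. comparison_energy P x \<partial>M) + 2 * (\<integral>\<^sup>+x. liminf (\<lambda>L. ennreal (variation_bound s L (orbit x))) \<partial>M)"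
    by (simp add: nn_integral_add nn_integral_cmult)
  also have "(\<integral>\<^sup>+x. liminf (\<lambda>L. ennreal (variation_bound s L (orbit x))) \<partial>M) \<le> liminf (\<lambda>L. \<integral>\<^sup>+x. ennreal (variation_bound s L (orbit x)) \<partial>M)"
    by (rule nn_integral_liminf) measurable
  also have "\<dots> \<le> liminf (\<lambda>L. ennreal (variation_const s * energy))"
    by (intro Liminf_mono always_eventually allI nn_integral_variation_bound s)
  also have "\<dots> = ennreal (variation_const s * energy)" by (simp add: Liminf_const)
  finally have "(\<integral>\<^sup>+x. (variation_norm s (\<lambda>n. average (P n) x))\<^sup>2 \<partial>M)
      \<le> 32 * (\<integral>\<^sup>+x. comparison_energy P x \<partial>M) + 2 * ennreal (variation_const s * energy)"
    by (simp add: add_mono mult_left_mono)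
  also have "\<dots> \<le> 32 * ennreal (5 * B * energy) + 2 * ennreal (variation_const s * energy)"
    by (intro add_mono mult_left_mono nn_integral_comparison_energy B) auto
  also have "\<dots> = ennreal (32 * (5 * B * energy) + 2 * (variation_const s * energy))"
    using B energy_nonneg variation_const_nonneg[OF s]
    by (intro ennreal_add_multiples) (auto simp: multiplier_bound_def)
  finally show ?thesis by (simp add: algebra_simps)
qed

text \<open>The energy drops over consecutive blocks telescope to at most \<open>energy\<close>, so
  the constant is the same for every sequence \<open>N\<close>.\<close>

lemma oscillation_norm_average_le:
  assumes N: "strict_mono N" "\<And>k. 0 < N k" and B: "multiplier_bound P B"
  shows "(\<integral>\<^sup>+x. (oscillation_norm N 2 (\<lambda>n. average (P n) x))\<^sup>2 \<partial>M) \<le> ennreal ((160 * B + 32) * energy)"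
proof -
  have step: "N k \<le> N (Suc k)" for k using strict_monoD[OF N(1), of k "Suc k"] by simp
  have "(\<integral>\<^sup>+x. (oscillation_norm N 2 (\<lambda>n. average (P n) x))\<^sup>2 \<partial>M)
      \<le> (\<integral>\<^sup>+x. 32 * comparison_energy P x + 2 * (\<Sum>k. ennreal (oscillation_bound (N k) (N (Suc k)) (orbit x))) \<partial>M)"
    unfolding comparison_energy_def
    by (intro nn_integral_mono oscillation_norm_sq_le N oscillation_bound_nonneg lazy_average_oscillation_le)
  also have "\<dots> = 32 * (\<integral>\<^sup>+x. comparison_energy P x \<partial>M) + 2 * (\<Sum>k. \<integral>\<^sup>+x. ennreal (oscillation_bound (N k) (N (Suc k)) (orbit x)) \<partial>M)"
    by (simp add: nn_integral_add nn_integral_cmult nn_integral_suminf)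
  also have "\<dots> \<le> 32 * ennreal (5 * B * energy) + 2 * ennreal (16 * energy)"
  proof (intro add_mono mult_left_mono nn_integral_comparison_energy B)
    show "(\<Sum>k. \<integral>\<^sup>+x. ennreal (oscillation_bound (N k) (N (Suc k)) (orbit x)) \<partial>M) \<le> ennreal (16 * energy)"
    proof (rule suminf_le_const)
      fix K
      have tele: "(\<Sum>k<K. 16 * (bwd_energy (N k) - bwd_energy (N (Suc k)))) = 16 * (bwd_energy (N 0) - bwd_energy (N K))"
        by (induction K) auto
      have "(\<Sum>k<K. \<integral>\<^sup>+x. ennreal (oscillation_bound (N k) (N (Suc k)) (orbit x)) \<partial>M)
          \<le> (\<Sum>k<K. ennreal (16 * (bwd_energy (N k) - bwd_energy (N (Suc k)))))"
        by (intro sum_mono nn_integral_oscillation_bound step)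
      also have "\<dots> = ennreal (16 * (bwd_energy (N 0) - bwd_energy (N K)))"
        unfolding tele[symmetric] by (rule sum_ennreal) (use bwd_energy_antimono[OF step] in simp)
      also have "\<dots> \<le> ennreal (16 * energy)"
        using bwd_energy_antimono[of 0 "N 0"] bwd_energy_nonneg[of "N K"] by (intro ennreal_leI) (simp add: bwd_energy_0)
      finally show "(\<Sum>k<K. \<integral>\<^sup>+x. ennreal (oscillation_bound (N k) (N (Suc k)) (orbit x)) \<partial>M) \<le> ennreal (16 * energy)" .
    qed simp
  qed auto
  also have "\<dots> = ennreal (32 * (5 * B * energy) + 2 * (16 * energy))"
    using B energy_nonneg by (intro ennreal_add_multiples) (auto simp: multiplier_bound_def)
  finally show ?thesis by (simp add: algebra_simps)
qed

lemma L2_norm_f: "L2_norm M (\<lambda>x. ennreal (norm (f x))) = ennreal (sqrt energy)"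
  using nn_integral_energy energy_nonneg
  by (simp add: L2_norm_def ennreal_power enn_powr_ennreal powr_half_sqrt)

lemma L2_norm_le:
  assumes "(\<integral>\<^sup>+x. (G x)\<^sup>2 \<partial>M) \<le> ennreal (C * energy)" "0 \<le> C" "sqrt C \<le> D"
  shows "L2_norm M G \<le> ennreal D * L2_norm M (\<lambda>x. ennreal (norm (f x)))"
proof -
  have "L2_norm M G \<le> enn_powr (ennreal (C * energy)) (1/2)"
    unfolding L2_norm_def by (intro enn_powr_half_mono assms)
  also have "\<dots> = ennreal (sqrt C * sqrt energy)"
    using assms energy_nonneg by (simp add: enn_powr_ennreal powr_half_sqrt real_sqrt_mult)
  also have "\<dots> \<le> ennreal (D * sqrt energy)"
    using assms energy_nonneg by (intro ennreal_leI mult_right_mono) auto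
  also have "\<dots> = ennreal D * ennreal (sqrt energy)"
    using assms energy_nonneg order_trans[OF real_sqrt_ge_zero assms(3)] by (intro ennreal_mult) auto
  finally show ?thesis by (simp add: L2_norm_f)
qed

text \<open>Valid at every point, including those where the series diverges: sum and integral have
  the same default value 0.\<close>

lemma weighted_average_eq: "weighted_average M T (conv_prod \<nu> n) f x = average (walk_pmf \<nu> n) x"
  by (simp add: weighted_average_def conv_prod_eq_pmf integral_pmf_eq_infsum average_def orbit_def)

end

theorem theorem1p7:
  fixes \<nu> :: "nat \<Rightarrow> int pmf" and M :: "'a measure" and T :: "'a \<Rightarrow> 'a"
    and s :: real and N :: "nat \<Rightarrow> nat"
  assumes aperiodic: "\<And>n. n \<ge> 1 \<Longrightarrow> strictly_aperiodic (\<nu> n)"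
    and mean_zero: "\<And>n. n \<ge> 1 \<Longrightarrow> mean (\<nu> n) = 0"
    and second_moments:
      "\<exists>K::real. \<forall>\<^sub>F n in sequentially. (\<Sum>i=1..n. (abs_moment 2 (\<nu> i))\<^sup>2) \<le> ennreal (K * real n)"
    and fourier_decay:
      "\<exists>c::real. c > 0 \<and> (\<exists>N\<^sub>0::nat. N\<^sub>0 > 0 \<and>
         (\<forall>n>N\<^sub>0. \<forall>t\<in>{-1/2..<1/2}. norm (fourier (\<nu> n) t) \<le> exp (- c * t\<^sup>2)))"
    and prob: "prob_space M"
    and T: "invertible_measure_preserving M T"
    and s: "2 < s"
    and N: "strict_mono N" "\<And>k. 0 < N k"
  shows "\<exists>C::real. \<forall>f. in_L2 M f \<longrightarrow>
      L2_norm M (\<lambda>x. variation_norm s (\<lambda>n. weighted_average M T (conv_prod \<nu> n) f x))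
        \<le> ennreal C * L2_norm M (\<lambda>x. ennreal (norm (f x))) \<and>
      L2_norm M (\<lambda>x. oscillation_norm N 2 (\<lambda>n. weighted_average M T (conv_prod \<nu> n) f x))
        \<le> ennreal C * L2_norm M (\<lambda>x. ennreal (norm (f x)))"
proof -
  obtain B where B: "multiplier_bound (walk_pmf \<nu>) B"
    using multiplier_bound_walk[OF mean_zero second_moments fourier_decay] .
  then have B0: "0 \<le> B" by (simp add: multiplier_bound_def)
  interpret measure_preserving_system M T
    using prob T by (simp add: measure_preserving_system_def measure_preserving_system_axioms_def)
  define C where "C = sqrt (160 * B + 2 * variation_const s) + sqrt (160 * B + 32)"
  show ?thesis
  proof (intro exI[of _ C] allI impI)
    fix f :: "'a \<Rightarrow> complex" assume f: "in_L2 M f"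
    have "(\<integral>\<^sup>+x. ennreal ((norm (f x))\<^sup>2) \<partial>M) < \<infinity>"
      using f by (auto simp: in_L2_def L2_norm_def enn_powr_def ennreal_power top.not_eq_extremum split: if_splits)
    then interpret square_integrable_observable M T f
      using f by unfold_locales (auto simp: in_L2_def)
    show "L2_norm M (\<lambda>x. variation_norm s (\<lambda>n. weighted_average M T (conv_prod \<nu> n) f x))
        \<le> ennreal C * L2_norm M (\<lambda>x. ennreal (norm (f x))) \<and>
      L2_norm M (\<lambda>x. oscillation_norm N 2 (\<lambda>n. weighted_average M T (conv_prod \<nu> n) f x))
        \<le> ennreal C * L2_norm M (\<lambda>x. ennreal (norm (f x)))"
      unfolding weighted_average_eq
      using variation_const_nonneg[OF s] B0
      by (intro conjI L2_norm_le[OF variation_norm_average_le[OF s B]] L2_norm_le[OF oscillation_norm_average_le[OF N B]])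
         (auto simp: C_def)
  qed
qed

end
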